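(* Let $\mathbf{x}_1,\dots,\mathbf{x}_n\in\mathbb{R}^d$ be fixed and let $\mathbf{y}_1,\dots,\mathbf{y}_n$ be independent (not necessarily identically distributed) real random variables for which there is a constant $\sigma\ge0$ with $\mathbf{E}e^{t(\mathbf{y}_i-\mathbf{E}\mathbf{y}_i)}\le e^{\sigma^2t^2/2}$ for all $i$ and all $t\in\mathbb{R}$. Let $\hat A=\frac1n\sum_{i=1}^n\mathbf{x}_i\mathbf{x}_i^T$ and $a=(\sup_j\hat A_{j,j})^{1/2}$. Consider any target vector $\bar\beta\in\mathbb{R}^d$ such that $\mathbf{E}\mathbf{y}_i=\bar\beta^T\mathbf{x}_i$ for all $i$ and such that $\bar\beta$ contains only $s$ nonzeros. Let $\lambda\ge0$ be the regularization parameter, let $\alpha$ be the threshold, let $k=|\mathrm{supp}_\lambda(\bar\beta)|$, and consider the two-stage selective penalization procedure with tuning parameters $\lambda,\alpha$: Stage 1: $\hat\beta=\arg\min_{\beta\in\mathbb{R}^d}\big[\frac1n\sum_{i=1}^n(\beta^T\mathbf{x}_i-\mathbf{y}_i)^2+\lambda\|\beta\|_1\big]$; Stage 2: $\hat\beta'=\arg\min_{\beta\in\mathbb{R}^d}\big[\frac1n\sum_{i=1}^n(\beta^T\mathbf{x}_i-\mathbf{y}_i)^2+\lambda\sum_{j\notin\mathrm{supp}_\alpha(\hat\beta)}|\beta_j|\big]$. Given $\delta\in(0,0.5)$, with probability larger than $1-2\delta$, for all integers $\ell$ with $(d-s)/2\ge\ell\ge s$, all $t\in(0,1)$ and all $p\in[1,\infty]$,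 if - $t\le1-\pi^{(2)}_{\hat A,k+\ell,\ell}k^{0.5}/\ell$; - $0.5\alpha\ge\lambda\ge4(2-t)t^{-1}\sigma a\sqrt{2\ln(2d/\delta)/n}$; - either $16(\alpha\,\omega^{(p)}_{\hat A,s+\ell})^{-1}s^{1/p}\lambda\le t\le1-\pi^{(p)}_{\hat A,s+\ell,\ell}s^{1-1/p}/\ell$, or $16(\alpha\,\mu^{(p)}_{\hat A,s+\ell})^{-1}(s+\ell)^{1/p}\lambda\le t\le1-\gamma^{(p)}_{\hat A,s+\ell,\ell}s^{1-1/p}/\ell$; then $$\|\hat\beta'-\bar\beta\|_2\le\frac{8}{t\mu^{(2)}_{\hat A,k+\ell}}\Big[5\rho^{(2)}_{\hat A,k+\ell}r_k^{(2)}(\bar\beta)+\sqrt{k-q}\,\lambda+a\sigma\big(1+\sqrt{20\ln(1/\delta)}\big)\sqrt{q/n}\Big]+8r_k^{(2)}(\bar\beta),$$ where $q=|\mathrm{supp}_{1.5\alpha}(\bar\beta)|$.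
   Context: For $\beta\in\mathbb{R}^d$ and $\alpha\ge0$, $\mathrm{supp}_\alpha(\beta)=\{j:|\beta_j|>\alpha\}$. With $|\beta_{(1)}|\ge\cdots\ge|\beta_{(d)}|$ in descending order, $r_k^{(p)}(\beta)=\big(\sum_{j=k+1}^d|\beta_{(j)}|^p\big)^{1/p}$. $\|\cdot\|_p$ is the usual $\ell_p$ norm; $1/\infty=0$. For a positive semi-definite $A\in\mathbb{R}^{d\times d}$ and $k,\ell\ge1$ with $k+\ell\le d$ (generic block sizes here), let $I,J$ range over disjoint subsets of $\{1,\dots,d\}$ with $k$ and $\ell$ elements, $A_{I,J}$ be the restriction of $A$ to row indices $I$ and column indices $J$, and $\mathbf{v}\in\mathbb{R}^k$, $\mathbf{u}\in\mathbb{R}^\ell$ range over (nonzero) vectors. Define $$\rho^{(p)}_{A,k}=\sup_{\mathbf{v},I}\frac{\|A_{I,I}\mathbf{v}\|_p}{\|\mathbf{v}\|_p},\quad \mu^{(p)}_{A,k}=\inf_{\mathbf{v},I}\frac{\|A_{I,I}\mathbf{v}\|_p}{\|\mathbf{v}\|_p},\quad \gamma^{(p)}_{A,k,\ell}=\sup_{\mathbf{u},I,J}\frac{\|A_{I,I}^{-1}A_{I,J}\mathbf{u}\|_p}{\|\mathbf{u}\|_\infty}.$$ With $\mathbf{v}^{p-1}=[|\mathbf{v}_1|^{p-1}\mathrm{sgn}(\mathbf{v}_1),\dots,|\mathbf{v}_k|^{p-1}\mathrm{sgn}(\mathbf{v}_k)]$, $$\omega^{(p)}_{A,k}=\inf_{\mathbf{v},I}\frac{\max(0,\mathbf{v}^TA_{I,I}\mathbf{v}^{p-1})}{\|\mathbf{v}\|_p^p},\qquad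 \pi^{(p)}_{A,k,\ell}=\sup_{\mathbf{v},\mathbf{u},I,J}\frac{(\mathbf{v}^{p-1})^TA_{I,J}\mathbf{u}\,\|\mathbf{v}\|_p}{\max(0,\mathbf{v}^TA_{I,I}\mathbf{v}^{p-1})\,\|\mathbf{u}\|_\infty}.$$ Reading conventions: a ratio with zero denominator is $+\infty$; $\gamma^{(p)}_{A,k,\ell}=+\infty$ if some $A_{I,I}$ with $|I|=k$ is singular; for $p=\infty$ the vector $\mathbf{v}^{p-1}/\|\mathbf{v}\|_p^{p-1}$ is understood as its limit as $p\to\infty$, i.e. the vector with entries $\mathrm{sgn}(\mathbf{v}_i)/m$ where $|\mathbf{v}_i|=\|\mathbf{v}\|_\infty$ ($m$ being the number of such $i$) and $0$ elsewhere.
   Formalization: When λ=0 the Stage 1 minimizer is assumed to be unique; without this the argmin is not well defined and the bound fails for some minimizers (singular Â, zero noise). For λ>0 the bound is proved for every choice of minimizers. *)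

theory Defs
  imports "HOL-Probability.Probability"
begin

definition supp_above :: "real \<Rightarrow> real^'d \<Rightarrow> 'd set" where
  "supp_above \<alpha> \<beta> = {j. \<bar>\<beta> $ j\<bar> > \<alpha>}"

text \<open>The entries of \<open>\<beta>\<close> in absolute value, with multiplicity, in descending order.\<close>

definition abs_desc :: "real^'d \<Rightarrow> real list" where
  "abs_desc \<beta> = rev (sorted_list_of_multiset (image_mset (\<lambda>j. \<bar>\<beta> $ j\<bar>) (mset_set UNIV)))"

definition tail_norm :: "real \<Rightarrow> nat \<Rightarrow> real^'d \<Rightarrow> real" where
  "tail_norm p k \<beta> = (\<Sum>x\<leftarrow>drop k (abs_desc \<beta>). x powr p) powr (1 / p)"

text \<open>The exponents \<open>p\<close> range over \<open>[1,\<infinity>]\<close>, as extended reals.\<close>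

definition lp_norm :: "ereal \<Rightarrow> real^'d \<Rightarrow> real" where
  "lp_norm p v =
     (if p = \<infinity> then Max (range (\<lambda>j. \<bar>v $ j\<bar>))
      else (\<Sum>j\<in>UNIV. \<bar>v $ j\<bar> powr real_of_ereal p) powr (1 / real_of_ereal p))"

text \<open>A vector in \<open>\<real>\<^sup>k\<close> indexed by a \<open>k\<close>-element set \<open>I\<close> of coordinates is represented by the vector
  in \<open>\<real>\<^sup>d\<close> that vanishes outside \<open>I\<close>, and the block \<open>A\<^sub>I\<^sub>,\<^sub>J\<close> by the matrix that vanishes outside
  \<open>I \<times> J\<close>. Thus \<open>sub_matrix (mat 1) I I\<close> is the identity of the block indexed by \<open>I\<close>, and
  invertibility of \<open>A\<^sub>I\<^sub>,\<^sub>I\<close> is meant inside that block.\<close>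

definition vec_on :: "'d set \<Rightarrow> real^'d \<Rightarrow> bool" where
  "vec_on I v \<longleftrightarrow> (\<forall>j. j \<notin> I \<longrightarrow> v $ j = 0)"

definition sub_matrix :: "real^'d^'d \<Rightarrow> 'd set \<Rightarrow> 'd set \<Rightarrow> real^'d^'d" where
  "sub_matrix A I J = (\<chi> i j. if i \<in> I \<and> j \<in> J then A $ i $ j else 0)"

definition is_block_inverse :: "real^'d^'d \<Rightarrow> 'd set \<Rightarrow> real^'d^'d \<Rightarrow> bool" where
  "is_block_inverse A I B \<longleftrightarrow>
     sub_matrix B I I = B \<and>
     sub_matrix A I I ** B = sub_matrix (mat 1) I I \<and>
     B ** sub_matrix A I I = sub_matrix (mat 1) I I"

definition block_invertible :: "real^'d^'d \<Rightarrow> 'd set \<Rightarrow> bool" where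
  "block_invertible A I \<longleftrightarrow> (\<exists>B. is_block_inverse A I B)"

definition block_inverse :: "real^'d^'d \<Rightarrow> 'd set \<Rightarrow> real^'d^'d" where
  "block_inverse A I = (THE B. is_block_inverse A I B)"

text \<open>A ratio with zero denominator is \<open>+\<infinity>\<close>, whatever the numerator; the library has \<open>0 / 0 = 0\<close>.\<close>

definition ratio :: "ereal \<Rightarrow> ereal \<Rightarrow> ereal" where
  "ratio a b = (if b = 0 then \<infinity> else a / b)"

definition rho_coef :: "ereal \<Rightarrow> real^'d^'d \<Rightarrow> nat \<Rightarrow> ereal" where
  "rho_coef p A k =
     (SUP (v, I) \<in> {(v, I). card I = k \<and> vec_on I v \<and> v \<noteq> 0}.
        ratio (ereal (lp_norm p (sub_matrix A I I *v v))) (ereal (lp_norm p v)))"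

definition mu_coef :: "ereal \<Rightarrow> real^'d^'d \<Rightarrow> nat \<Rightarrow> ereal" where
  "mu_coef p A k =
     (INF (v, I) \<in> {(v, I). card I = k \<and> vec_on I v \<and> v \<noteq> 0}.
        ratio (ereal (lp_norm p (sub_matrix A I I *v v))) (ereal (lp_norm p v)))"

definition gamma_coef :: "ereal \<Rightarrow> real^'d^'d \<Rightarrow> nat \<Rightarrow> nat \<Rightarrow> ereal" where
  "gamma_coef p A k l =
     (if \<exists>I. card I = k \<and> \<not> block_invertible A I then \<infinity>
      else SUP (u, I, J) \<in> {(u, I, J). card I = k \<and> card J = l \<and> I \<inter> J = {} \<and> vec_on J u \<and> u \<noteq> 0}.
        ratio (ereal (lp_norm p (block_inverse A I *v (sub_matrix A I J *v u))))
              (ereal (lp_norm \<infinity> u)))"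

text \<open>For finite \<open>p\<close> this is the vector \<open>v\<close> to the power \<open>p - 1\<close> with entrywise signs. For \<open>p = \<infinity>\<close> it is
  the limit of that vector divided by the \<open>(p - 1)\<close>-st power of the \<open>p\<close>-norm of \<open>v\<close>. The
  division cancels between numerator and denominator of \<open>pi_coef\<close>, and in \<open>omega_coef\<close>
  it leaves the first power of the norm in the denominator.\<close>

definition dual_power :: "ereal \<Rightarrow> real^'d \<Rightarrow> real^'d" where
  "dual_power p v =
     (if p = \<infinity> then
        (\<chi> j. if \<bar>v $ j\<bar> = lp_norm \<infinity> v
              then sgn (v $ j) / real (card {i. \<bar>v $ i\<bar> = lp_norm \<infinity> v}) else 0)
      else (\<chi> j. \<bar>v $ j\<bar> powr (real_of_ereal p - 1) * sgn (v $ j)))"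

definition omega_coef :: "ereal \<Rightarrow> real^'d^'d \<Rightarrow> nat \<Rightarrow> ereal" where
  "omega_coef p A k =
     (INF (v, I) \<in> {(v, I). card I = k \<and> vec_on I v \<and> v \<noteq> 0}.
        ratio (ereal (max 0 (v \<bullet> (sub_matrix A I I *v dual_power p v))))
              (ereal (if p = \<infinity> then lp_norm \<infinity> v else lp_norm p v powr real_of_ereal p)))"

definition pi_coef :: "ereal \<Rightarrow> real^'d^'d \<Rightarrow> nat \<Rightarrow> nat \<Rightarrow> ereal" where
  "pi_coef p A k l =
     (SUP (v, u, I, J) \<in> {(v, u, I, J). card I = k \<and> card J = l \<and> I \<inter> J = {} \<and>
                            vec_on I v \<and> v \<noteq> 0 \<and> vec_on J u \<and> u \<noteq> 0}.
        ratio (ereal ((dual_power p v \<bullet> (sub_matrix A I J *v u)) * lp_norm p v))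
              (ereal (max 0 (v \<bullet> (sub_matrix A I I *v dual_power p v)) * lp_norm \<infinity> u)))"

definition gram :: "nat \<Rightarrow> (nat \<Rightarrow> real^'d) \<Rightarrow> real^'d^'d" where
  "gram n x = (\<chi> j j'. (\<Sum>i=1..n. x i $ j * x i $ j') / real n)"

text \<open>Least squares with an \<open>\<ell>\<^sub>1\<close> penalty on the coordinates in \<open>P\<close>: the first stage has
  \<open>P = UNIV\<close>, the second leaves the coordinates selected by the first stage unpenalized.\<close>

definition penalized_loss ::
    "nat \<Rightarrow> (nat \<Rightarrow> real^'d) \<Rightarrow> (nat \<Rightarrow> real) \<Rightarrow> real \<Rightarrow> 'd set \<Rightarrow> real^'d \<Rightarrow> real" where
  "penalized_loss n x Y lam P \<beta> =
     (\<Sum>i=1..n. (\<beta> \<bullet> x i - Y i)\<^sup>2) / real n + lam * (\<Sum>j\<in>P. \<bar>\<beta> $ j\<bar>)"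

definition stage1 ::
    "nat \<Rightarrow> (nat \<Rightarrow> real^'d) \<Rightarrow> (nat \<Rightarrow> real) \<Rightarrow> real \<Rightarrow> real^'d \<Rightarrow> bool" where
  "stage1 n x Y lam b \<longleftrightarrow> is_arg_min (penalized_loss n x Y lam UNIV) (\<lambda>_. True) b"

definition stage2 ::
    "nat \<Rightarrow> (nat \<Rightarrow> real^'d) \<Rightarrow> (nat \<Rightarrow> real) \<Rightarrow> real \<Rightarrow> real \<Rightarrow> real^'d \<Rightarrow> real^'d \<Rightarrow> bool" where
  "stage2 n x Y lam \<alpha> b b' \<longleftrightarrow>
     is_arg_min (penalized_loss n x Y lam (- supp_above \<alpha> b)) (\<lambda>_. True) b'"

end

theory Submission
  imports Defs
begin

text \<open>Write \<open>z\<close> for the correlations of the noise with the columns of the design, and \<open>\<tau>\<close> for the level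
\<open>\<sigma> a sqrt (2 ln (2 d / \<delta>) / n)\<close>. Randomness enters through two events only: all \<open>\<bar>z\<^sub>j\<bar> \<le> \<tau>\<close>, and the Euclidean
norm of \<open>z\<close> on the fixed set \<open>Q\<close> of coordinates with \<open>\<bar>\<beta>\<^sub>j\<bar> > 1.5 \<alpha>\<close> is of order \<open>a \<sigma> sqrt (q ln (1 / \<delta>) / n)\<close>
(\<open>noise_event\<close>). Neither depends on \<open>\<ell>\<close>, \<open>t\<close> or \<open>p\<close>, so the rest is deterministic and holds for all of
them at once.

Every stage minimises a convex function, so its solution \<open>b\<close> satisfies \<open>A (b - \<beta>) = z + w\<close> with a vector \<open>w\<close>
that vanishes on unpenalized coordinates, is at most \<open>\<lambda> / 2\<close> elsewhere and points against \<open>b\<close>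
(\<open>arg_min_stationary\<close>). Pairing this with \<open>b - \<beta>\<close> and using \<open>A \<ge> 0\<close> gives the cone condition: outside a
set \<open>K\<close> containing the unpenalized coordinates the \<open>1\<close>-norm of \<open>b\<close> is at most a constant depending on \<open>t\<close> times
the \<open>1\<close>-norm of the error on \<open>K\<close> plus that of \<open>\<beta>\<close> outside \<open>K\<close> (\<open>stationary_cone_ratio\<close>). Shelling turns this
into information about \<open>A\<close>: let \<open>I\<close> be \<open>K\<close> with the \<open>\<ell>\<close> largest remaining coordinates, and cut the complement
of \<open>I\<close> into blocks of size \<open>\<ell>\<close> of decreasing magnitude. The sup-norms of these blocks add up to at most
\<open>1 / \<ell>\<close> times the \<open>1\<close>-norm outside \<open>K\<close>, and \<open>\<pi>\<close> or \<open>\<gamma>\<close> bounds how much one block can perturb the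
equation on \<open>I\<close> (\<open>shelling\<close>).

For the first stage take \<open>K\<close> to be the support of \<open>\<beta>\<close>. The conditions on \<open>\<pi>\<close> or \<open>\<gamma>\<close> leave at least the fraction
\<open>t / 2\<close> of the diagonal block, whose strength is measured by \<open>\<omega>\<close> or \<open>\<mu>\<close>; this bounds the error in the \<open>p\<close>-norm on \<open>I\<close>,
hence every entry of it, by \<open>\<alpha> / 2\<close> (\<open>stage1_sup_error\<close>). So the selected set lies between \<open>Q\<close> and
the set \<open>K\<close> of coordinates with \<open>\<bar>\<beta>\<^sub>j\<bar> > \<lambda>\<close>.

For the second stage take this \<open>K\<close> and compare \<open>b'\<close> with the truncation \<open>\<beta>\<^sub>K\<close>. The coordinates in \<open>Q\<close> are not
penalized, so only their noise counts, and the other coordinates of \<open>K\<close> cost \<open>\<lambda>\<close> each. The difficulty is that the cone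
condition carries the \<open>1\<close>-norm \<open>r\<^sub>1\<close> of the tail of \<open>\<beta>\<close>, which may be as large as \<open>sqrt \<ell>\<close> times its \<open>2\<close>-norm \<open>r\<close>.
If the error on \<open>I\<close> dominates \<open>r\<^sub>1\<close>, the argument of the first stage applies (\<open>energy_good\<close>). If not, the whole error outside
\<open>K\<close> has \<open>1\<close>-norm of order \<open>sqrt \<ell> r / t\<close>, and the argument goes through the prediction norm: for the full error it is
controlled by the energy inequality, for the part outside \<open>I\<close> it is of order \<open>sqrt \<rho> r / t\<close>, and the difference bounds
\<open>sqrt \<mu>\<close> times the error on \<open>I\<close> (\<open>energy_bad\<close>).

The case \<open>\<lambda> = 0\<close> forces \<open>\<tau> = 0\<close>, hence \<open>z = 0\<close>; then \<open>\<beta>\<close> itself is a minimiser, and uniqueness makes both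
estimates equal to it.\<close>

section \<open>Shelling: blocks of decreasing magnitude\<close>

lemma top_subset_exists:
  fixes f :: "'a \<Rightarrow> real"
  assumes "finite R" and "m \<le> card R"
  shows "\<exists>T\<subseteq>R. card T = m \<and> (\<forall>i\<in>R - T. \<forall>j\<in>T. f i \<le> f j)"
  using assms(2)
proof (induction m)
  case 0
  show ?case by (rule exI[of _ "{}"]) simp
next
  case (Suc m)
  then obtain T where T: "T \<subseteq> R" "card T = m" "\<forall>i\<in>R - T. \<forall>j\<in>T. f i \<le> f j"
    by auto
  have fT: "finite T"
    using T(1) assms(1) finite_subset by blast
  have "R - T \<noteq> {}"
    using T(1,2) Suc.prems card_mono[OF fT, of R] by auto
  then have ne: "f ` (R - T) \<noteq> {}" "finite (f ` (R - T))"
    using assms(1) by auto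
  from Max_in[OF ne(2,1)] obtain a where a: "a \<in> R - T" "f a = Max (f ` (R - T))"
    by auto
  have "f i \<le> f a" if "i \<in> R - T" for i
    unfolding a(2) using ne(2) that by (intro Max_ge) auto
  then show ?case
    using T a fT by (intro exI[of _ "insert a T"]) auto
qed

definition restr :: "'d set \<Rightarrow> real^'d \<Rightarrow> real^'d" where
  "restr I v = (\<chi> j. if j \<in> I then v $ j else 0)"

lemma restr_nth [simp]: "restr I v $ j = (if j \<in> I then v $ j else 0)"
  by (simp add: restr_def)

lemma vec_on_restr [simp]: "vec_on I (restr I v)"
  by (simp add: vec_on_def)

lemma vec_on_restr_subset: "I \<subseteq> J \<Longrightarrow> vec_on J (restr I v)"
  by (auto simp: vec_on_def)

lemma restr_vec_on: "vec_on I v \<Longrightarrow> restr I v = v"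
  by (auto simp: vec_on_def vec_eq_iff)

lemma restr_Un_disjoint: "I \<inter> J = {} \<Longrightarrow> restr (I \<union> J) v = restr I v + restr J v"
  by (auto simp: vec_eq_iff)

lemma restr_add_compl: "restr I v + restr (- I) v = v"
  by (auto simp: vec_eq_iff)

lemma card_real_le_sum:
  assumes "finite T" and "\<And>j. j \<in> T \<Longrightarrow> c \<le> f j"
  shows "real (card T) * c \<le> (\<Sum>j\<in>T. f j :: real)"
  using sum_mono[of T "\<lambda>_. c" f] assms by simp

lemma lp_norm_inf_le_iff:
  "lp_norm \<infinity> (v :: real^'d) \<le> c \<longleftrightarrow> (\<forall>j. \<bar>v $ j\<bar> \<le> c)"
  by (simp add: lp_norm_def)

lemma abs_le_lp_norm_inf: "\<bar>(v :: real^'d) $ j\<bar> \<le> lp_norm \<infinity> v"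
  using lp_norm_inf_le_iff[of v "lp_norm \<infinity> v"] by simp

text \<open>Induction on the size of the set \<open>R\<close> still to be covered. The \<open>l\<close> largest entries of \<open>D\<close> on \<open>R\<close> form a block whose sup-norm is
at most \<open>m\<close>; every other entry is at most the average over that block, so this average can play the role of \<open>m\<close> for
the remaining set. A last block that is too small is padded, which needs \<open>l \<le> card (- I)\<close>. Sublinearity is all
that is asked of \<open>\<phi>\<close>, so linear forms, norms and seminorms are covered alike.\<close>

lemma shelling_aux:
  fixes \<phi> :: "real^'d \<Rightarrow> real"
  assumes sub: "\<And>u v. \<phi> (u + v) \<le> \<phi> u + \<phi> v"
    and block: "\<And>J u. card J = l \<Longrightarrow> J \<inter> I = {} \<Longrightarrow> vec_on J u \<Longrightarrow> \<phi> u \<le> C * lp_norm \<infinity> u"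
    and l: "1 \<le> l" "l \<le> card (- I)" and C: "0 \<le> C"
    and "R \<subseteq> - I" and "\<And>i. i \<in> R \<Longrightarrow> \<bar>D $ i\<bar> \<le> m" and "0 \<le> m"
  shows "\<phi> (restr R D) \<le> C * (m + (\<Sum>i\<in>R. \<bar>D $ i\<bar>) / real l)"
  using assms(6-8)
proof (induction "card R" arbitrary: R m rule: less_induct)
  case less
  have small: "\<phi> (restr T D) \<le> C * c"
    if T: "card T \<le> l" "T \<subseteq> - I" "\<And>i. i \<in> T \<Longrightarrow> \<bar>D $ i\<bar> \<le> c" "0 \<le> c" for T c
  proof -
    obtain J where J: "T \<subseteq> J" "J \<subseteq> - I" "card J = l"
      using exists_subset_between[of T l "- I"] T l by auto
    have "\<phi> (restr T D) \<le> C * lp_norm \<infinity> (restr T D)"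
      using J by (intro block[of J] vec_on_restr_subset) auto
    also have "\<dots> \<le> C * c"
      using T C by (intro mult_left_mono) (auto simp: lp_norm_inf_le_iff)
    finally show ?thesis .
  qed
  show ?case
  proof (cases "card R \<le> l")
    case True
    have "\<phi> (restr R D) \<le> C * m"
      using small[of R m] True less by auto
    also have "\<dots> \<le> C * (m + (\<Sum>i\<in>R. \<bar>D $ i\<bar>) / real l)"
      using C by (intro mult_left_mono) (auto intro!: sum_nonneg divide_nonneg_nonneg)
    finally show ?thesis .
  next
    case False
    obtain T where T: "T \<subseteq> R" "card T = l" "\<forall>i\<in>R - T. \<forall>j\<in>T. \<bar>D $ i\<bar> \<le> \<bar>D $ j\<bar>"
      using top_subset_exists[of R l "\<lambda>i. \<bar>D $ i\<bar>"] False by auto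
    define m' where "m' = (\<Sum>j\<in>T. \<bar>D $ j\<bar>) / real l"
    have le: "\<bar>D $ i\<bar> \<le> m'" if "i \<in> R - T" for i
      using card_real_le_sum[of T "\<bar>D $ i\<bar>" "\<lambda>j. \<bar>D $ j\<bar>"] that T l
      by (auto simp: m'_def field_simps)
    have "card (R - T) < card R"
      using T l False by (subst card_Diff_subset) auto
    then have IH: "\<phi> (restr (R - T) D) \<le> C * (m' + (\<Sum>i\<in>R - T. \<bar>D $ i\<bar>) / real l)"
      using less le by (intro less.hyps) (auto simp: m'_def intro!: sum_nonneg divide_nonneg_nonneg)
    have "restr R D = restr T D + restr (R - T) D"
      using T(1) by (subst restr_Un_disjoint[symmetric]) (auto intro!: arg_cong2[of _ _ _ _ restr])
    then have "\<phi> (restr R D) \<le> \<phi> (restr T D) + \<phi> (restr (R - T) D)"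
      using sub by simp
    also have "\<dots> \<le> C * m + C * (m' + (\<Sum>i\<in>R - T. \<bar>D $ i\<bar>) / real l)"
      using T less.prems by (intro add_mono IH small) auto
    also have "m' + (\<Sum>i\<in>R - T. \<bar>D $ i\<bar>) / real l = (\<Sum>i\<in>R. \<bar>D $ i\<bar>) / real l"
      using sum.subset_diff[of T R "\<lambda>i. \<bar>D $ i\<bar>"] T(1) by (simp add: m'_def add_divide_distrib)
    finally show ?thesis
      by (simp add: algebra_simps)
  qed
qed

definition is_head :: "nat \<Rightarrow> real^'d \<Rightarrow> 'd set \<Rightarrow> 'd set \<Rightarrow> bool" where
  "is_head l D K J \<longleftrightarrow> K \<inter> J = {} \<and> card J = l \<and>
     (\<forall>i\<in>- (K \<union> J). \<forall>j\<in>J. \<bar>D $ i\<bar> \<le> \<bar>D $ j\<bar>)"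

lemma head_exists:
  fixes K :: "'d::finite set"
  assumes "l \<le> card (- K)"
  shows "\<exists>J. is_head l D K J"
proof -
  obtain J where "J \<subseteq> - K" "card J = l" "\<forall>i\<in>- K - J. \<forall>j\<in>J. \<bar>D $ i\<bar> \<le> \<bar>D $ j\<bar>"
    using top_subset_exists[of "- K" l "\<lambda>i. \<bar>D $ i\<bar>"] assms by auto
  then show ?thesis
    unfolding is_head_def by (intro exI[of _ J]) auto
qed

lemma head_tail_le:
  assumes "is_head l D K J" and "1 \<le> l" and "i \<notin> K \<union> J"
  shows "\<bar>D $ i\<bar> \<le> (\<Sum>j\<in>J. \<bar>D $ j\<bar>) / real l"
  using card_real_le_sum[of J "\<bar>D $ i\<bar>" "\<lambda>j. \<bar>D $ j\<bar>"] assms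
  by (auto simp: is_head_def field_simps)

lemma head_sum_split:
  assumes "is_head l D K J"
  shows "(\<Sum>j\<in>J. f j) + (\<Sum>j\<in>- (K \<union> J). f j) = (\<Sum>j\<in>- K. f j :: real)"
proof -
  have "- K = J \<union> - (K \<union> J)"
    using assms by (auto simp: is_head_def)
  then show ?thesis
    using sum.union_disjoint[of J "- (K \<union> J)" f] by auto
qed

text \<open>Starting the induction from the head \<open>J\<close>, whose average dominates every later entry, absorbs the initial bound \<open>m\<close> into
the \<open>1\<close>-norm outside \<open>K\<close>.\<close>

lemma shelling:
  fixes \<phi> :: "real^'d \<Rightarrow> real"
  assumes sub: "\<And>u v. \<phi> (u + v) \<le> \<phi> u + \<phi> v"
    and block: "\<And>L u. card L = l \<Longrightarrow> (K \<union> J) \<inter> L = {} \<Longrightarrow> vec_on L u \<Longrightarrow> \<phi> u \<le> C * lp_norm \<infinity> u"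
    and head: "is_head l D K J" and l: "1 \<le> l" "l \<le> card (- (K \<union> J))" and C: "0 \<le> C"
  shows "\<phi> (restr (- (K \<union> J)) D) \<le> C * ((\<Sum>i\<in>- K. \<bar>D $ i\<bar>) / real l)"
proof -
  have "\<phi> (restr (- (K \<union> J)) D) \<le>
          C * ((\<Sum>j\<in>J. \<bar>D $ j\<bar>) / real l + (\<Sum>i\<in>- (K \<union> J). \<bar>D $ i\<bar>) / real l)"
    using head_tail_le[OF head l(1)] l C
    by (intro shelling_aux[where l = l and I = "K \<union> J"] sub block)
       (auto intro!: sum_nonneg divide_nonneg_nonneg)
  then show ?thesis
    using head_sum_split[OF head, of "\<lambda>j. \<bar>D $ j\<bar>"] by (simp add: add_divide_distrib[symmetric])
qed

text \<open>The entries after the head are at most its average, so the squared norm of the tail is at most \<open>a b / l\<close>, where \<open>a\<close> and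
\<open>b\<close> are the \<open>1\<close>-norms of head and tail; \<open>a b \<le> (a + b)\<^sup>2 / 4\<close> gives the factor \<open>2\<close>, which the constants of
the second stage need.\<close>

lemma head_tail_norm_le:
  fixes D :: "real^'d"
  assumes head: "is_head l D K J" and l: "1 \<le> l"
  shows "norm (restr (- (K \<union> J)) D) \<le> (\<Sum>i\<in>- K. \<bar>D $ i\<bar>) / (2 * sqrt (real l))"
proof -
  let ?a = "\<Sum>j\<in>J. \<bar>D $ j\<bar>" and ?b = "\<Sum>j\<in>- (K \<union> J). \<bar>D $ j\<bar>"
  have "(norm (restr (- (K \<union> J)) D))\<^sup>2 = (\<Sum>j\<in>- (K \<union> J). (D $ j)\<^sup>2)"
    unfolding power2_norm_eq_inner inner_vec_def
    by (intro sum.mono_neutral_cong_right) (auto simp: power2_eq_square)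
  also have "\<dots> = (\<Sum>j\<in>- (K \<union> J). \<bar>D $ j\<bar> * \<bar>D $ j\<bar>)"
    by (simp add: power2_eq_square flip: abs_mult)
  also have "\<dots> \<le> (\<Sum>j\<in>- (K \<union> J). ?a / real l * \<bar>D $ j\<bar>)"
    using head_tail_le[OF head l] by (intro sum_mono mult_right_mono) auto
  also have "\<dots> = ?a / real l * ?b"
    by (rule sum_distrib_left[symmetric])
  also have "\<dots> = ?a * ?b / real l"
    by simp
  also have "?a * ?b \<le> (?a + ?b)\<^sup>2 / 4"
    using zero_le_power2[of "?a - ?b"] by (simp add: power2_eq_square algebra_simps)
  finally have "(norm (restr (- (K \<union> J)) D))\<^sup>2 \<le> (?a + ?b)\<^sup>2 / (4 * real l)"
    using l by (simp add: divide_right_mono)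
  also have "\<dots> = ((?a + ?b) / (2 * sqrt (real l)))\<^sup>2"
    by (simp add: power_divide power_mult_distrib)
  finally show ?thesis
    unfolding head_sum_split[OF head]
    by (rule power2_le_imp_le) (auto intro!: sum_nonneg divide_nonneg_nonneg)
qed

section \<open>The norms \<open>\<ell>\<^sub>p\<close> and their dual vectors\<close>

text \<open>Convexity on the open half-line extends to \<open>0\<close>, since \<open>(u z) powr r = u powr r * z powr r \<le> u * z powr r\<close>
for \<open>0 < u < 1\<close>.\<close>

lemma convex_on_powr_nonneg:
  assumes "1 \<le> r"
  shows "convex_on {0..} (\<lambda>x::real. x powr r)"
proof (rule convex_onI)
  fix t x y :: real
  assume t: "0 < t" "t < 1" and xy: "x \<in> {0..}" "y \<in> {0..}"
  have scale: "(u * z) powr r \<le> u * z powr r" if "0 < u" "u < 1" "0 \<le> z" for u z :: real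
  proof -
    have "u powr r \<le> u powr 1"
      using that assms by (intro powr_mono') auto
    then show ?thesis
      using that by (simp add: powr_mult mult_right_mono)
  qed
  show "((1 - t) *\<^sub>R x + t *\<^sub>R y) powr r \<le> (1 - t) * x powr r + t * y powr r"
  proof (cases "x = 0 \<or> y = 0")
    case True
    then show ?thesis
      using scale[of t y] scale[of "1 - t" x] t xy by auto
  next
    case False
    then show ?thesis
      using convex_onD[OF powr_convex[OF assms], of t x y] t xy by auto
  qed
qed simp

lemma power_mean_le:
  assumes "finite S" "S \<noteq> {}" "1 \<le> r" "\<And>i. i \<in> S \<Longrightarrow> 0 \<le> f i"
  shows "((\<Sum>i\<in>S. f i) / real (card S)) powr r \<le> (\<Sum>i\<in>S. f i powr r) / real (card S)"
  using convex_on_sum[OF assms(1,2) convex_on_powr_nonneg[OF assms(3)],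
      of "\<lambda>_. 1 / real (card S)" f] assms
  by (simp add: sum_divide_distrib)

lemma lp_norm_ereal:
  "lp_norm (ereal r) v = (\<Sum>j\<in>UNIV. \<bar>v $ j\<bar> powr r) powr (1 / r)"
  by (simp add: lp_norm_def)

lemma lp_norm_2: "lp_norm 2 v = norm v"
proof -
  have "lp_norm (ereal 2) v = norm v"
    unfolding lp_norm_ereal
    by (simp add: norm_vec_def L2_set_def powr_half_sqrt sum_nonneg)
  then show ?thesis
    by simp
qed

lemma one_le_ereal_cases:
  assumes "1 \<le> (p :: ereal)"
  obtains r where "p = ereal r" "1 \<le> r" | "p = \<infinity>"
  using assms by (cases p) auto

lemma real_of_inverse_ereal: "r \<noteq> 0 \<Longrightarrow> real_of_ereal (1 / ereal r) = 1 / r"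
  by (simp add: one_ereal_def)

lemma lp_norm_powr:
  assumes "1 \<le> r"
  shows "lp_norm (ereal r) v powr r = (\<Sum>j\<in>UNIV. \<bar>v $ j\<bar> powr r)"
  using assms by (simp add: lp_norm_ereal powr_powr sum_nonneg)

lemma abs_le_lp_norm:
  assumes "1 \<le> p"
  shows "\<bar>v $ j\<bar> \<le> lp_norm p v"
  using assms
proof (cases p rule: one_le_ereal_cases)
  case (1 r)
  have "\<bar>v $ j\<bar> = (\<bar>v $ j\<bar> powr r) powr (1 / r)"
    using 1 by (simp add: powr_powr)
  also have "\<dots> \<le> lp_norm p v"
    unfolding 1 lp_norm_ereal using 1 by (intro powr_mono2 member_le_sum) auto
  finally show ?thesis .
qed (simp add: abs_le_lp_norm_inf)

lemma lp_norm_nonneg: "1 \<le> p \<Longrightarrow> 0 \<le> lp_norm p v"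
  using abs_le_lp_norm[of p v] abs_ge_zero order_trans by blast

lemma lp_norm_pos: 
  assumes "1 \<le> p" "v \<noteq> 0" shows "0 < lp_norm p v"
proof -
  obtain j where "v $ j \<noteq> 0"
    using assms(2) by (auto simp: vec_eq_iff)
  then show ?thesis
    using abs_le_lp_norm[OF assms(1), of v j] by linarith
qed

lemma lp_norm_zero: "1 \<le> p \<Longrightarrow> lp_norm p 0 = 0"
  by (cases p rule: one_le_ereal_cases) (auto simp: lp_norm_def)

lemma lp_norm_minus: "lp_norm p (- v) = lp_norm p v"
  by (simp add: lp_norm_def)

text \<open>Minkowski's inequality. For finite \<open>p\<close> normalise both vectors: \<open>(u + v) / (a + b)\<close> is a convex combination of
\<open>u / a\<close> and \<open>v / b\<close>, so convexity of the \<open>p\<close>-th power bounds the \<open>p\<close>-th power of its norm by \<open>1\<close>.\<close>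

lemma lp_norm_triangle:
  assumes "1 \<le> p"
  shows "lp_norm p (u + v) \<le> lp_norm p u + lp_norm p v"
  using assms
proof (cases p rule: one_le_ereal_cases)
  case 2
  show ?thesis
    unfolding 2 lp_norm_inf_le_iff
    using abs_le_lp_norm_inf[of u] abs_le_lp_norm_inf[of v]
    by (auto intro: order.trans[OF abs_triangle_ineq add_mono])
next
  case (1 r)
  show ?thesis
  proof (cases "u = 0 \<or> v = 0")
    case True
    then show ?thesis
      by (elim disjE) (simp_all add: lp_norm_zero[OF assms])
  next
    case False
    define a b where "a = lp_norm p u" and "b = lp_norm p v"
    have pos: "0 < a" "0 < b"
      unfolding a_def b_def using False assms by (auto intro: lp_norm_pos)
    define t where "t = b / (a + b)"
    have t: "0 \<le> t" "t \<le> 1" "1 - t = a / (a + b)"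
      using pos by (auto simp: t_def field_simps)
    have "\<bar>(u + v) $ j\<bar> powr r \<le>
            (a + b) powr r * ((1 - t) * (\<bar>u $ j\<bar> powr r / a powr r) + t * (\<bar>v $ j\<bar> powr r / b powr r))" for j
    proof -
      have "\<bar>(u + v) $ j\<bar> \<le> \<bar>u $ j\<bar> + \<bar>v $ j\<bar>"
        by simp
      also have "\<dots> = (a + b) * ((1 - t) * (\<bar>u $ j\<bar> / a) + t * (\<bar>v $ j\<bar> / b))"
      proof -
        have "(a + b) * (1 - t) = a" "(a + b) * t = b"
          using pos unfolding t(3) by (simp_all add: t_def)
        then have "(a + b) * ((1 - t) * (\<bar>u $ j\<bar> / a) + t * (\<bar>v $ j\<bar> / b)) =
            a * (\<bar>u $ j\<bar> / a) + b * (\<bar>v $ j\<bar> / b)"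
          unfolding distrib_left mult.assoc[symmetric] by simp
        then show ?thesis
          using pos by simp
      qed
      finally have "\<bar>(u + v) $ j\<bar> powr r \<le>
          ((a + b) * ((1 - t) * (\<bar>u $ j\<bar> / a) + t * (\<bar>v $ j\<bar> / b))) powr r"
        using 1 by (intro powr_mono2) auto
      also have "\<dots> = (a + b) powr r * ((1 - t) * (\<bar>u $ j\<bar> / a) + t * (\<bar>v $ j\<bar> / b)) powr r"
        by (rule powr_mult)
      also have "((1 - t) * (\<bar>u $ j\<bar> / a) + t * (\<bar>v $ j\<bar> / b)) powr r \<le>
          (1 - t) * (\<bar>u $ j\<bar> / a) powr r + t * (\<bar>v $ j\<bar> / b) powr r"
        using convex_onD[OF convex_on_powr_nonneg[of r], of t "\<bar>u $ j\<bar> / a" "\<bar>v $ j\<bar> / b"] 1 t pos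
        by simp
      finally show ?thesis
        using pos by (simp add: powr_divide mult_left_mono)
    qed
    then have "(\<Sum>j\<in>UNIV. \<bar>(u + v) $ j\<bar> powr r) \<le> (\<Sum>j\<in>UNIV. (a + b) powr r *
        ((1 - t) * (\<bar>u $ j\<bar> powr r / a powr r) + t * (\<bar>v $ j\<bar> powr r / b powr r)))"
      by (rule sum_mono)
    also have "\<dots> = (a + b) powr r * ((1 - t) * ((\<Sum>j\<in>UNIV. \<bar>u $ j\<bar> powr r) / a powr r)
        + t * ((\<Sum>j\<in>UNIV. \<bar>v $ j\<bar> powr r) / b powr r))"
      by (simp add: sum_distrib_left sum.distrib sum_divide_distrib distrib_left)
    also have "\<dots> = (a + b) powr r * ((1 - t) * (a powr r / a powr r) + t * (b powr r / b powr r))"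
      unfolding a_def b_def 1 lp_norm_powr[OF 1(2)] ..
    also have "\<dots> = (a + b) powr r"
      using pos by simp
    finally have "lp_norm p (u + v) \<le> ((a + b) powr r) powr (1 / r)"
      unfolding 1 lp_norm_ereal using 1 by (intro powr_mono2) (auto intro: sum_nonneg)
    then show ?thesis
      using 1 pos by (simp add: powr_powr a_def b_def)
  qed
qed

text \<open>The power mean inequality on \<open>S\<close>.\<close>

lemma sum_abs_le_lp_norm:
  assumes "1 \<le> p" "S \<noteq> {}"
  shows "(\<Sum>j\<in>S. \<bar>v $ j\<bar>) \<le> real (card S) powr (1 - real_of_ereal (1 / p)) * lp_norm p v"
proof -
  have c: "0 < real (card S)"
    using assms(2) by (simp add: card_gt_0_iff)
  show ?thesis
    using assms(1)
  proof (cases p rule: one_le_ereal_cases)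
    case 2
    have "(\<Sum>j\<in>S. \<bar>v $ j\<bar>) \<le> (\<Sum>j\<in>S. lp_norm \<infinity> v)"
      by (intro sum_mono abs_le_lp_norm_inf)
    then show ?thesis
      using 2 c by simp
  next
    case (1 r)
    let ?c = "real (card S)" and ?N = "lp_norm (ereal r) v"
    have N: "0 \<le> ?N"
      using assms(1) 1 lp_norm_nonneg by blast
    have "((\<Sum>j\<in>S. \<bar>v $ j\<bar>) / ?c) powr r \<le> (\<Sum>j\<in>S. \<bar>v $ j\<bar> powr r) / ?c"
      using assms(2) 1 by (intro power_mean_le) auto
    also have "\<dots> \<le> ?N powr r / ?c"
      unfolding lp_norm_powr[OF 1(2)] using c by (intro divide_right_mono sum_mono2) auto
    finally have "(((\<Sum>j\<in>S. \<bar>v $ j\<bar>) / ?c) powr r) powr (1 / r) \<le> (?N powr r / ?c) powr (1 / r)"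
      using 1 by (intro powr_mono2) auto
    then have "(\<Sum>j\<in>S. \<bar>v $ j\<bar>) / ?c \<le> ?N / ?c powr (1 / r)"
      using 1 N c by (simp add: powr_powr powr_divide sum_nonneg)
    then have "(\<Sum>j\<in>S. \<bar>v $ j\<bar>) \<le> ?c powr (1 - 1 / r) * ?N"
      using c unfolding powr_diff by (simp add: field_simps)
    then show ?thesis
      using 1 by (simp add: real_of_inverse_ereal)
  qed
qed

text \<open>The size of \<open>dual_power p v\<close>: the denominators in the definition of \<open>\<omega>\<close> are \<open>dual_scale p v * lp_norm p v\<close> for every
\<open>p\<close> and nonzero \<open>v\<close>, so that finite and infinite \<open>p\<close> can be treated together.\<close>

definition dual_scale :: "ereal \<Rightarrow> real^'d \<Rightarrow> real" where
  "dual_scale p v = (if p = \<infinity> then 1 else lp_norm p v powr (real_of_ereal p - 1))"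

lemma dual_scale_pos: "1 \<le> p \<Longrightarrow> v \<noteq> 0 \<Longrightarrow> 0 < dual_scale p v"
  using lp_norm_pos[of p v] by (simp add: dual_scale_def)

lemma dual_scale_times_norm:
  assumes "1 \<le> p" "v \<noteq> 0"
  shows "dual_scale p v * lp_norm p v =
           (if p = \<infinity> then lp_norm \<infinity> v else lp_norm p v powr real_of_ereal p)"
  using assms lp_norm_pos[OF assms] by (cases p) (auto simp: dual_scale_def powr_diff)

lemma dual_power_sgn:
  "dual_power p v $ j = \<bar>dual_power p v $ j\<bar> * sgn (v $ j)"
  by (auto simp: dual_power_def abs_mult sgn_if)

lemma vec_on_dual_power:
  assumes "vec_on I v"
  shows "vec_on I (dual_power p v)"
  using assms by (auto simp: vec_on_def dual_power_def)

text \<open>The power mean inequality with exponent \<open>p / (p - 1)\<close>, applied to the entries \<open>\<bar>v\<^sub>j\<bar> powr (p - 1)\<close>. The end points are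
different: for \<open>p = 1\<close> the entries are signs, and for \<open>p = \<infinity>\<close> they have absolute sum \<open>1\<close>.\<close>

lemma sum_abs_dual_power_le:
  assumes "1 \<le> p" "S \<noteq> {}" "v \<noteq> 0"
  shows "(\<Sum>j\<in>S. \<bar>dual_power p v $ j\<bar>) \<le> real (card S) powr real_of_ereal (1 / p) * dual_scale p v"
proof -
  have c: "0 < real (card S)"
    using assms(2) by (simp add: card_gt_0_iff)
  show ?thesis
    using assms(1)
  proof (cases p rule: one_le_ereal_cases)
    case 2
    let ?T = "{i. \<bar>v $ i\<bar> = lp_norm \<infinity> v}"
    have "(\<Sum>j\<in>S. \<bar>dual_power p v $ j\<bar>) \<le> (\<Sum>j\<in>UNIV. \<bar>dual_power p v $ j\<bar>)"
      by (intro sum_mono2) auto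
    also have "\<dots> \<le> (\<Sum>j\<in>UNIV. if j \<in> ?T then 1 / real (card ?T) else 0)"
      using 2 by (intro sum_mono) (auto simp: dual_power_def abs_mult abs_sgn_eq)
    also have "\<dots> = real (card ?T) * (1 / real (card ?T))"
      by (subst sum.If_cases) auto
    also have "\<dots> \<le> 1"
      by simp
    finally show ?thesis
      using 2 c by (simp add: dual_scale_def)
  next
    case (1 r)
    let ?c = "real (card S)" and ?N = "lp_norm (ereal r) v"
    have N: "0 < ?N"
      using assms 1 lp_norm_pos by blast
    have dp: "\<bar>dual_power p v $ j\<bar> = (if v $ j = 0 then 0 else \<bar>v $ j\<bar> powr (r - 1))" for j
      using 1 by (auto simp: dual_power_def abs_mult abs_sgn_eq)
    show ?thesis
    proof (cases "r = 1")
      case True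
      have "(\<Sum>j\<in>S. \<bar>dual_power p v $ j\<bar>) \<le> (\<Sum>j\<in>S. 1)"
        unfolding dp using True by (intro sum_mono) auto
      then show ?thesis
        using True 1 c N by (simp add: dual_scale_def one_ereal_def)
    next
      case False
      then have r: "1 < r"
        using 1 by simp
      define q where "q = r / (r - 1)"
      have q: "1 \<le> q" "(r - 1) * q = r" "1 / q = 1 - 1 / r"
        using r by (auto simp: q_def field_simps)
      have "((\<Sum>j\<in>S. \<bar>v $ j\<bar> powr (r - 1)) / ?c) powr q \<le>
              (\<Sum>j\<in>S. (\<bar>v $ j\<bar> powr (r - 1)) powr q) / ?c"
        using assms(2) q by (intro power_mean_le) auto
      also have "\<dots> = (\<Sum>j\<in>S. \<bar>v $ j\<bar> powr r) / ?c"
        by (simp add: powr_powr q)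
      also have "\<dots> \<le> ?N powr r / ?c"
        unfolding lp_norm_powr[OF 1(2)] using c by (intro divide_right_mono sum_mono2) auto
      finally have "(((\<Sum>j\<in>S. \<bar>v $ j\<bar> powr (r - 1)) / ?c) powr q) powr (1 / q) \<le>
          (?N powr r / ?c) powr (1 / q)"
        using q(1) by (intro powr_mono2) auto
      then have "(\<Sum>j\<in>S. \<bar>v $ j\<bar> powr (r - 1)) / ?c \<le> ?N powr (r * (1 / q)) / ?c powr (1 / q)"
        using r N c q(1) by (simp add: powr_powr powr_divide sum_nonneg)
      also have "r * (1 / q) = r - 1"
        using r by (simp add: q field_simps)
      finally have "(\<Sum>j\<in>S. \<bar>v $ j\<bar> powr (r - 1)) / ?c \<le> ?N powr (r - 1) / ?c powr (1 - 1 / r)"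
        by (simp add: q)
      then have "(\<Sum>j\<in>S. \<bar>v $ j\<bar> powr (r - 1)) \<le> ?c * (?N powr (r - 1) / ?c powr (1 - 1 / r))"
        using c by (simp add: field_simps)
      also have "\<dots> = ?c powr (1 / r) * ?N powr (r - 1)"
        using c by (simp add: powr_diff)
      finally have "(\<Sum>j\<in>S. \<bar>v $ j\<bar> powr (r - 1)) \<le> ?c powr (1 / r) * ?N powr (r - 1)" .
      moreover have "(\<Sum>j\<in>S. \<bar>dual_power p v $ j\<bar>) \<le> (\<Sum>j\<in>S. \<bar>v $ j\<bar> powr (r - 1))"
        unfolding dp by (intro sum_mono) auto
      ultimately show ?thesis
        using 1 r by (simp add: dual_scale_def real_of_inverse_ereal)
    qed
  qed
qed

lemma lp_norm_le_of_entries: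
  assumes "1 \<le> p" "I \<noteq> {}" "vec_on I w" "\<And>j. j \<in> I \<Longrightarrow> \<bar>w $ j\<bar> \<le> c"
  shows "lp_norm p w \<le> real (card I) powr real_of_ereal (1 / p) * c"
proof -
  have cI: "0 < real (card I)"
    using assms(2) by (simp add: card_gt_0_iff)
  have c: "0 \<le> c"
    using assms(2,4) abs_ge_zero order_trans by blast
  show ?thesis
    using assms(1)
  proof (cases p rule: one_le_ereal_cases)
    case 2
    then show ?thesis
      using assms(3,4) c cI by (simp add: lp_norm_inf_le_iff vec_on_def) (metis abs_zero)
  next
    case (1 r)
    have "(\<Sum>j\<in>UNIV. \<bar>w $ j\<bar> powr r) = (\<Sum>j\<in>I. \<bar>w $ j\<bar> powr r)"
      using assms(3) by (intro sum.mono_neutral_right) (auto simp: vec_on_def)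
    also have "\<dots> \<le> (\<Sum>j\<in>I. c powr r)"
      using assms(4) 1 by (intro sum_mono powr_mono2) auto
    finally have "(\<Sum>j\<in>UNIV. \<bar>w $ j\<bar> powr r) \<le> real (card I) * c powr r"
      by simp
    then have "lp_norm p w \<le> (real (card I) * c powr r) powr (1 / r)"
      unfolding 1 lp_norm_ereal using 1 by (intro powr_mono2) (auto intro: sum_nonneg)
    also have "\<dots> = real (card I) powr (1 / r) * c"
      using 1 c by (simp add: powr_mult powr_powr)
    finally show ?thesis
      using 1 by (simp add: real_of_inverse_ereal)
  qed
qed

section \<open>Gram matrices and sparse eigenvalues\<close>

text \<open>The prediction seminorm, whose square is the quadratic form of the Gram matrix; written with the design, it inherits the
triangle and Cauchy-Schwarz inequalities from Euclidean space.\<close>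

definition pred_norm :: "nat \<Rightarrow> (nat \<Rightarrow> real^'d) \<Rightarrow> real^'d \<Rightarrow> real" where
  "pred_norm n x u = L2_set (\<lambda>i. x i \<bullet> u) {1..n} / sqrt (real n)"

lemma gram_mult_nth:
  "(gram n x *v v) $ j = (\<Sum>i=1..n. x i $ j * (x i \<bullet> v)) / real n"
proof -
  have "(gram n x *v v) $ j = (\<Sum>j'\<in>UNIV. (\<Sum>i=1..n. x i $ j * (x i $ j' * v $ j')) / real n)"
    unfolding matrix_vector_mult_def gram_def
    by (simp add: sum_distrib_right mult.assoc)
  also have "\<dots> = (\<Sum>i=1..n. \<Sum>j'\<in>UNIV. x i $ j * (x i $ j' * v $ j')) / real n"
    by (subst sum.swap) (simp add: sum_divide_distrib)
  finally show ?thesis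
    by (simp add: inner_vec_def sum_distrib_left)
qed

lemma inner_gram: "u \<bullet> (gram n x *v v) = (\<Sum>i=1..n. (x i \<bullet> u) * (x i \<bullet> v)) / real n"
proof -
  have "u \<bullet> (gram n x *v v) = (\<Sum>j\<in>UNIV. (\<Sum>i=1..n. x i $ j * u $ j * (x i \<bullet> v)) / real n)"
    unfolding inner_vec_def[of u] gram_mult_nth
    by (simp add: sum_distrib_left mult.assoc mult.left_commute)
  also have "\<dots> = (\<Sum>i=1..n. \<Sum>j\<in>UNIV. x i $ j * u $ j * (x i \<bullet> v)) / real n"
    by (subst sum.swap) (simp add: sum_divide_distrib)
  finally show ?thesis
    by (simp add: inner_vec_def sum_distrib_right)
qed

lemma gram_inner_commute: "u \<bullet> (gram n x *v v) = v \<bullet> (gram n x *v u)"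
  by (simp add: inner_gram mult.commute)

lemma pred_norm_nonneg [simp]: "0 \<le> pred_norm n x u"
  by (simp add: pred_norm_def)

lemma pred_norm_power2: "(pred_norm n x u)\<^sup>2 = u \<bullet> (gram n x *v u)"
  unfolding inner_gram pred_norm_def L2_set_def
  by (simp add: power_divide sum_nonneg flip: power2_eq_square)

lemma pred_norm_triangle: "pred_norm n x (u + v) \<le> pred_norm n x u + pred_norm n x v"
  unfolding pred_norm_def
  using L2_set_triangle_ineq[of "\<lambda>i. x i \<bullet> u" "\<lambda>i. x i \<bullet> v" "{1..n}"]
  by (simp add: inner_add_right divide_right_mono flip: add_divide_distrib)

lemma pred_norm_minus [simp]: "pred_norm n x (- u) = pred_norm n x u"
  by (simp add: pred_norm_def L2_set_def)

lemma gram_inner_le_pred_norm: "u \<bullet> (gram n x *v v) \<le> pred_norm n x u * pred_norm n x v"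
proof -
  have "(\<Sum>i=1..n. (x i \<bullet> u) * (x i \<bullet> v)) \<le> (\<Sum>i=1..n. \<bar>x i \<bullet> u\<bar> * \<bar>x i \<bullet> v\<bar>)"
    by (intro sum_mono) (simp flip: abs_mult)
  also have "\<dots> \<le> L2_set (\<lambda>i. x i \<bullet> u) {1..n} * L2_set (\<lambda>i. x i \<bullet> v) {1..n}"
    by (rule L2_set_mult_ineq)
  finally have "(\<Sum>i=1..n. (x i \<bullet> u) * (x i \<bullet> v)) / real n \<le>
      L2_set (\<lambda>i. x i \<bullet> u) {1..n} * L2_set (\<lambda>i. x i \<bullet> v) {1..n} / real n"
    by (rule divide_right_mono) simp
  then show ?thesis
    by (simp add: inner_gram pred_norm_def)
qed

lemma sub_matrix_mult: "sub_matrix A I J *v w = restr I (A *v restr J w)"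
proof -
  have "(\<Sum>j\<in>UNIV. (if i \<in> I \<and> j \<in> J then A $ i $ j else 0) * w $ j) =
        (if i \<in> I then \<Sum>j\<in>UNIV. A $ i $ j * (if j \<in> J then w $ j else 0) else 0)" for i
    by (auto intro!: sum.cong)
  then show ?thesis
    unfolding vec_eq_iff matrix_vector_mult_def sub_matrix_def by simp
qed

lemma inner_restr_left: "restr I u \<bullet> v = u \<bullet> restr I v"
  by (simp add: inner_vec_def if_distrib[of "\<lambda>c. c * _"] if_distrib[of "\<lambda>c. _ * c"] cong: if_cong)

lemma inner_restr_vec_on: "vec_on I u \<Longrightarrow> u \<bullet> restr I v = u \<bullet> v"
  by (metis inner_restr_left restr_vec_on)

lemma inner_vec_on_le:
  assumes "vec_on I u" "\<And>j. j \<in> I \<Longrightarrow> u $ j * w $ j \<le> f j"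
  shows "u \<bullet> w \<le> (\<Sum>j\<in>I. f j)"
proof -
  have "u \<bullet> w = (\<Sum>j\<in>I. u $ j * w $ j)"
    unfolding inner_vec_def using assms(1)
    by (intro sum.mono_neutral_cong_right) (auto simp: vec_on_def)
  then show ?thesis
    using assms(2) by (simp add: sum_mono)
qed

lemma restr_add: "restr I (u + v) = restr I u + restr I v"
  by (auto simp: vec_eq_iff)

lemma norm_restr_le: "norm (restr I v) \<le> norm v"
  by (intro norm_le_componentwise_cart) auto

text \<open>The coefficients are extended reals. As infima and suprema of nonnegative quotients over a nonempty set of block vectors
they can be replaced by real constants that satisfy the inequalities needed for all block vectors.\<close>

lemma INF_ereal_real:
  fixes f :: "'a \<Rightarrow> real"
  assumes "S \<noteq> {}" "\<And>x. x \<in> S \<Longrightarrow> 0 \<le> f x"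
  obtains c where "(INF x\<in>S. ereal (f x)) = ereal c" "0 \<le> c" "\<And>x. x \<in> S \<Longrightarrow> c \<le> f x"
proof -
  obtain y where y: "y \<in> S"
    using assms(1) by blast
  have lo: "0 \<le> (INF x\<in>S. ereal (f x))"
    using assms(2) by (intro INF_greatest) simp
  have hi: "(INF x\<in>S. ereal (f x)) \<le> ereal (f x)" if "x \<in> S" for x
    using that by (rule INF_lower)
  obtain c where c: "(INF x\<in>S. ereal (f x)) = ereal c"
    using lo hi[OF y] by (cases "INF x\<in>S. ereal (f x)") auto
  show thesis
    using lo hi unfolding c by (intro that[OF c]) auto
qed

lemma SUP_ereal_real:
  fixes f :: "'a \<Rightarrow> real"
  assumes "S \<noteq> {}" "\<And>x. x \<in> S \<Longrightarrow> 0 \<le> f x" "(SUP x\<in>S. ereal (f x)) \<noteq> \<infinity>"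
  obtains c where "(SUP x\<in>S. ereal (f x)) = ereal c" "0 \<le> c" "\<And>x. x \<in> S \<Longrightarrow> f x \<le> c"
proof -
  obtain y where y: "y \<in> S"
    using assms(1) by blast
  have hi: "ereal (f x) \<le> (SUP x\<in>S. ereal (f x))" if "x \<in> S" for x
    using that by (rule SUP_upper)
  have lo: "0 \<le> (SUP x\<in>S. ereal (f x))"
    using hi[OF y] assms(2)[OF y] by (meson ereal_less_eq(5) order_trans)
  obtain c where c: "(SUP x\<in>S. ereal (f x)) = ereal c"
    using lo assms(3) by (cases "SUP x\<in>S. ereal (f x)") auto
  show thesis
    using lo hi unfolding c by (intro that[OF c]) auto
qed

lemma ratio_ereal: "0 < b \<Longrightarrow> ratio (ereal a) (ereal b) = ereal (a / b)"
  by (simp add: ratio_def)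

lemma block_vectors_nonempty:
  assumes "1 \<le> k" "k \<le> CARD('d::finite)"
  shows "{(v :: real^'d, I). card I = k \<and> vec_on I v \<and> v \<noteq> 0} \<noteq> {}"
proof -
  obtain I :: "'d set" where I: "card I = k"
    using assms(2) obtain_subset_with_card_n[of k UNIV] by auto
  then obtain i where "i \<in> I"
    using assms(1) by fastforce
  then have "vec_on I (axis i (1::real))" "axis i (1::real) \<noteq> 0"
    by (auto simp: vec_on_def axis_def vec_eq_iff)
  then show ?thesis
    using I by blast
qed

lemma mu_coef_real:
  fixes A :: "real^'d^'d"
  assumes "1 \<le> p" "1 \<le> k" "k \<le> CARD('d)"
  obtains m where "mu_coef p A k = ereal m" "0 \<le> m"
    "\<And>I v. card I = k \<Longrightarrow> vec_on I v \<Longrightarrow> m * lp_norm p v \<le> lp_norm p (sub_matrix A I I *v v)"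
proof -
  let ?S = "{(v :: real^'d, I). card I = k \<and> vec_on I v \<and> v \<noteq> 0}"
  let ?f = "\<lambda>(v :: real^'d, I). lp_norm p (sub_matrix A I I *v v) / lp_norm p v"
  have eq: "mu_coef p A k = (INF z\<in>?S. ereal (?f z))"
    unfolding mu_coef_def
    by (intro INF_cong) (auto simp: ratio_ereal lp_norm_pos[OF assms(1)])
  have nonneg: "0 \<le> ?f z" for z
    by (auto split: prod.splits simp: lp_norm_nonneg[OF assms(1)])
  obtain m where m: "mu_coef p A k = ereal m" "0 \<le> m" "\<And>z. z \<in> ?S \<Longrightarrow> m \<le> ?f z"
    unfolding eq 
    by (rule INF_ereal_real[where f = ?f, OF block_vectors_nonempty[OF assms(2,3)] nonneg]) auto
  show thesis
  proof (rule that[OF m(1,2)])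
    fix I and v :: "real^'d" assume *: "card I = k" "vec_on I v"
    show "m * lp_norm p v \<le> lp_norm p (sub_matrix A I I *v v)"
    proof (cases "v = 0")
      case True
      then show ?thesis
        by (simp add: lp_norm_zero[OF assms(1)])
    next
      case False
      then show ?thesis
        using m(3)[of "(v, I)"] * lp_norm_pos[OF assms(1), of v] by (simp add: field_simps)
    qed
  qed
qed

lemma omega_coef_real:
  fixes A :: "real^'d^'d"
  assumes "1 \<le> p" "1 \<le> k" "k \<le> CARD('d)"
  obtains m where "omega_coef p A k = ereal m" "0 \<le> m"
    "\<And>I v. card I = k \<Longrightarrow> vec_on I v \<Longrightarrow> v \<noteq> 0 \<Longrightarrow>
       m * (dual_scale p v * lp_norm p v) \<le> max 0 (v \<bullet> (sub_matrix A I I *v dual_power p v))"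
proof -
  let ?S = "{(v :: real^'d, I). card I = k \<and> vec_on I v \<and> v \<noteq> 0}"
  let ?f = "\<lambda>(v :: real^'d, I). max 0 (v \<bullet> (sub_matrix A I I *v dual_power p v)) /
              (dual_scale p v * lp_norm p v)"
  have pos: "0 < dual_scale p v * lp_norm p v" if "v \<noteq> 0" for v :: "real^'d"
    using that assms(1) by (simp add: lp_norm_pos dual_scale_pos)
  have eq: "omega_coef p A k = (INF z\<in>?S. ereal (?f z))"
    unfolding omega_coef_def
  proof (rule INF_cong[OF refl])
    fix z assume "z \<in> ?S"
    then obtain v I where z: "z = (v, I)" "v \<noteq> 0"
      by auto
    show "(case z of (v, I) \<Rightarrow> ratio (ereal (max 0 (v \<bullet> (sub_matrix A I I *v dual_power p v))))
        (ereal (if p = \<infinity> then lp_norm \<infinity> v else lp_norm p v powr real_of_ereal p))) = ereal (?f z)"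
      unfolding z(1) split dual_scale_times_norm[OF assms(1) z(2), symmetric]
      by (rule ratio_ereal[OF pos[OF z(2)]])
  qed
  have nonneg: "0 \<le> ?f z" if "z \<in> ?S" for z
    using that pos by (auto intro!: divide_nonneg_pos)
  obtain m where m: "omega_coef p A k = ereal m" "0 \<le> m" "\<And>z. z \<in> ?S \<Longrightarrow> m \<le> ?f z"
    unfolding eq 
    by (rule INF_ereal_real[where f = ?f, OF block_vectors_nonempty[OF assms(2,3)] nonneg]) auto
  show thesis
    using m(3) pos by (intro that[OF m(1,2)]) (fastforce simp: field_simps)
qed

lemma norm_mult_le_entries:
  fixes A :: "real^'d^'d"
  shows "norm (A *v v) \<le> (\<Sum>i\<in>UNIV. \<Sum>j\<in>UNIV. \<bar>A $ i $ j\<bar>) * norm v"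
proof -
  have "norm (A *v v) \<le> (\<Sum>i\<in>UNIV. \<bar>(A *v v) $ i\<bar>)"
    by (rule norm_le_l1_cart)
  also have "\<dots> \<le> (\<Sum>i\<in>UNIV. \<Sum>j\<in>UNIV. \<bar>A $ i $ j\<bar> * norm v)"
    unfolding matrix_vector_mult_def
    by (intro sum_mono) (auto simp: abs_mult intro!: order.trans[OF sum_abs] sum_mono mult_left_mono
        component_le_norm_cart)
  finally show ?thesis
    by (simp add: sum_distrib_right)
qed

text \<open>Finiteness comes from the crude bound by the absolute sum of all entries of \<open>A\<close>.\<close>

lemma rho_coef_real:
  fixes A :: "real^'d^'d"
  assumes "1 \<le> k" "k \<le> CARD('d)"
  obtains r where "rho_coef 2 A k = ereal r" "0 \<le> r"
    "\<And>I v. card I = k \<Longrightarrow> vec_on I v \<Longrightarrow> norm (sub_matrix A I I *v v) \<le> r * norm v"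
proof -
  let ?S = "{(v :: real^'d, I). card I = k \<and> vec_on I v \<and> v \<noteq> 0}"
  let ?f = "\<lambda>(v :: real^'d, I). norm (sub_matrix A I I *v v) / norm v"
  let ?b = "\<Sum>i\<in>UNIV. \<Sum>j\<in>UNIV. \<bar>A $ i $ j\<bar>"
  have eq: "rho_coef 2 A k = (SUP z\<in>?S. ereal (?f z))"
    unfolding rho_coef_def lp_norm_2 by (intro SUP_cong) (auto simp: ratio_ereal)
  have "?f z \<le> ?b" if "z \<in> ?S" for z
  proof -
    obtain v I where z: "z = (v, I)" "v \<noteq> 0"
      using \<open>z \<in> ?S\<close> by auto
    have "norm (sub_matrix A I I *v v) \<le> norm (A *v restr I v)"
      unfolding sub_matrix_mult by (rule norm_restr_le)
    also have "\<dots> \<le> ?b * norm (restr I v)"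
      by (rule norm_mult_le_entries)
    also have "\<dots> \<le> ?b * norm v"
      by (intro mult_left_mono norm_restr_le sum_nonneg) auto
    finally show ?thesis
      using z by (simp add: field_simps)
  qed
  then have "(SUP z\<in>?S. ereal (?f z)) \<le> ereal ?b"
    by (intro SUP_least) simp
  then have finite_sup: "(SUP z\<in>?S. ereal (?f z)) \<noteq> \<infinity>"
    by auto
  have nonneg: "0 \<le> ?f z" for z
    by (auto split: prod.splits)
  obtain r where r: "rho_coef 2 A k = ereal r" "0 \<le> r" "\<And>z. z \<in> ?S \<Longrightarrow> ?f z \<le> r"
    unfolding eq 
    by (rule SUP_ereal_real[where f = ?f, OF block_vectors_nonempty[OF assms] nonneg finite_sup]) auto
  show thesis
  proof (rule that[OF r(1,2)])
    fix I and v :: "real^'d" assume *: "card I = k" "vec_on I v"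
    show "norm (sub_matrix A I I *v v) \<le> r * norm v"
      using r(3)[of "(v, I)"] * by (cases "v = 0") (auto simp: field_simps)
  qed
qed

text \<open>The linear term dominates for small \<open>e\<close> of the sign opposite to \<open>b\<close>.\<close>

lemma linear_coeff_zero:
  fixes b c :: real
  assumes "\<And>e. 0 \<le> 2 * e * b + e\<^sup>2 * c"
  shows "b = 0"
proof (rule ccontr)
  assume b: "b \<noteq> 0"
  define C where "C = \<bar>c\<bar> + 1"
  have C: "0 < C" "c < C"
    by (auto simp: C_def)
  have "0 \<le> C\<^sup>2 * (2 * (- b / C) * b + (- b / C)\<^sup>2 * c)"
    using assms[of "- b / C"] by simp
  also have "\<dots> = b\<^sup>2 * (c - 2 * C)"
    using C by (simp add: field_simps power2_eq_square)
  also have "\<dots> < 0"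
    using C b by (intro mult_pos_neg) auto
  finally show False
    by simp
qed

text \<open>For a positive semi-definite block the smallest singular value, which \<open>\<mu>\<close> measures, is the smallest value of the Rayleigh
quotient. By compactness the quotient has a minimiser \<open>u\<close> among unit vectors on \<open>I\<close>; perturbing \<open>u\<close> in the direction
\<open>h = A u - c u\<close> shows that \<open>u\<close> is an eigenvector, whose eigenvalue \<open>c \<ge> 0\<close> is then the norm of its image.\<close>

lemma gram_block_lower_bound:
  fixes x :: "nat \<Rightarrow> real^'d"
  assumes "\<And>v. vec_on I v \<Longrightarrow> m * norm v \<le> norm (sub_matrix (gram n x) I I *v v)"
    and v: "vec_on I v"
  shows "m * (norm v)\<^sup>2 \<le> v \<bullet> (gram n x *v v)"
proof (cases "v = 0")
  case False
  let ?A = "gram n x"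
  let ?S = "{u :: real^'d. vec_on I u \<and> norm u = 1}"
  have "closed {u :: real^'d. vec_on I u}"
    unfolding vec_on_def by (intro closed_Collect_all closed_Collect_imp closed_Collect_eq) (auto intro!: continuous_intros)
  moreover have "?S = sphere 0 1 \<inter> {u. vec_on I u}"
    by auto
  ultimately have "compact ?S"
    using compact_Int_closed[OF compact_sphere] by metis
  moreover have "?S \<noteq> {}"
  proof -
    have "v /\<^sub>R norm v \<in> ?S"
      using v False by (auto simp: vec_on_def)
    then show ?thesis
      by blast
  qed
  moreover have "continuous_on ?S (\<lambda>u. u \<bullet> (?A *v u))"
    by (intro continuous_intros)
  ultimately obtain u where u: "vec_on I u" "norm u = 1"
    and min: "\<And>w. w \<in> ?S \<Longrightarrow> u \<bullet> (?A *v u) \<le> w \<bullet> (?A *v w)"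
    using continuous_attains_inf[of ?S "\<lambda>u. u \<bullet> (?A *v u)"] by auto
  define c where "c = u \<bullet> (?A *v u)"
  have c: "0 \<le> c"
    unfolding c_def by (simp flip: pred_norm_power2)
  have low: "c * (norm w)\<^sup>2 \<le> w \<bullet> (?A *v w)" if "vec_on I w" for w
  proof (cases "w = 0")
    case False
    then have "c \<le> (w /\<^sub>R norm w) \<bullet> (?A *v (w /\<^sub>R norm w))"
      unfolding c_def using that by (intro min) (auto simp: vec_on_def)
    also have "\<dots> = (w \<bullet> (?A *v w)) / (norm w)\<^sup>2"
      by (simp add: matrix_vector_mult_scaleR power2_eq_square field_simps)
    finally show ?thesis
      using False by (simp add: field_simps)
  qed simp
  define h where "h = restr I (?A *v u) - c *\<^sub>R u"
  have hI: "vec_on I h"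
    using u by (auto simp: h_def vec_on_def)
  have "h \<bullet> (?A *v u) - c * (h \<bullet> u) = 0"
  proof (rule linear_coeff_zero)
    fix e :: real
    have "vec_on I (u + e *\<^sub>R h)"
      using u(1) hI by (auto simp: vec_on_def)
    from low[OF this] show "0 \<le> 2 * e * (h \<bullet> (?A *v u) - c * (h \<bullet> u)) +
        e\<^sup>2 * (h \<bullet> (?A *v h) - c * (h \<bullet> h))"
      unfolding power2_norm_eq_inner using u(2) gram_inner_commute[of u n x h]
      by (simp add: matrix_vector_right_distrib matrix_vector_mult_scaleR inner_add_left
          inner_add_right c_def[symmetric] power2_eq_square algebra_simps inner_commute norm_eq_1)
  qed
  then have "h \<bullet> h = 0"
    using hI by (simp add: h_def inner_diff_right inner_restr_vec_on)
  then have "sub_matrix ?A I I *v u = c *\<^sub>R u"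
    using u by (simp add: sub_matrix_mult restr_vec_on h_def)
  then have "m \<le> c"
    using assms(1)[OF u(1)] u(2) c by simp
  then show ?thesis
    using low[OF v] by (meson mult_right_mono order_trans zero_le_power2)
qed simp

section \<open>The block coefficients \<open>\<pi>\<close> and \<open>\<gamma>\<close>\<close>

lemma card_add_card_compl: "card I + card (- I) = CARD('d)" for I :: "'d::finite set"
  using card_Un_disjoint[of I "- I"] by simp

lemma disjoint_block_exists:
  fixes I :: "'d::finite set"
  assumes "card I + l \<le> CARD('d)" "1 \<le> l"
  shows "\<exists>J (u :: real^'d). card J = l \<and> I \<inter> J = {} \<and> vec_on J u \<and> u \<noteq> 0"
proof -
  obtain J where J: "J \<subseteq> - I" "card J = l"
    using obtain_subset_with_card_n[of l "- I"] card_add_card_compl[of I] assms(1) by auto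
  then obtain j where "j \<in> J"
    using assms(2) by fastforce
  then have "vec_on J (axis j (1::real))" "axis j (1::real) \<noteq> 0"
    by (auto simp: vec_on_def axis_def vec_eq_iff)
  then show ?thesis
    using J by blast
qed

text \<open>A finite supremum has no vanishing denominator, which is why every quadratic form \<open>v\<^sup>T A\<^sub>I\<^sub>I v\<^sup>p\<^sup>-\<^sup>1\<close> is
positive. The constant is nonnegative because \<open>u\<close> and \<open>- u\<close> both enter the supremum. A block \<open>J\<close> disjoint from
\<open>I\<close> exists since \<open>k + l \<le> d\<close>.\<close>

lemma pi_coef_real:
  fixes A :: "real^'d^'d"
  assumes "1 \<le> p" "1 \<le> k" "1 \<le> l" "k + l \<le> CARD('d)" and fin: "pi_coef p A k l \<noteq> \<infinity>"
  obtains P where "pi_coef p A k l = ereal P" "0 \<le> P"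
    "\<And>I v. card I = k \<Longrightarrow> vec_on I v \<Longrightarrow> v \<noteq> 0 \<Longrightarrow> 0 < v \<bullet> (sub_matrix A I I *v dual_power p v)"
    "\<And>I J u v. card I = k \<Longrightarrow> card J = l \<Longrightarrow> I \<inter> J = {} \<Longrightarrow> vec_on I v \<Longrightarrow> v \<noteq> 0 \<Longrightarrow> vec_on J u \<Longrightarrow>
       (dual_power p v \<bullet> (sub_matrix A I J *v u)) * lp_norm p v
         \<le> P * (v \<bullet> (sub_matrix A I I *v dual_power p v)) * lp_norm \<infinity> u"
proof -
  let ?W = "\<lambda>v I. v \<bullet> (sub_matrix A I I *v dual_power p v)"
  let ?N = "\<lambda>v u I J. (dual_power p v \<bullet> (sub_matrix A I J *v u)) * lp_norm p v"
  have upper: "ratio (ereal (?N v u I J)) (ereal (max 0 (?W v I) * lp_norm \<infinity> u)) \<le> pi_coef p A k l"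
    if "card I = k" "card J = l" "I \<inter> J = {}" "vec_on I v" "v \<noteq> 0" "vec_on J u" "u \<noteq> 0" for v u I J
    unfolding pi_coef_def using that
    by (intro SUP_upper2[of "(v, u, I, J)"]) auto
  have W: "0 < ?W v I" if vI: "card I = k" "vec_on I v" "v \<noteq> 0" for v I
  proof (rule ccontr)
    assume "\<not> 0 < ?W v I"
    then have "max 0 (?W v I) = 0"
      by simp
    moreover obtain J and u :: "real^'d" where "card J = l" "I \<inter> J = {}" "vec_on J u" "u \<noteq> 0"
      using disjoint_block_exists[of I l] vI assms by auto
    ultimately have "\<infinity> \<le> pi_coef p A k l"
      using upper[of I J v u] that by (simp add: ratio_def zero_ereal_def[symmetric])
    then show False
      using fin by simp
  qed
  have quot: "ereal (?N v u I J / (?W v I * lp_norm \<infinity> u)) \<le> pi_coef p A k l"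
    if "card I = k" "card J = l" "I \<inter> J = {}" "vec_on I v" "v \<noteq> 0" "vec_on J u" "u \<noteq> 0" for v u I J
  proof -
    have "0 < ?W v I * lp_norm \<infinity> u" "max 0 (?W v I) = ?W v I"
      using W[of I v] that lp_norm_pos[of \<infinity> u] by auto
    then show ?thesis
      using upper[OF that] ratio_ereal by metis
  qed
  obtain v0 :: "real^'d" and I0 where vI: "card I0 = k" "vec_on I0 v0" "v0 \<noteq> 0"
    using block_vectors_nonempty[of k] assms by force
  obtain J0 and u0 :: "real^'d" where uJ: "card J0 = l" "I0 \<inter> J0 = {}" "vec_on J0 u0" "u0 \<noteq> 0"
    using disjoint_block_exists[of I0 l] vI assms by auto
  let ?q = "?N v0 u0 I0 J0 / (?W v0 I0 * lp_norm \<infinity> u0)"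
  have neg: "vec_on J0 (- u0)" "- u0 \<noteq> 0"
    using uJ by (auto simp: vec_on_def)
  have "sub_matrix A I0 J0 *v (- u0) = - (sub_matrix A I0 J0 *v u0)"
    by (metis scaleR_minus1_left matrix_vector_mult_scaleR)
  then have "ereal ?q \<le> pi_coef p A k l" "ereal (- ?q) \<le> pi_coef p A k l"
    using quot[OF vI(1) uJ(1,2) vI(2,3) uJ(3,4)] quot[OF vI(1) uJ(1,2) vI(2,3) neg]
    by (simp_all add: lp_norm_minus)
  then have "ereal \<bar>?q\<bar> \<le> pi_coef p A k l"
    by (simp add: abs_if)
  then have "0 \<le> pi_coef p A k l"
    by (meson abs_ge_zero ereal_less_eq(5) order_trans)
  then obtain P where P: "pi_coef p A k l = ereal P" "0 \<le> P"
    using fin by (cases "pi_coef p A k l") auto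
  show thesis
  proof (rule that[OF P W])
    fix I J and u v :: "real^'d"
    assume *: "card I = k" "card J = l" "I \<inter> J = {}" "vec_on I v" "v \<noteq> 0" "vec_on J u"
    show "?N v u I J \<le> P * ?W v I * lp_norm \<infinity> u"
    proof (cases "u = 0")
      case True
      then show ?thesis
        by (simp add: lp_norm_zero)
    next
      case False
      then have "0 < ?W v I * lp_norm \<infinity> u"
        using W[of I v] * lp_norm_pos[of \<infinity> u] by auto
      then show ?thesis
        using quot[OF * False] unfolding P by (simp add: pos_divide_le_eq mult.assoc)
    qed
  qed
qed

lemma sub_matrix_identity_mult: "sub_matrix (mat 1) I I *v w = restr I w"
  by (auto simp: sub_matrix_mult vec_eq_iff)

text \<open>In terms of vectors a block inverse ignores entries outside \<open>I\<close>, maps into vectors on \<open>I\<close> and inverts the block there.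
These facts determine it, which justifies the definite description in \<open>block_inverse\<close>.\<close>

lemma block_inverse_apply:
  assumes B: "is_block_inverse A I B"
  shows "vec_on I v \<Longrightarrow> B *v (sub_matrix A I I *v v) = v"
    and "sub_matrix A I I *v (B *v w) = restr I w"
    and "vec_on I (B *v w)"
    and "B *v restr I w = B *v w"
proof -
  have *: "B *v w = restr I (B *v restr I w)" for w
    using B by (metis is_block_inverse_def sub_matrix_mult)
  show "vec_on I (B *v w)"
    using * by (metis vec_on_restr)
  show "B *v restr I w = B *v w"
    using *[of w] *[of "restr I w"] by (metis restr_vec_on vec_on_restr)
  show "B *v (sub_matrix A I I *v v) = v" if "vec_on I v"
    using B that by (simp add: is_block_inverse_def matrix_vector_mul_assoc
        sub_matrix_identity_mult restr_vec_on)
  show "sub_matrix A I I *v (B *v w) = restr I w"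
    using B by (simp add: is_block_inverse_def matrix_vector_mul_assoc sub_matrix_identity_mult)
qed

lemma is_block_inverse_block_inverse:
  assumes "block_invertible A I"
  shows "is_block_inverse A I (block_inverse A I)"
proof -
  obtain B where B: "is_block_inverse A I B"
    using assms by (auto simp: block_invertible_def)
  have "C = B" if C: "is_block_inverse A I C" for C
  proof -
    have "C *v w = B *v w" for w
      using block_inverse_apply[OF B] block_inverse_apply[OF C] by metis
    then show ?thesis
      by (simp add: matrix_eq)
  qed
  then show ?thesis
    unfolding block_inverse_def using theI[of "is_block_inverse A I" B] B by blast
qed

lemma gamma_coef_real:
  fixes A :: "real^'d^'d"
  assumes "1 \<le> p" "1 \<le> k" "1 \<le> l" "k + l \<le> CARD('d)" and fin: "gamma_coef p A k l \<noteq> \<infinity>"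
  obtains G where "gamma_coef p A k l = ereal G" "0 \<le> G"
    "\<And>I. card I = k \<Longrightarrow> block_invertible A I"
    "\<And>I J u. card I = k \<Longrightarrow> card J = l \<Longrightarrow> I \<inter> J = {} \<Longrightarrow> vec_on J u \<Longrightarrow>
       lp_norm p (block_inverse A I *v (sub_matrix A I J *v u)) \<le> G * lp_norm \<infinity> u"
proof -
  let ?N = "\<lambda>u I J. lp_norm p (block_inverse A I *v (sub_matrix A I J *v u))"
  have inv: "block_invertible A I" if "card I = k" for I
    using that fin by (auto simp: gamma_coef_def split: if_splits)
  have quot: "ereal (?N u I J / lp_norm \<infinity> u) \<le> gamma_coef p A k l"
    if "card I = k" "card J = l" "I \<inter> J = {}" "vec_on J u" "u \<noteq> 0" for u I J
  proof -
    have "ratio (ereal (?N u I J)) (ereal (lp_norm \<infinity> u)) \<le> gamma_coef p A k l"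
      unfolding gamma_coef_def using that inv
      by (auto intro!: SUP_upper2[of "(u, I, J)"])
    then show ?thesis
      using that lp_norm_pos[of \<infinity> u] by (simp add: ratio_ereal)
  qed
  obtain I0 :: "'d set" where I0: "card I0 = k"
    using assms(4) obtain_subset_with_card_n[of k "UNIV :: 'd set"] by auto
  obtain J0 and u0 :: "real^'d" where uJ: "card J0 = l" "I0 \<inter> J0 = {}" "vec_on J0 u0" "u0 \<noteq> 0"
    using disjoint_block_exists[of I0 l] I0 assms by auto
  have "0 \<le> ?N u0 I0 J0 / lp_norm \<infinity> u0"
    using assms(1) by (simp add: lp_norm_nonneg)
  then have "0 \<le> gamma_coef p A k l"
    using quot[OF I0 uJ] by (meson ereal_less_eq(5) order_trans)
  then obtain G where G: "gamma_coef p A k l = ereal G" "0 \<le> G"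
    using fin by (cases "gamma_coef p A k l") auto
  show thesis
  proof (rule that[OF G inv])
    fix I J and u :: "real^'d"
    assume *: "card I = k" "card J = l" "I \<inter> J = {}" "vec_on J u"
    show "?N u I J \<le> G * lp_norm \<infinity> u"
    proof (cases "u = 0")
      case True
      then show ?thesis
        using assms(1) by (simp add: lp_norm_zero)
    next
      case False
      then show ?thesis
        using quot[OF * False] lp_norm_pos[of \<infinity> u] unfolding G by (simp add: pos_divide_le_eq)
    qed
  qed
qed

section \<open>Stationary points of penalized least squares\<close>

definition noise_corr :: "nat \<Rightarrow> (nat \<Rightarrow> real^'d) \<Rightarrow> (nat \<Rightarrow> real) \<Rightarrow> real^'d \<Rightarrow> real^'d" where
  "noise_corr n x Y \<beta> = (\<chi> j. (\<Sum>i=1..n. x i $ j * (Y i - \<beta> \<bullet> x i)) / real n)"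

lemma inner_noise_corr:
  "u \<bullet> noise_corr n x Y \<beta> = (\<Sum>i=1..n. (x i \<bullet> u) * (Y i - \<beta> \<bullet> x i)) / real n"
proof -
  have "u \<bullet> noise_corr n x Y \<beta> = (\<Sum>j\<in>UNIV. (\<Sum>i=1..n. x i $ j * u $ j * (Y i - \<beta> \<bullet> x i)) / real n)"
    unfolding inner_vec_def[of u] noise_corr_def
    by (simp add: sum_distrib_left mult.assoc mult.left_commute)
  also have "\<dots> = (\<Sum>i=1..n. \<Sum>j\<in>UNIV. x i $ j * u $ j * (Y i - \<beta> \<bullet> x i)) / real n"
    by (subst sum.swap) (simp add: sum_divide_distrib)
  finally show ?thesis
    by (simp add: inner_vec_def sum_distrib_right)
qed

text \<open>Second-order expansion of the squared loss at \<open>b\<close>; it is exact, and half its gradient is \<open>A (b - \<beta>) - z\<close>.\<close>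

lemma squared_loss_shift:
  "(\<Sum>i=1..n. ((b + u) \<bullet> x i - Y i)\<^sup>2) / real n =
     (\<Sum>i=1..n. (b \<bullet> x i - Y i)\<^sup>2) / real n
     + 2 * (u \<bullet> (gram n x *v (b - \<beta>) - noise_corr n x Y \<beta>)) + u \<bullet> (gram n x *v u)"
proof -
  have "2 * (u \<bullet> (gram n x *v (b - \<beta>) - noise_corr n x Y \<beta>)) + u \<bullet> (gram n x *v u) =
     (\<Sum>i=1..n. 2 * ((x i \<bullet> u) * (x i \<bullet> (b - \<beta>))) - 2 * ((x i \<bullet> u) * (Y i - \<beta> \<bullet> x i))
        + (x i \<bullet> u) * (x i \<bullet> u)) / real n"
    unfolding inner_diff_right inner_gram inner_noise_corr
    by (simp add: sum.distrib sum_subtractf diff_divide_distrib add_divide_distrib sum_distrib_left)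
  also have "\<dots> = (\<Sum>i=1..n. ((b + u) \<bullet> x i - Y i)\<^sup>2 - (b \<bullet> x i - Y i)\<^sup>2) / real n"
  proof -
    have "2 * ((x i \<bullet> u) * (x i \<bullet> (b - \<beta>))) - 2 * ((x i \<bullet> u) * (Y i - \<beta> \<bullet> x i)) + (x i \<bullet> u) * (x i \<bullet> u)
        = ((b + u) \<bullet> x i - Y i)\<^sup>2 - (b \<bullet> x i - Y i)\<^sup>2" for i
      unfolding inner_commute[of "x i"] inner_diff_left inner_add_left power2_eq_square by algebra
    then show ?thesis
      by simp
  qed
  finally show ?thesis
    by (simp add: sum_subtractf diff_divide_distrib)
qed

text \<open>The first-order condition with respect to the penalized set \<open>P\<close>. Together with \<open>\<bar>w\<bar> \<le> lam / 2\<close> the inequality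
\<open>b $ j * w \<le> - (lam / 2) * \<bar>b $ j\<bar>\<close> says that \<open>w\<close> is \<open>- lam / 2\<close> times a subgradient of the absolute value at \<open>b $ j\<close>.\<close>

definition stationary ::
    "real^'d^'d \<Rightarrow> real^'d \<Rightarrow> real \<Rightarrow> 'd set \<Rightarrow> real^'d \<Rightarrow> real^'d \<Rightarrow> bool" where
  "stationary A z lam P \<beta> b \<longleftrightarrow>
     (\<forall>j. let w = (A *v (b - \<beta>)) $ j - z $ j in
        \<bar>w\<bar> \<le> lam / 2 \<and> (if j \<in> P then b $ j * w \<le> - (lam / 2) * \<bar>b $ j\<bar> else w = 0))"

lemma nonneg_of_small_perturbation:
  fixes a m :: real
  assumes "\<And>e. 0 < e \<Longrightarrow> e < 1 \<Longrightarrow> 0 \<le> a + e * m"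
  shows "0 \<le> a"
proof (rule tendsto_lowerbound)
  show "((\<lambda>e. a + e * m) \<longlongrightarrow> a) (at_right 0)"
    by (auto intro!: tendsto_eq_intros)
  show "eventually (\<lambda>e. 0 \<le> a + e * m) (at_right 0)"
    using assms eventually_at_right_less[of "0::real"] eventually_at_right_field[of "\<lambda>e. e < 1" 0]
    by (auto elim!: eventually_mono intro: exI[of _ 1] simp: eventually_at_right_field)
qed simp

text \<open>Moving by a small \<open>c\<close> of either sign gives the first bound, and shrinking \<open>b\<close> towards \<open>0\<close> gives the second; the quadratic
term disappears in the limit.\<close>

lemma scalar_stationarity:
  fixes w m lam b :: real
  assumes "0 \<le> lam" and min: "\<And>c. 0 \<le> 2 * c * w + c\<^sup>2 * m + lam * (\<bar>b + c\<bar> - \<bar>b\<bar>)"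
  shows "\<bar>w\<bar> \<le> lam / 2" and "b * w \<le> - (lam / 2) * \<bar>b\<bar>"
proof -
  have abs: "0 \<le> 2 * c * w + c\<^sup>2 * m + lam * \<bar>c\<bar>" for c
  proof -
    have "lam * (\<bar>b + c\<bar> - \<bar>b\<bar>) \<le> lam * \<bar>c\<bar>"
      using assms(1) by (intro mult_left_mono) auto
    then show ?thesis
      using min[of c] by linarith
  qed
  have div: "0 \<le> r" if "0 < e" "0 \<le> e * r" for e r :: real
    using that by (simp add: zero_le_mult_iff)
  have "0 \<le> 2 * w + lam"
  proof (rule nonneg_of_small_perturbation)
    fix e :: real assume "0 < e"
    show "0 \<le> 2 * w + lam + e * m"
      by (rule div[OF \<open>0 < e\<close>]) (use abs[of e] \<open>0 < e\<close> in \<open>auto simp: power2_eq_square algebra_simps\<close>)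
  qed
  moreover have "0 \<le> - 2 * w + lam"
  proof (rule nonneg_of_small_perturbation)
    fix e :: real assume "0 < e"
    show "0 \<le> - 2 * w + lam + e * m"
      by (rule div[OF \<open>0 < e\<close>]) (use abs[of "- e"] \<open>0 < e\<close> in \<open>auto simp: power2_eq_square algebra_simps\<close>)
  qed
  ultimately show "\<bar>w\<bar> \<le> lam / 2"
    by simp
  have "0 \<le> - 2 * b * w - lam * \<bar>b\<bar>"
  proof (rule nonneg_of_small_perturbation)
    fix e :: real assume "0 < e" and e: "e < 1"
    have "b + - e * b = (1 - e) * b"
      by (simp add: algebra_simps)
    then have scaled: "\<bar>b + - e * b\<bar> = (1 - e) * \<bar>b\<bar>"
      using e by (simp only: abs_mult abs_of_pos diff_gt_0_iff_gt)
    show "0 \<le> - 2 * b * w - lam * \<bar>b\<bar> + e * (b\<^sup>2 * m)"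
      by (rule div[OF \<open>0 < e\<close>]) (use min[of "- e * b", unfolded scaled] in \<open>simp add: power2_eq_square algebra_simps\<close>)
  qed
  then show "b * w \<le> - (lam / 2) * \<bar>b\<bar>"
    by simp
qed

lemma arg_min_stationary:
  assumes lam: "0 \<le> lam" and min: "is_arg_min (penalized_loss n x Y lam P) (\<lambda>_. True) b"
  shows "stationary (gram n x) (noise_corr n x Y \<beta>) lam P \<beta> b"
  unfolding stationary_def Let_def
proof
  fix j
  define w where "w = (gram n x *v (b - \<beta>)) $ j - noise_corr n x Y \<beta> $ j"
  have *: "0 \<le> 2 * c * w + c\<^sup>2 * (axis j 1 \<bullet> (gram n x *v axis j 1))
           + (if j \<in> P then lam else 0) * (\<bar>b $ j + c\<bar> - \<bar>b $ j\<bar>)" for c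
  proof -
    let ?u = "c *\<^sub>R axis j 1 :: real^'a"
    have "\<not> penalized_loss n x Y lam P (b + ?u) < penalized_loss n x Y lam P b"
      using min by (simp add: is_arg_min_def)
    then have "0 \<le> 2 * (?u \<bullet> (gram n x *v (b - \<beta>) - noise_corr n x Y \<beta>)) + ?u \<bullet> (gram n x *v ?u)
        + lam * ((\<Sum>i\<in>P. \<bar>(b + ?u) $ i\<bar>) - (\<Sum>i\<in>P. \<bar>b $ i\<bar>))"
      unfolding penalized_loss_def squared_loss_shift[of b ?u x Y n \<beta>] by (simp add: algebra_simps)
    also have "(\<Sum>i\<in>P. \<bar>(b + ?u) $ i\<bar>) - (\<Sum>i\<in>P. \<bar>b $ i\<bar>) =
        (\<Sum>i\<in>P. if i = j then \<bar>b $ j + c\<bar> - \<bar>b $ j\<bar> else 0)"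
      unfolding sum_subtractf[symmetric] by (intro sum.cong) (auto simp: axis_def)
    also have "\<dots> = (if j \<in> P then \<bar>b $ j + c\<bar> - \<bar>b $ j\<bar> else 0)"
      by simp
    finally show ?thesis
      by (auto simp: w_def inner_axis' matrix_vector_mult_scaleR power2_eq_square mult.assoc)
  qed
  from scalar_stationarity[OF _ *] lam show "\<bar>(gram n x *v (b - \<beta>)) $ j - noise_corr n x Y \<beta> $ j\<bar> \<le> lam / 2 \<and>
     (if j \<in> P then b $ j * ((gram n x *v (b - \<beta>)) $ j - noise_corr n x Y \<beta> $ j) \<le> - (lam / 2) * \<bar>b $ j\<bar>
      else (gram n x *v (b - \<beta>)) $ j - noise_corr n x Y \<beta> $ j = 0)"
    unfolding w_def[symmetric] by (cases "j \<in> P") auto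
qed

text \<open>Positive semi-definiteness gives \<open>0 \<le> (b - \<beta>) \<bullet> (z + w)\<close>. Outside \<open>K\<close> all coordinates are penalized, so \<open>w\<close> contributes
\<open>- lam / 2\<close> times \<open>\<bar>b $ j\<bar>\<close> and at most \<open>lam / 2\<close> times \<open>\<bar>\<beta> $ j\<bar>\<close>; everywhere else absolute values are taken.\<close>

lemma stationary_cone:
  assumes A: "A = gram n x" and st: "stationary A z lam P \<beta> b" and P: "- P \<subseteq> K"
    and z: "\<And>j. \<bar>z $ j\<bar> \<le> \<tau>"
  shows "(lam / 2 - \<tau>) * (\<Sum>j\<in>- K. \<bar>b $ j\<bar>) \<le>
           (lam / 2 + \<tau>) * ((\<Sum>j\<in>K. \<bar>(b - \<beta>) $ j\<bar>) + (\<Sum>j\<in>- K. \<bar>\<beta> $ j\<bar>))"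
proof -
  let ?D = "b - \<beta>"
  define w where "w = A *v ?D - z"
  have w: "\<bar>w $ j\<bar> \<le> lam / 2" "j \<in> P \<Longrightarrow> b $ j * w $ j \<le> - (lam / 2) * \<bar>b $ j\<bar>" for j
    using st by (auto simp: stationary_def Let_def w_def split: if_splits)
  have prod: "c * v \<le> e * \<bar>c\<bar>" if "\<bar>v\<bar> \<le> e" for c v e :: real
    using mult_left_mono[OF that abs_ge_zero[of c]] abs_le_D1[of "c * v" "\<bar>c\<bar> * \<bar>v\<bar>"]
    by (simp add: abs_mult mult.commute)
  have inK: "?D $ j * (z $ j + w $ j) \<le> (lam / 2 + \<tau>) * \<bar>?D $ j\<bar>" for j
    using prod[OF z, of "?D $ j" j] prod[OF w(1), of "?D $ j" j] by (simp add: algebra_simps)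
  have outK: "?D $ j * (z $ j + w $ j) \<le> (lam / 2 + \<tau>) * \<bar>\<beta> $ j\<bar> - (lam / 2 - \<tau>) * \<bar>b $ j\<bar>"
    if "j \<in> - K" for j
  proof -
    have "j \<in> P"
      using that P by auto
    then show ?thesis
      using w(2)[of j] prod[OF z, of "b $ j" j] prod[OF z, of "- \<beta> $ j" j]
        prod[OF w(1), of "- \<beta> $ j" j]
      by (simp add: algebra_simps)
  qed
  have "0 \<le> (pred_norm n x ?D)\<^sup>2"
    by simp
  also have "\<dots> = ?D \<bullet> (z + w)"
    by (simp add: pred_norm_power2 w_def A)
  also have "\<dots> = (\<Sum>j\<in>K. ?D $ j * (z $ j + w $ j)) + (\<Sum>j\<in>- K. ?D $ j * (z $ j + w $ j))"
    unfolding inner_vec_def using sum.union_disjoint[of K "- K"] by simp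
  also have "\<dots> \<le> (\<Sum>j\<in>K. (lam / 2 + \<tau>) * \<bar>?D $ j\<bar>) +
      (\<Sum>j\<in>- K. (lam / 2 + \<tau>) * \<bar>\<beta> $ j\<bar> - (lam / 2 - \<tau>) * \<bar>b $ j\<bar>)"
    using inK outK by (intro add_mono sum_mono) auto
  finally show ?thesis
    unfolding sum_subtractf sum_distrib_left[symmetric] distrib_left by linarith
qed

text \<open>The value of \<open>(lam / 2 + \<tau>) / (lam / 2 - \<tau>)\<close> when \<open>4 * (2 - t) * \<tau> = t * lam\<close>, which is the extreme case allowed.\<close>

definition cone_ratio :: "real \<Rightarrow> real" where
  "cone_ratio t = (4 - t) / (4 - 3 * t)"

lemma stationary_cone_ratio:
  assumes "A = gram n x" "stationary A z lam P \<beta> b" "- P \<subseteq> K" "\<And>j. \<bar>z $ j\<bar> \<le> \<tau>"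
    and t: "0 < t" "t < 1" and lam: "0 < lam" "4 * (2 - t) * \<tau> \<le> t * lam"
  shows "(\<Sum>j\<in>- K. \<bar>b $ j\<bar>) \<le>
           cone_ratio t * ((\<Sum>j\<in>K. \<bar>(b - \<beta>) $ j\<bar>) + (\<Sum>j\<in>- K. \<bar>\<beta> $ j\<bar>))"
proof -
  let ?L = "\<Sum>j\<in>- K. \<bar>b $ j\<bar>"
  let ?R = "(\<Sum>j\<in>K. \<bar>(b - \<beta>) $ j\<bar>) + (\<Sum>j\<in>- K. \<bar>\<beta> $ j\<bar>)"
  have R: "0 \<le> ?R" and L: "0 \<le> ?L"
    by (auto intro!: add_nonneg_nonneg sum_nonneg)
  have pos: "0 < lam / 2 - \<tau>"
  proof -
    have "4 * (2 - t) * \<tau> < 4 * (2 - t) * (lam / 2)"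
    proof -
      have "t * lam < 2 * (2 - t) * lam"
        using lam t by (intro mult_strict_right_mono) auto
      then show ?thesis
        using lam(2) by linarith
    qed
    then show ?thesis
      using t by simp
  qed
  have "(4 - 3 * t) * (lam / 2 + \<tau>) \<le> (4 - t) * (lam / 2 - \<tau>)"
    using lam by (simp add: algebra_simps)
  then have "lam / 2 + \<tau> \<le> cone_ratio t * (lam / 2 - \<tau>)"
    using t by (simp add: cone_ratio_def field_simps)
  then have "(lam / 2 + \<tau>) * ?R \<le> cone_ratio t * (lam / 2 - \<tau>) * ?R"
    using R by (intro mult_right_mono) auto
  with stationary_cone[OF assms(1-4)]
  have "(lam / 2 - \<tau>) * ?L \<le> (lam / 2 - \<tau>) * (cone_ratio t * ?R)"
    by (simp add: mult_ac)
  then show ?thesis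
    using pos by simp
qed

text \<open>The last two bounds say that multiplying a defect \<open>1 - t\<close> by the cone ratio, even when enlarged by \<open>1 + t / 4\<close>,
still leaves a defect proportional to \<open>t\<close>.\<close>

lemma cone_ratio_bounds:
  assumes "0 < t" "t < 1"
  shows "0 < cone_ratio t" "cone_ratio t \<le> 3" "cone_ratio t * (1 - t) \<le> 1 - t / 2"
    "cone_ratio t * (1 + t / 4) * (1 - t) \<le> 1 - t / 4"
proof -
  have pos: "0 < 4 - 3 * t"
    using assms by simp
  show "0 < cone_ratio t"
    using assms by (simp add: cone_ratio_def)
  show "cone_ratio t \<le> 3"
    using assms by (simp add: cone_ratio_def pos_divide_le_eq[OF pos])
  have "(4 - t) * (1 - t) \<le> (1 - t / 2) * (4 - 3 * t)"
    by (simp add: algebra_simps)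
  then show "cone_ratio t * (1 - t) \<le> 1 - t / 2"
    using pos by (simp add: cone_ratio_def pos_divide_le_eq)
  have "(1 + t / 4) * (1 - t) \<le> (4 - 3 * t) / 4"
    by (simp add: algebra_simps)
  then have "(4 - t) * ((1 + t / 4) * (1 - t)) \<le> (4 - t) * ((4 - 3 * t) / 4)"
    using assms by (intro mult_left_mono) auto
  also have "(4 - t) * ((4 - 3 * t) / 4) = (1 - t / 4) * (4 - 3 * t)"
    by (simp add: field_simps)
  finally show "cone_ratio t * (1 + t / 4) * (1 - t) \<le> 1 - t / 4"
    using pos by (simp add: cone_ratio_def pos_divide_le_eq mult.assoc)
qed

section \<open>Sup-norm error of the first stage\<close>

text \<open>If \<open>c\<close> has the signs of the error, the coordinates outside the support of \<open>\<beta>\<close> contribute nonpositively: there the error is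
\<open>b\<close> itself, and the penalty \<open>lam / 2\<close> pointing against \<open>b\<close> exceeds the noise. Hence only \<open>S\<close> remains, which gives the factor
\<open>s powr (1 / p)\<close> instead of \<open>(s + l) powr (1 / p)\<close> in the condition on \<open>\<omega>\<close>.\<close>

lemma inner_le_of_stationary:
  assumes st: "stationary A z lam UNIV \<beta> b" and z: "\<And>j. \<bar>z $ j\<bar> \<le> \<tau>" and \<tau>: "\<tau> \<le> lam / 4" and lam: "0 \<le> lam"
    and S: "S = {j. \<beta> $ j \<noteq> 0}"
    and c: "vec_on I c" "\<And>j. j \<in> I \<Longrightarrow> c $ j = \<bar>c $ j\<bar> * sgn ((b - \<beta>) $ j)" and SI: "S \<subseteq> I"
  shows "c \<bullet> (A *v (b - \<beta>)) \<le> 3 / 4 * lam * (\<Sum>j\<in>S. \<bar>c $ j\<bar>)"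
proof -
  let ?w = "\<lambda>j. (A *v (b - \<beta>)) $ j - z $ j"
  have w: "\<bar>?w j\<bar> \<le> lam / 2" "b $ j * ?w j \<le> - (lam / 2) * \<bar>b $ j\<bar>" for j
    using st by (auto simp: stationary_def Let_def)
  have "c \<bullet> (A *v (b - \<beta>)) \<le> (\<Sum>j\<in>I. if j \<in> S then 3 / 4 * lam * \<bar>c $ j\<bar> else 0)"
  proof (rule inner_vec_on_le[OF c(1)])
    fix j assume j: "j \<in> I"
    show "c $ j * (A *v (b - \<beta>)) $ j \<le> (if j \<in> S then 3 / 4 * lam * \<bar>c $ j\<bar> else 0)"
    proof (cases "j \<in> S")
      case True
      have "c $ j * (A *v (b - \<beta>)) $ j \<le> \<bar>c $ j\<bar> * \<bar>(A *v (b - \<beta>)) $ j\<bar>"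
        by (simp flip: abs_mult)
      also have "\<dots> \<le> \<bar>c $ j\<bar> * (3 / 4 * lam)"
      proof (rule mult_left_mono)
        show "\<bar>(A *v (b - \<beta>)) $ j\<bar> \<le> 3 / 4 * lam"
          using w(1)[of j] z[of j] \<tau> by linarith
      qed simp
      finally show ?thesis
        using True by (simp add: mult_ac)
    next
      case False
      then have bj: "(b - \<beta>) $ j = b $ j"
        using S by simp
      have "sgn (b $ j) * (A *v (b - \<beta>)) $ j \<le> 0"
      proof (cases "b $ j = 0")
        case nz: False
        have "\<bar>b $ j\<bar> * (sgn (b $ j) * ?w j) \<le> \<bar>b $ j\<bar> * (- (lam / 2))"
          using w(2)[of j] by (simp add: mult.assoc[symmetric] abs_mult_sgn mult.commute)
        then have "sgn (b $ j) * ?w j \<le> - (lam / 2)"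
          using nz by (subst (asm) mult_le_cancel_left_pos) auto
        moreover have "sgn (b $ j) * z $ j \<le> lam / 2"
          using z[of j] \<tau> lam by (auto simp: sgn_if)
        ultimately show ?thesis
          by (simp add: algebra_simps)
      qed simp
      then have "\<bar>c $ j\<bar> * (sgn (b $ j) * (A *v (b - \<beta>)) $ j) \<le> 0"
        by (simp add: mult_nonneg_nonpos)
      then show ?thesis
        using False c(2)[OF j] bj by (simp add: mult.assoc[symmetric])
    qed
  qed
  also have "\<dots> = (\<Sum>j\<in>S. 3 / 4 * lam * \<bar>c $ j\<bar>)"
    using SI by (simp add: sum.If_cases Int_absorb1)
  finally show ?thesis
    by (simp add: sum_distrib_left)
qed

lemma ratio_condition:
  fixes \<alpha> m c lam t :: real
  assumes "0 < \<alpha>" "0 \<le> m" "0 < c" "0 < lam"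
    and "ratio 16 (ereal \<alpha> * ereal m) * ereal c * ereal lam \<le> ereal t"
  shows "0 < m" and "16 * c * lam \<le> t * (\<alpha> * m)"
proof -
  show m: "0 < m"
  proof (rule ccontr)
    assume "\<not> 0 < m"
    then have "m = 0"
      using assms(2) by simp
    then show False
      using assms by (simp add: ratio_def zero_ereal_def[symmetric])
  qed
  have "ratio 16 (ereal \<alpha> * ereal m) = ereal (16 / (\<alpha> * m))"
    using m assms(1) ratio_ereal[of "\<alpha> * m" 16] by simp
  then show "16 * c * lam \<le> t * (\<alpha> * m)"
    using assms m by (simp add: field_simps)
qed

text \<open>With a positive factor \<open>c\<close> the condition excludes an infinite coefficient \<open>r\<close>. For \<open>c = 0\<close> it would say nothing about \<open>r\<close>,
because \<open>\<infinity> * 0 = 0\<close>.\<close>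

lemma coef_condition:
  fixes t c L :: real
  assumes "0 \<le> t" "0 < c" "0 < L" "ereal t \<le> 1 - r * ereal c / ereal L"
  shows "r \<noteq> \<infinity>" and "r = ereal P \<Longrightarrow> P * c / L \<le> 1 - t"
proof -
  show "r \<noteq> \<infinity>"
    using assms by (auto simp: one_ereal_def)
  show "P * c / L \<le> 1 - t" if "r = ereal P"
    using assms(3,4) unfolding that by (simp add: one_ereal_def)
qed

text \<open>Shelling for the linear form given by \<open>c\<close>: the part of \<open>D\<close> outside \<open>K \<union> J\<close> lowers \<open>c \<bullet> (A *v D)\<close> by a controlled
amount only.\<close>

lemma tail_inner_lower_bound:
  fixes D :: "real^'d"
  assumes head: "is_head l D K J" and l: "1 \<le> l" "l \<le> card (- (K \<union> J))" and C: "0 \<le> C"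
    and block: "\<And>L u. card L = l \<Longrightarrow> (K \<union> J) \<inter> L = {} \<Longrightarrow> vec_on L u \<Longrightarrow> c \<bullet> (A *v u) \<le> C * lp_norm \<infinity> u"
  shows "c \<bullet> (A *v restr (K \<union> J) D) - C * ((\<Sum>i\<in>- K. \<bar>D $ i\<bar>) / real l) \<le> c \<bullet> (A *v D)"
proof -
  let ?\<phi> = "\<lambda>u. - (c \<bullet> (A *v u))"
  have "?\<phi> (restr (- (K \<union> J)) D) \<le> C * ((\<Sum>i\<in>- K. \<bar>D $ i\<bar>) / real l)"
  proof (rule shelling[OF _ _ head l C])
    show "?\<phi> (u + v) \<le> ?\<phi> u + ?\<phi> v" for u v
      by (simp add: matrix_vector_right_distrib inner_add_right)
    fix L :: "'d set" and u :: "real^'d"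
    assume L: "card L = l" "(K \<union> J) \<inter> L = {}" "vec_on L u"
    have "A *v (- u) = - (A *v u)"
      by (metis scaleR_minus1_left matrix_vector_mult_scaleR)
    then show "?\<phi> u \<le> C * lp_norm \<infinity> u"
      using block[of L "- u"] L by (simp add: vec_on_def lp_norm_minus)
  qed
  moreover have "c \<bullet> (A *v D) = c \<bullet> (A *v restr (K \<union> J) D) + c \<bullet> (A *v restr (- (K \<union> J)) D)"
    using restr_add_compl[of "K \<union> J" D]
    by (metis inner_add_right matrix_vector_right_distrib)
  ultimately show ?thesis
    by simp
qed

lemma head_sup_bound:
  assumes head: "is_head l D K J" and l: "1 \<le> l" and c: "\<And>j. j \<in> K \<union> J \<Longrightarrow> \<bar>D $ j\<bar> \<le> c"
  shows "\<bar>D $ j\<bar> \<le> c"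
proof (cases "j \<in> K \<union> J")
  case False
  obtain i where "i \<in> J"
    using head l unfolding is_head_def by fastforce
  then show ?thesis
    using head False c[of i] unfolding is_head_def by force
qed (use c in auto)

text \<open>Test the stationarity equation with the vector \<open>c\<close> dual to the error \<open>v\<close> on \<open>S \<union> J\<close>. The diagonal block gives \<open>w > 0\<close>, the tail
takes away at most \<open>(1 - t / 2) w\<close> by the condition on \<open>\<pi>\<close> and the cone condition, and \<open>w\<close> is at least
\<open>\<omega>\<close> times the product of the norms.\<close>

lemma stage1_error_omega:
  fixes x :: "nat \<Rightarrow> real^'d"
  assumes A: "A = gram n x" and st: "stationary A z lam UNIV \<beta> b"
    and z: "\<And>j. \<bar>z $ j\<bar> \<le> \<tau>" and lam: "0 < lam" "\<tau> \<le> lam / 4"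
    and S: "S = {j. \<beta> $ j \<noteq> 0}" "card S = s" "S \<noteq> {}" and l: "1 \<le> l" "s + 2 * l \<le> CARD('d)"
    and t: "0 < t" "t < 1" and p: "1 \<le> p"
    and cone: "(\<Sum>j\<in>- S. \<bar>(b - \<beta>) $ j\<bar>) \<le> cone_ratio t * (\<Sum>j\<in>S. \<bar>(b - \<beta>) $ j\<bar>)"
    and head: "is_head l (b - \<beta>) S J"
    and \<omega>: "omega_coef p A (s + l) = ereal m"
    and cond: "ereal t \<le> 1 - pi_coef p A (s + l) l * ereal (real s powr (1 - real_of_ereal (1 / p))) / ereal (real l)"
  shows "m * lp_norm p (restr (S \<union> J) (b - \<beta>)) * t \<le> 3 / 2 * lam * real s powr real_of_ereal (1 / p)"
proof (cases "restr (S \<union> J) (b - \<beta>) = 0")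
  case True
  then show ?thesis
    using lam by (simp add: lp_norm_zero[OF p])
next
  case False
  define D where "D = b - \<beta>"
  define I where "I = S \<union> J"
  define v where "v = restr I D"
  have v0: "v \<noteq> 0" and vI: "vec_on I v"
    using False by (simp_all add: v_def I_def D_def)
  have cI: "card I = s + l"
    using head S(2) card_Un_disjoint[of S J] by (auto simp: is_head_def I_def)
  have lc: "l \<le> card (- I)"
    using card_add_card_compl[of I] cI l by simp
  have s: "0 < real s"
    using S(2,3) card_gt_0_iff by fastforce
  obtain P where P: "pi_coef p A (s + l) l = ereal P" "0 \<le> P"
    and W: "\<And>I v. card I = s + l \<Longrightarrow> vec_on I v \<Longrightarrow> v \<noteq> 0 \<Longrightarrow> 0 < v \<bullet> (sub_matrix A I I *v dual_power p v)"
    and PW: "\<And>I J u v. card I = s + l \<Longrightarrow> card J = l \<Longrightarrow> I \<inter> J = {} \<Longrightarrow> vec_on I v \<Longrightarrow> v \<noteq> 0 \<Longrightarrow> vec_on J u \<Longrightarrow>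
       (dual_power p v \<bullet> (sub_matrix A I J *v u)) * lp_norm p v
         \<le> P * (v \<bullet> (sub_matrix A I I *v dual_power p v)) * lp_norm \<infinity> u"
    using pi_coef_real[of p "s + l" l A, OF p _ l(1) _ coef_condition(1)[OF _ _ _ cond]] l t s by auto
  obtain m' where m': "omega_coef p A (s + l) = ereal m'" "0 \<le> m'"
    "\<And>I v. card I = s + l \<Longrightarrow> vec_on I v \<Longrightarrow> v \<noteq> 0 \<Longrightarrow>
       m' * (dual_scale p v * lp_norm p v) \<le> max 0 (v \<bullet> (sub_matrix A I I *v dual_power p v))"
    using omega_coef_real[of p "s + l" A, OF p] l by auto
  define c where "c = dual_power p v"
  define V where "V = lp_norm p v"
  define w where "w = v \<bullet> (sub_matrix A I I *v c)"
  have V: "0 < V"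
    unfolding V_def using p v0 by (rule lp_norm_pos)
  have w: "0 < w"
    unfolding w_def c_def using W[OF cI vI v0] .
  have cI': "vec_on I c"
    unfolding c_def using vI by (rule vec_on_dual_power)
  have w_eq: "c \<bullet> (A *v v) = w"
    unfolding w_def sub_matrix_mult using vI cI'
    by (simp add: inner_restr_vec_on restr_vec_on A gram_inner_commute)
  have tail: "c \<bullet> (A *v u) \<le> P * w / V * lp_norm \<infinity> u"
    if "card L = l" "I \<inter> L = {}" "vec_on L u" for L u
    using PW[OF cI that(1,2) vI v0 that(3)] that(3) cI' V
    by (simp add: sub_matrix_mult restr_vec_on inner_restr_vec_on w_def c_def V_def pos_le_divide_eq mult_ac)
  have "c \<bullet> (A *v v) - P * w / V * ((\<Sum>i\<in>- S. \<bar>D $ i\<bar>) / real l) \<le> c \<bullet> (A *v D)"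
    unfolding v_def I_def D_def
    using tail head l lc P V w by (intro tail_inner_lower_bound) (auto simp: I_def)
  moreover have "P * w / V * ((\<Sum>i\<in>- S. \<bar>D $ i\<bar>) / real l) \<le> w * (1 - t / 2)"
  proof -
    have "(\<Sum>j\<in>S. \<bar>D $ j\<bar>) = (\<Sum>j\<in>S. \<bar>v $ j\<bar>)"
      by (intro sum.cong) (auto simp: v_def I_def)
    also have "\<dots> \<le> real s powr (1 - real_of_ereal (1 / p)) * V"
      using sum_abs_le_lp_norm[OF p S(3), of v] S(2) by (simp add: V_def)
    finally have "(\<Sum>i\<in>- S. \<bar>D $ i\<bar>) \<le> cone_ratio t * (real s powr (1 - real_of_ereal (1 / p)) * V)"
      using cone cone_ratio_bounds(1)[OF t] unfolding D_def
      by (meson less_imp_le mult_left_mono order_trans)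
    then have "P * w / V * ((\<Sum>i\<in>- S. \<bar>D $ i\<bar>) / real l) \<le>
        P * w / V * (cone_ratio t * (real s powr (1 - real_of_ereal (1 / p)) * V) / real l)"
      using P V w l by (intro mult_left_mono divide_right_mono) auto
    also have "\<dots> = w * (cone_ratio t * (P * real s powr (1 - real_of_ereal (1 / p)) / real l))"
      using V by simp
    also have "\<dots> \<le> w * (cone_ratio t * (1 - t))"
      using coef_condition(2)[OF _ _ _ cond P(1)] t s l w cone_ratio_bounds(1)[OF t]
      by (intro mult_left_mono) auto
    also have "\<dots> \<le> w * (1 - t / 2)"
      using cone_ratio_bounds(3)[OF t] w by (intro mult_left_mono) auto
    finally show ?thesis .
  qed
  moreover have "c \<bullet> (A *v D) \<le> 3 / 4 * lam * (\<Sum>j\<in>S. \<bar>c $ j\<bar>)"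
    unfolding D_def
  proof (rule inner_le_of_stationary[OF st z lam(2) _ S(1) cI'])
    show "c $ j = \<bar>c $ j\<bar> * sgn ((b - \<beta>) $ j)" if "j \<in> I" for j
      using dual_power_sgn[of p v j] that by (simp add: c_def v_def D_def)
  qed (use lam in \<open>auto simp: I_def\<close>)
  moreover have "3 / 4 * lam * (\<Sum>j\<in>S. \<bar>c $ j\<bar>) \<le>
      3 / 4 * lam * (real s powr real_of_ereal (1 / p) * dual_scale p v)"
    using sum_abs_dual_power_le[OF p S(3) v0] S(2) lam by (intro mult_left_mono) (auto simp: c_def)
  ultimately have "w * (t / 2) \<le> 3 / 4 * lam * (real s powr real_of_ereal (1 / p) * dual_scale p v)"
    unfolding w_eq by (simp add: algebra_simps)
  moreover have "m * (dual_scale p v * V) \<le> w"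
    using m'(1) \<omega> m'(3)[OF cI vI v0] w by (simp add: w_def c_def V_def)
  then have "m * (dual_scale p v * V) * (t / 2) \<le> w * (t / 2)"
    using t by (intro mult_right_mono) auto
  ultimately have "dual_scale p v * (m * V * t) \<le> dual_scale p v * (3 / 2 * lam * real s powr real_of_ereal (1 / p))"
    by (simp add: algebra_simps)
  then show ?thesis
    using dual_scale_pos[OF p v0] by (simp add: V_def v_def I_def D_def)
qed

text \<open>Solve the stationarity equation for the error \<open>v\<close> on \<open>I = S \<union> J\<close> by the inverse of the diagonal block. The tail contributes
at most \<open>(1 - t / 2)\<close> times the norm of \<open>v\<close> by the condition on \<open>\<gamma>\<close>. The right-hand side has entries at most
\<open>3 / 4 * lam\<close> on all of \<open>I\<close>, whence the factor \<open>(s + l) powr (1 / p)\<close>.\<close>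

lemma stage1_error_mu:
  fixes x :: "nat \<Rightarrow> real^'d"
  assumes A: "A = gram n x" and st: "stationary A z lam UNIV \<beta> b"
    and z: "\<And>j. \<bar>z $ j\<bar> \<le> \<tau>" and lam: "0 < lam" "\<tau> \<le> lam / 4"
    and S: "S = {j. \<beta> $ j \<noteq> 0}" "card S = s" "S \<noteq> {}" and l: "1 \<le> l" "s + 2 * l \<le> CARD('d)"
    and t: "0 < t" "t < 1" and p: "1 \<le> p"
    and cone: "(\<Sum>j\<in>- S. \<bar>(b - \<beta>) $ j\<bar>) \<le> cone_ratio t * (\<Sum>j\<in>S. \<bar>(b - \<beta>) $ j\<bar>)"
    and head: "is_head l (b - \<beta>) S J"
    and \<mu>: "mu_coef p A (s + l) = ereal m"
    and cond: "ereal t \<le> 1 - gamma_coef p A (s + l) l * ereal (real s powr (1 - real_of_ereal (1 / p))) / ereal (real l)"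
  shows "m * lp_norm p (restr (S \<union> J) (b - \<beta>)) * t \<le> 3 / 2 * lam * real (s + l) powr real_of_ereal (1 / p)"
proof -
  define D where "D = b - \<beta>"
  define I where "I = S \<union> J"
  define v where "v = restr I D"
  define V where "V = lp_norm p v"
  have V: "0 \<le> V"
    unfolding V_def using p by (rule lp_norm_nonneg)
  have vI: "vec_on I v"
    by (simp add: v_def)
  have cI: "card I = s + l"
    using head S(2) card_Un_disjoint[of S J] by (auto simp: is_head_def I_def)
  have lc: "l \<le> card (- I)"
    using card_add_card_compl[of I] cI l by simp
  have s: "0 < real s"
    using S(2,3) card_gt_0_iff by fastforce
  obtain G where G: "gamma_coef p A (s + l) l = ereal G" "0 \<le> G"
    and inv: "\<And>I. card I = s + l \<Longrightarrow> block_invertible A I"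
    and GW: "\<And>I J u. card I = s + l \<Longrightarrow> card J = l \<Longrightarrow> I \<inter> J = {} \<Longrightarrow> vec_on J u \<Longrightarrow>
       lp_norm p (block_inverse A I *v (sub_matrix A I J *v u)) \<le> G * lp_norm \<infinity> u"
    using gamma_coef_real[of p "s + l" l A, OF p _ l(1) _ coef_condition(1)[OF _ _ _ cond]] l t s by auto
  obtain m' where m': "mu_coef p A (s + l) = ereal m'" "0 \<le> m'"
    "\<And>I v. card I = s + l \<Longrightarrow> vec_on I v \<Longrightarrow> m' * lp_norm p v \<le> lp_norm p (sub_matrix A I I *v v)"
    using mu_coef_real[of p "s + l" A, OF p] l by auto
  define B where "B = block_inverse A I"
  note B = block_inverse_apply[OF is_block_inverse_block_inverse[OF inv[OF cI]], folded B_def]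
  let ?\<phi> = "\<lambda>u. lp_norm p (B *v restr I (A *v u))"
  have tail: "?\<phi> (restr (- I) D) \<le> G * ((\<Sum>i\<in>- S. \<bar>D $ i\<bar>) / real l)"
    unfolding I_def
  proof (rule shelling[OF _ _ head[folded D_def] l(1) _ G(2)])
    show "lp_norm p (B *v restr (S \<union> J) (A *v (u + w))) \<le>
        lp_norm p (B *v restr (S \<union> J) (A *v u)) + lp_norm p (B *v restr (S \<union> J) (A *v w))" for u w
      using lp_norm_triangle[OF p] by (simp add: matrix_vector_right_distrib restr_add)
    show "lp_norm p (B *v restr (S \<union> J) (A *v u)) \<le> G * lp_norm \<infinity> u"
      if "card L = l" "(S \<union> J) \<inter> L = {}" "vec_on L u" for L u
      using GW[OF cI that(1) _ that(3)] that
      by (simp add: I_def sub_matrix_mult restr_vec_on B_def)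
    show "l \<le> card (- (S \<union> J))"
      using lc by (simp add: I_def)
  qed
  have "A *v D = A *v v + A *v restr (- I) D"
    unfolding v_def by (metis matrix_vector_right_distrib restr_add_compl)
  then have "B *v restr I (A *v D) = B *v restr I (A *v v) + B *v restr I (A *v restr (- I) D)"
    by (simp add: restr_add matrix_vector_right_distrib)
  moreover have "B *v restr I (A *v v) = v"
    using B(1)[OF vI] vI by (simp add: sub_matrix_mult restr_vec_on)
  ultimately have "v = B *v restr I (A *v D) + - (B *v restr I (A *v restr (- I) D))"
    by simp
  then have "V \<le> lp_norm p (B *v restr I (A *v D)) + ?\<phi> (restr (- I) D)"
    unfolding V_def using lp_norm_triangle[OF p] lp_norm_minus by metis
  also have "?\<phi> (restr (- I) D) \<le> V * (1 - t / 2)"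
  proof -
    have "(\<Sum>j\<in>S. \<bar>D $ j\<bar>) = (\<Sum>j\<in>S. \<bar>v $ j\<bar>)"
      by (intro sum.cong) (auto simp: v_def I_def)
    also have "\<dots> \<le> real s powr (1 - real_of_ereal (1 / p)) * V"
      using sum_abs_le_lp_norm[OF p S(3), of v] S(2) by (simp add: V_def)
    finally have "(\<Sum>i\<in>- S. \<bar>D $ i\<bar>) \<le> cone_ratio t * (real s powr (1 - real_of_ereal (1 / p)) * V)"
      using cone cone_ratio_bounds(1)[OF t] unfolding D_def
      by (meson less_imp_le mult_left_mono order_trans)
    then have "G * ((\<Sum>i\<in>- S. \<bar>D $ i\<bar>) / real l) \<le>
        G * (cone_ratio t * (real s powr (1 - real_of_ereal (1 / p)) * V) / real l)"
      using G l by (intro mult_left_mono divide_right_mono) auto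
    also have "\<dots> = V * (cone_ratio t * (G * real s powr (1 - real_of_ereal (1 / p)) / real l))"
      by simp
    also have "\<dots> \<le> V * (cone_ratio t * (1 - t))"
      using coef_condition(2)[OF _ _ _ cond G(1)] t s l V cone_ratio_bounds(1)[OF t]
      by (intro mult_left_mono) auto
    also have "\<dots> \<le> V * (1 - t / 2)"
      using cone_ratio_bounds(3)[OF t] V by (intro mult_left_mono) auto
    finally show ?thesis
      using tail by simp
  qed
  finally have "V * (t / 2) \<le> lp_norm p (B *v restr I (A *v D))"
    by (simp add: algebra_simps)
  then have "m' * (V * (t / 2)) \<le> m' * lp_norm p (B *v restr I (A *v D))"
    using m'(2) by (rule mult_left_mono)
  also have "\<dots> \<le> lp_norm p (sub_matrix A I I *v (B *v restr I (A *v D)))"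
    by (rule m'(3)[OF cI B(3)])
  also have "\<dots> = lp_norm p (restr I (A *v D))"
    by (simp add: B(2) restr_vec_on)
  also have "\<dots> \<le> real (card I) powr real_of_ereal (1 / p) * (3 / 4 * lam)"
  proof (rule lp_norm_le_of_entries[OF p])
    fix j
    have "\<bar>(A *v (b - \<beta>)) $ j - z $ j\<bar> \<le> lam / 2"
      using st by (simp add: stationary_def Let_def)
    then show "\<bar>restr I (A *v D) $ j\<bar> \<le> 3 / 4 * lam"
      using z[of j] lam unfolding restr_nth D_def by (simp only: split: if_split) linarith
  qed (use S(3) in \<open>auto simp: I_def\<close>)
  finally have "m' * V * t \<le> 3 / 2 * lam * real (s + l) powr real_of_ereal (1 / p)"
    unfolding cI by (simp add: algebra_simps)
  then show ?thesis
    using m'(1) \<mu> by (simp add: V_def v_def I_def D_def)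
qed

text \<open>Entries on \<open>S \<union> J\<close> are bounded by the \<open>p\<close>-norm, and all other entries are smaller than those on \<open>J\<close>. An empty support is separate:
the conditions on \<open>\<pi>\<close> and \<open>\<gamma>\<close> are then vacuous, but the cone condition already gives \<open>b = \<beta>\<close>.\<close>

lemma stage1_sup_error:
  fixes x :: "nat \<Rightarrow> real^'d"
  assumes A: "A = gram n x" and st: "stationary A z lam UNIV \<beta> b"
    and z: "\<And>j. \<bar>z $ j\<bar> \<le> \<tau>" and lam: "0 < lam" "4 * (2 - t) * \<tau> \<le> t * lam" and \<alpha>: "0 < \<alpha>"
    and S: "card {j. \<beta> $ j \<noteq> 0} = s" and l: "1 \<le> l" "s + 2 * l \<le> CARD('d)"
    and t: "0 < t" "t < 1" and p: "1 \<le> p"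
    and cond: "ratio 16 (ereal \<alpha> * omega_coef p A (s + l))
              * ereal (real s powr real_of_ereal (1 / p)) * ereal lam \<le> ereal t \<and>
            ereal t \<le> 1 - pi_coef p A (s + l) l
              * ereal (real s powr (1 - real_of_ereal (1 / p))) / ereal (real l)
          \<or>
          ratio 16 (ereal \<alpha> * mu_coef p A (s + l))
              * ereal (real (s + l) powr real_of_ereal (1 / p)) * ereal lam \<le> ereal t \<and>
            ereal t \<le> 1 - gamma_coef p A (s + l) l
              * ereal (real s powr (1 - real_of_ereal (1 / p))) / ereal (real l)"
  shows "\<bar>b $ j - \<beta> $ j\<bar> \<le> \<alpha> / 2"
proof -
  define S where "S = {j. \<beta> $ j \<noteq> 0}"
  have cS: "card S = s"
    using assms by (simp add: S_def)
  have \<tau>0: "0 \<le> \<tau>"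
    using z[of undefined] by linarith
  have \<tau>: "\<tau> \<le> lam / 4"
  proof -
    have "4 * \<tau> \<le> 4 * (2 - t) * \<tau>"
      using \<tau>0 t mult_right_mono[of 4 "4 * (2 - t)" \<tau>] by simp
    also have "\<dots> \<le> 1 * lam"
      using lam(2) mult_right_mono[of t 1 lam] lam(1) t by linarith
    finally show ?thesis
      by simp
  qed
  have off: "(\<Sum>j\<in>- S. \<bar>\<beta> $ j\<bar>) = 0" "(\<Sum>j\<in>- S. \<bar>(b - \<beta>) $ j\<bar>) = (\<Sum>j\<in>- S. \<bar>b $ j\<bar>)"
    by (auto simp: S_def intro!: sum.neutral sum.cong)
  have cone: "(\<Sum>j\<in>- S. \<bar>(b - \<beta>) $ j\<bar>) \<le> cone_ratio t * (\<Sum>j\<in>S. \<bar>(b - \<beta>) $ j\<bar>)"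
    using stationary_cone_ratio[OF A st _ z t lam, of S] unfolding off by simp
  obtain J where head: "is_head l (b - \<beta>) S J"
    using head_exists[of l S] card_add_card_compl[of S] cS l by auto
  show ?thesis
  proof (cases "S = {}")
    case True
    then have "(\<Sum>j\<in>UNIV. \<bar>(b - \<beta>) $ j\<bar>) \<le> 0"
      using cone by simp
    then have "\<bar>(b - \<beta>) $ j\<bar> \<le> 0"
      using member_le_sum[of j UNIV "\<lambda>j. \<bar>(b - \<beta>) $ j\<bar>"] by simp
    then show ?thesis
      using \<alpha> by simp
  next
    case False
    then have s: "0 < s"
      using cS card_gt_0_iff by fastforce
    define V where "V = lp_norm p (restr (S \<union> J) (b - \<beta>))"
    \<comment> \<open>The condition with constant \<open>16\<close> in fact yields \<open>V \<le> 3 / 32 * \<alpha>\<close>.\<close>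
    have V: "V \<le> \<alpha> / 2"
      if "0 < m" "16 * c * lam \<le> t * (\<alpha> * m)" "m * V * t \<le> 3 / 2 * lam * c" for m c :: real
    proof -
      have "16 * (m * V * t) \<le> 16 * (3 / 2 * lam * c)"
        using that(3) by linarith
      also have "\<dots> = 3 / 2 * (16 * c * lam)"
        by simp
      also have "\<dots> \<le> 3 / 2 * (t * (\<alpha> * m))"
        using that(2) by linarith
      finally have "(m * t) * (16 * V) \<le> (m * t) * (3 / 2 * \<alpha>)"
        by (simp add: algebra_simps)
      then have "16 * V \<le> 3 / 2 * \<alpha>"
        using that(1) t by (subst (asm) mult_le_cancel_left_pos) auto
      then show ?thesis
        using \<alpha> by simp
    qed
    have sl: "1 \<le> s + l" "s + l \<le> CARD('d)"
      using l by auto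
    have "V \<le> \<alpha> / 2"
      using cond
    proof
      assume c: "ratio 16 (ereal \<alpha> * omega_coef p A (s + l))
              * ereal (real s powr real_of_ereal (1 / p)) * ereal lam \<le> ereal t \<and>
            ereal t \<le> 1 - pi_coef p A (s + l) l
              * ereal (real s powr (1 - real_of_ereal (1 / p))) / ereal (real l)"
      obtain m where m: "omega_coef p A (s + l) = ereal m" "0 \<le> m"
        using omega_coef_real[OF p sl] by metis
      have pos: "0 < real s powr real_of_ereal (1 / p)"
        using s by simp
      note * = ratio_condition[OF \<alpha> m(2) pos lam(1) c[THEN conjunct1, unfolded m(1)]]
      show ?thesis
        using stage1_error_omega[OF A st z lam(1) \<tau> S_def cS False l t p cone head m(1) c[THEN conjunct2]]
        by (intro V[OF *]) (simp add: V_def)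
    next
      assume c: "ratio 16 (ereal \<alpha> * mu_coef p A (s + l))
              * ereal (real (s + l) powr real_of_ereal (1 / p)) * ereal lam \<le> ereal t \<and>
            ereal t \<le> 1 - gamma_coef p A (s + l) l
              * ereal (real s powr (1 - real_of_ereal (1 / p))) / ereal (real l)"
      obtain m where m: "mu_coef p A (s + l) = ereal m" "0 \<le> m"
        using mu_coef_real[OF p sl] by metis
      have pos: "0 < real (s + l) powr real_of_ereal (1 / p)"
        using s by simp
      note * = ratio_condition[OF \<alpha> m(2) pos lam(1) c[THEN conjunct1, unfolded m(1)]]
      show ?thesis
        using stage1_error_mu[OF A st z lam(1) \<tau> S_def cS False l t p cone head m(1) c[THEN conjunct2]]
        by (intro V[OF *]) (simp add: V_def)
    qed
    then have "\<bar>(b - \<beta>) $ j\<bar> \<le> \<alpha> / 2" if "j \<in> S \<union> J" for j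
      using abs_le_lp_norm[OF p, of "restr (S \<union> J) (b - \<beta>)" j] that
      unfolding V_def restr_nth by (simp del: Un_iff)
    then show ?thesis
      using head_sup_bound[OF head l(1), of "\<alpha> / 2" j] by simp
  qed
qed

section \<open>Euclidean error of the second stage\<close>

lemma dual_power_2: "dual_power 2 v = v"
proof -
  have "dual_power (ereal 2) v = v"
    by (auto simp: dual_power_def vec_eq_iff sgn_if)
  then show ?thesis
    by simp
qed

lemma sum_abs_le_sqrt_card: "(\<Sum>j\<in>S. \<bar>v $ j\<bar>) \<le> sqrt (real (card S)) * norm (restr S v)"
proof -
  have "(\<Sum>j\<in>S. \<bar>v $ j\<bar>) \<le> (\<Sum>j\<in>UNIV. \<bar>if j \<in> S then 1 else 0\<bar> * \<bar>restr S v $ j\<bar>)"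
    by (subst sum.mono_neutral_right[of UNIV S]) auto
  also have "\<dots> \<le> L2_set (\<lambda>j. if j \<in> S then 1 else 0) UNIV * L2_set (\<lambda>j. restr S v $ j) UNIV"
    by (rule L2_set_mult_ineq)
  also have "L2_set (\<lambda>j. restr S v $ j) UNIV = norm (restr S v)"
    by (simp add: norm_vec_def L2_set_def)
  also have "L2_set (\<lambda>j. if j \<in> S then 1 else 0) UNIV = sqrt (real (card S))"
    by (simp add: L2_set_def if_distrib[of "\<lambda>c. c\<^sup>2"] sum.If_cases cong: if_cong)
  finally show ?thesis .
qed

lemma restr_zero: "restr I 0 = 0"
  by (simp add: vec_eq_iff)

lemma norm_restr_mono: "S \<subseteq> T \<Longrightarrow> norm (restr S v) \<le> norm (restr T v)"
  by (intro norm_le_componentwise_cart) auto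

lemma norm_le_sqrt_card_sup:
  assumes "vec_on L u"
  shows "norm u \<le> sqrt (real (card L)) * lp_norm \<infinity> u"
proof (rule power2_le_imp_le)
  have "(norm u)\<^sup>2 = (\<Sum>j\<in>L. (u $ j)\<^sup>2)"
    unfolding power2_norm_eq_inner inner_vec_def using assms
    by (intro sum.mono_neutral_cong_right) (auto simp: vec_on_def power2_eq_square)
  also have "\<dots> \<le> (\<Sum>j\<in>L. (lp_norm \<infinity> u)\<^sup>2)"
    using abs_le_lp_norm_inf[of u] by (intro sum_mono) (simp add: abs_le_square_iff[symmetric] lp_norm_nonneg)
  finally show "(norm u)\<^sup>2 \<le> (sqrt (real (card L)) * lp_norm \<infinity> u)\<^sup>2"
    by (simp add: power_mult_distrib)
qed (simp add: lp_norm_nonneg)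

lemma gram_sparse_upper_bound:
  fixes x :: "nat \<Rightarrow> real^'d"
  assumes \<rho>: "0 \<le> \<rho>" "\<And>I v. card I = k \<Longrightarrow> vec_on I v \<Longrightarrow> norm (sub_matrix (gram n x) I I *v v) \<le> \<rho> * norm v"
    and L: "card L \<le> k" "k \<le> CARD('d)" "vec_on L u"
  shows "pred_norm n x u \<le> sqrt \<rho> * norm u"
proof (rule power2_le_imp_le)
  obtain I where I: "L \<subseteq> I" "card I = k"
    using exists_subset_between[of L k UNIV] L by auto
  have uI: "vec_on I u"
    using I L(3) by (auto simp: vec_on_def)
  have "(pred_norm n x u)\<^sup>2 = u \<bullet> (sub_matrix (gram n x) I I *v u)"
    using uI by (simp add: pred_norm_power2 sub_matrix_mult restr_vec_on inner_restr_vec_on)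
  also have "\<dots> \<le> norm u * (\<rho> * norm u)"
    using norm_cauchy_schwarz[of u "sub_matrix (gram n x) I I *v u"] \<rho>(2)[OF I(2) uI]
    by (meson mult_left_mono norm_ge_zero order_trans)
  also have "\<dots> = (sqrt \<rho> * norm u)\<^sup>2"
    using \<rho>(1) by (simp add: power_mult_distrib) (simp add: power2_eq_square)
  finally show "(pred_norm n x u)\<^sup>2 \<le> (sqrt \<rho> * norm u)\<^sup>2" .
qed (use \<rho>(1) in simp)

lemma restr_inner_split:
  assumes "K \<subseteq> I"
  shows "restr I D \<bullet> y = (\<Sum>j\<in>K. D $ j * y $ j) + (\<Sum>j\<in>I - K. D $ j * y $ j)"
proof -
  have "restr I D \<bullet> y = (\<Sum>j\<in>I. D $ j * y $ j)"
    unfolding inner_vec_def by (intro sum.mono_neutral_cong_right) auto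
  then show ?thesis
    using sum.subset_diff[OF assms, of "\<lambda>j. D $ j * y $ j"] by simp
qed

text \<open>If \<open>X > sqrt P + R\<close> then \<open>X\<^sup>2 > (sqrt P + R) X \<ge> P + R X\<close>.\<close>

lemma le_of_quadratic:
  fixes X P R :: real
  assumes "X\<^sup>2 \<le> P + R * X" "0 \<le> P" "0 \<le> R"
  shows "X \<le> sqrt P + R"
proof (rule ccontr)
  assume X: "\<not> X \<le> sqrt P + R"
  have "P + R * X = sqrt P * sqrt P + R * X"
    using assms(2) by simp
  also have "\<dots> \<le> sqrt P * X + R * X"
    using X assms(3) by (intro add_right_mono mult_left_mono) (auto simp: assms(2))
  also have "\<dots> < X * X"
  proof -
    have "0 \<le> sqrt P"
      using assms(2) by simp
    then have "(sqrt P + R) * X < X * X"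
      using X assms(3) by (intro mult_strict_right_mono) linarith+
    then show ?thesis
      by (simp add: algebra_simps)
  qed
  finally show False
    using assms(1) by (simp add: power2_eq_square)
qed

text \<open>The situation after a successful selection: \<open>- P\<close> is the selected set, which lies between the strong coordinates \<open>Q\<close> and the
set \<open>K\<close>. The target is truncated to \<open>K\<close>; \<open>r\<close> and \<open>r1\<close> are the \<open>2\<close>-norm and \<open>1\<close>-norm of what is cut off, \<open>D\<close>
is the error relative to the truncation, and \<open>v\<close> is its restriction to \<open>K\<close> and the \<open>l\<close> largest other
coordinates. \<open>N\<close> bounds the right-hand side of the stationarity equation on \<open>K\<close>.\<close>

locale second_stage =
  fixes n :: nat and x :: "nat \<Rightarrow> real^'d" and A :: "real^'d^'d" and z :: "real^'d"
    and lam \<tau> t nz :: real and P K Q :: "'d set" and \<beta> b :: "real^'d" and s l :: nat and \<rho> m :: real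
  assumes A: "A = gram n x" and st: "stationary A z lam P \<beta> b"
    and z: "\<And>j. \<bar>z $ j\<bar> \<le> \<tau>" and lam: "0 < lam" "4 * (2 - t) * \<tau> \<le> t * lam" and t: "0 < t" "t < 1"
    and K: "Q \<subseteq> - P" "- P \<subseteq> K" "K \<subseteq> {j. \<beta> $ j \<noteq> 0}"
    and s: "card {j. \<beta> $ j \<noteq> 0} = s" and l: "1 \<le> l" "s \<le> l" "s + 2 * l \<le> CARD('d)"
    and nz: "norm (restr Q z) \<le> nz"
    and \<rho>: "rho_coef 2 A (card K + l) = ereal \<rho>" and m: "mu_coef 2 A (card K + l) = ereal m"
    and cond: "ereal t \<le> 1 - pi_coef 2 A (card K + l) l * ereal (sqrt (real (card K))) / ereal (real l)"
begin

definition r :: real where "r = norm (restr (- K) \<beta>)"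

definition r1 :: real where "r1 = (\<Sum>j\<in>- K. \<bar>\<beta> $ j\<bar>)"

definition N :: real where "N = nz + 3 / 4 * (sqrt (real (card K) - real (card Q)) * lam)"

definition D :: "real^'d" where "D = b - restr K \<beta>"

definition w :: "real^'d" where "w = A *v (b - \<beta>) - z"

definition J :: "'d set" where "J = (SOME J. is_head l D K J)"

definition v :: "real^'d" where "v = restr (K \<union> J) D"

definition V :: real where "V = norm v"

lemma k_le: "card K \<le> s"
  using card_mono[OF _ K(3)] s by simp

lemma kl: "1 \<le> card K + l" "card K + l \<le> CARD('d)" "card K + l + l \<le> CARD('d)"
  using k_le l by auto

lemma head: "is_head l D K J"
proof -
  have "l \<le> card (- K)"
    using card_add_card_compl[of K] kl by simp
  then show ?thesis
    unfolding J_def by (rule someI_ex[OF head_exists])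
qed

lemma card_I: "card (K \<union> J) = card K + l"
  using head card_Un_disjoint[of K J] by (simp add: is_head_def)

lemma tail_room: "l \<le> card (- (K \<union> J))"
  using card_add_card_compl[of "K \<union> J"] card_I kl by simp

lemma nonneg: "0 \<le> r" "0 \<le> r1" "0 \<le> N" "0 \<le> V" "0 \<le> nz" "0 \<le> \<tau>"
proof -
  show n0: "0 \<le> nz"
    using nz norm_ge_zero order_trans by blast
  have "card Q \<le> card K"
    using K(1,2) by (intro card_mono) auto
  then show "0 \<le> N"
    using n0 lam by (simp add: N_def)
  show "0 \<le> \<tau>"
    using z[of undefined] by linarith
qed (simp_all add: r_def r1_def V_def sum_nonneg)

lemma \<tau>_le: "\<tau> \<le> lam / 4"
proof -
  have "4 * \<tau> \<le> 4 * (2 - t) * \<tau>"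
    using nonneg(6) t mult_right_mono[of 4 "4 * (2 - t)" \<tau>] by simp
  also have "\<dots> \<le> 1 * lam"
    using lam(2) mult_right_mono[of t 1 lam] lam(1) t by linarith
  finally show ?thesis
    by simp
qed

lemma rho_bound: "0 \<le> \<rho>"
  "card I = card K + l \<Longrightarrow> vec_on I u \<Longrightarrow> norm (sub_matrix A I I *v u) \<le> \<rho> * norm u"
proof -
  obtain \<rho>' where "rho_coef 2 A (card K + l) = ereal \<rho>'" "0 \<le> \<rho>'"
    "\<And>I v. card I = card K + l \<Longrightarrow> vec_on I v \<Longrightarrow> norm (sub_matrix A I I *v v) \<le> \<rho>' * norm v"
    using rho_coef_real[OF kl(1,2), of A] by metis
  then show "0 \<le> \<rho>"
    "card I = card K + l \<Longrightarrow> vec_on I u \<Longrightarrow> norm (sub_matrix A I I *v u) \<le> \<rho> * norm u"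
    using \<rho> by auto
qed

lemma mu_bound: "0 \<le> m"
  "card I = card K + l \<Longrightarrow> vec_on I u \<Longrightarrow> m * norm u \<le> norm (sub_matrix A I I *v u)"
proof -
  have "(1 :: ereal) \<le> 2"
    by simp
  then obtain m' where "mu_coef 2 A (card K + l) = ereal m'" "0 \<le> m'"
    "\<And>I v. card I = card K + l \<Longrightarrow> vec_on I v \<Longrightarrow> m' * norm v \<le> norm (sub_matrix A I I *v v)"
    using mu_coef_real[OF _ kl(1,2), of 2 A] unfolding lp_norm_2 by metis
  then show "0 \<le> m"
    "card I = card K + l \<Longrightarrow> vec_on I u \<Longrightarrow> m * norm u \<le> norm (sub_matrix A I I *v u)"
    using m by auto
qed

lemma mu_le_rho: "m \<le> \<rho>"
proof -
  obtain u :: "real^'d" and I where u: "card I = card K + l" "vec_on I u" "u \<noteq> 0"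
    using block_vectors_nonempty[OF kl(1,2)] by auto
  have "m * norm u \<le> \<rho> * norm u"
    using mu_bound(2)[OF u(1,2)] rho_bound(2)[OF u(1,2)] by linarith
  then show ?thesis
    using u(3) by simp
qed

lemma pred_norm_le: "card L \<le> card K + l \<Longrightarrow> vec_on L u \<Longrightarrow> pred_norm n x u \<le> sqrt \<rho> * norm u"
  using gram_sparse_upper_bound[OF rho_bound(1) _ _ kl(2)] rho_bound(2) unfolding A by blast

lemma pred_norm_tail_target: "pred_norm n x (restr (- K) \<beta>) \<le> sqrt \<rho> * r"
proof -
  have "card {j. \<beta> $ j \<noteq> 0} \<le> card K + l"
    using s l by simp
  then show ?thesis
    unfolding r_def by (rule pred_norm_le) (auto simp: vec_on_def)
qed

lemma r1_le: "r1 \<le> sqrt (real l) * r"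
proof -
  let ?G = "{j. \<beta> $ j \<noteq> 0} - K"
  have "r1 = (\<Sum>j\<in>?G. \<bar>\<beta> $ j\<bar>)"
    unfolding r1_def by (intro sum.mono_neutral_right) auto
  also have "\<dots> \<le> sqrt (real (card ?G)) * norm (restr ?G \<beta>)"
    by (rule sum_abs_le_sqrt_card)
  also have "\<dots> \<le> sqrt (real l) * r"
  proof (rule mult_mono)
    have "card ?G \<le> l"
      using card_mono[of "{j. \<beta> $ j \<noteq> 0}" ?G] s l by auto
    then show "sqrt (real (card ?G)) \<le> sqrt (real l)"
      by simp
    show "norm (restr ?G \<beta>) \<le> r"
      unfolding r_def by (rule norm_restr_mono) auto
  qed simp_all
  finally show ?thesis .
qed

lemma D_nth: "D $ j = (if j \<in> K then (b - \<beta>) $ j else b $ j)"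
  by (simp add: D_def)

lemma gram_D: "A *v D = z + w + A *v restr (- K) \<beta>"
proof -
  have "D = (b - \<beta>) + restr (- K) \<beta>"
    by (auto simp: D_def vec_eq_iff)
  then have "A *v D = A *v (b - \<beta>) + A *v restr (- K) \<beta>"
    by (metis matrix_vector_right_distrib)
  then show ?thesis
    by (simp add: w_def)
qed

lemma cone: "(\<Sum>j\<in>- K. \<bar>D $ j\<bar>) \<le> cone_ratio t * (sqrt (real (card K)) * V + r1)"
proof -
  have "(\<Sum>j\<in>- K. \<bar>D $ j\<bar>) = (\<Sum>j\<in>- K. \<bar>b $ j\<bar>)"
    by (intro sum.cong) (auto simp: D_nth)
  also have "\<dots> \<le> cone_ratio t * ((\<Sum>j\<in>K. \<bar>(b - \<beta>) $ j\<bar>) + r1)"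
    unfolding r1_def by (rule stationary_cone_ratio[OF A st K(2) z t lam])
  also have "(\<Sum>j\<in>K. \<bar>(b - \<beta>) $ j\<bar>) = (\<Sum>j\<in>K. \<bar>D $ j\<bar>)"
    by (intro sum.cong) (auto simp: D_nth)
  also have "cone_ratio t * ((\<Sum>j\<in>K. \<bar>D $ j\<bar>) + r1) \<le> cone_ratio t * (sqrt (real (card K)) * V + r1)"
  proof -
    have "(\<Sum>j\<in>K. \<bar>D $ j\<bar>) \<le> sqrt (real (card K)) * norm (restr K D)"
      by (rule sum_abs_le_sqrt_card)
    also have "\<dots> \<le> sqrt (real (card K)) * V"
      unfolding V_def v_def by (intro mult_left_mono norm_restr_mono) auto
    finally show ?thesis
      using cone_ratio_bounds(1)[OF t] by (intro mult_left_mono) auto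
  qed
  finally show ?thesis .
qed

text \<open>Outside \<open>K\<close> the penalty beats the noise, so the sum there is nonpositive. On \<open>Q\<close> there is no penalty and only the
noise counts; on each coordinate of \<open>K - Q\<close> noise and penalty together are at most \<open>3 / 4 * lam\<close>.\<close>

lemma noise_inner_le:
  assumes I: "K \<subseteq> I"
  shows "restr I D \<bullet> (z + w) \<le> N * V"
proof -
  have w: "\<bar>w $ j\<bar> \<le> lam / 2" "j \<in> P \<Longrightarrow> b $ j * w $ j \<le> - (lam / 2) * \<bar>b $ j\<bar>" "j \<notin> P \<Longrightarrow> w $ j = 0" for j
    using st by (auto simp: stationary_def Let_def w_def split: if_splits)
  have QK: "Q \<subseteq> K"
    using K by auto
  have off: "D $ j * (z + w) $ j \<le> 0" if "j \<in> I - K" for j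
  proof -
    have "b $ j * z $ j \<le> \<bar>b $ j\<bar> * \<tau>"
      using mult_left_mono[OF z[of j] abs_ge_zero[of "b $ j"]] abs_le_D1[of "b $ j * z $ j"]
      by (simp add: abs_mult)
    also have "\<dots> \<le> \<bar>b $ j\<bar> * (lam / 2)"
      using \<tau>_le lam by (intro mult_left_mono) auto
    finally have "b $ j * z $ j \<le> \<bar>b $ j\<bar> * (lam / 2)" .
    moreover have "j \<in> P" "D $ j = b $ j"
      using that K(2) by (auto simp: D_nth)
    ultimately show ?thesis
      using w(2)[of j] by (simp add: distrib_left mult.commute)
  qed
  have "(\<Sum>j\<in>Q. D $ j * (z + w) $ j) = restr Q D \<bullet> restr Q z"
    unfolding inner_vec_def using w(3) K(1) by (intro sum.mono_neutral_cong_left) auto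
  also have "\<dots> \<le> norm (restr Q D) * norm (restr Q z)"
    by (rule norm_cauchy_schwarz)
  also have "\<dots> \<le> V * nz"
    unfolding V_def v_def using QK nz by (intro mult_mono norm_restr_mono) auto
  finally have inQ: "(\<Sum>j\<in>Q. D $ j * (z + w) $ j) \<le> nz * V"
    by (simp add: mult.commute)
  have "(\<Sum>j\<in>K - Q. D $ j * (z + w) $ j) \<le> (\<Sum>j\<in>K - Q. 3 / 4 * lam * \<bar>D $ j\<bar>)"
  proof (rule sum_mono)
    fix j
    have "\<bar>(z + w) $ j\<bar> \<le> 3 / 4 * lam"
      using w(1)[of j] z[of j] \<tau>_le unfolding vector_add_component by linarith
    then have "\<bar>D $ j\<bar> * \<bar>(z + w) $ j\<bar> \<le> \<bar>D $ j\<bar> * (3 / 4 * lam)"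
      by (intro mult_left_mono) auto
    then show "D $ j * (z + w) $ j \<le> 3 / 4 * lam * \<bar>D $ j\<bar>"
      using abs_ge_self[of "D $ j * (z + w) $ j"] unfolding abs_mult by (simp add: mult.commute)
  qed
  also have "\<dots> = 3 / 4 * lam * (\<Sum>j\<in>K - Q. \<bar>D $ j\<bar>)"
    by (rule sum_distrib_left[symmetric])
  also have "\<dots> \<le> 3 / 4 * lam * (sqrt (real (card K) - real (card Q)) * V)"
  proof -
    have "(\<Sum>j\<in>K - Q. \<bar>D $ j\<bar>) \<le> sqrt (real (card (K - Q))) * norm (restr (K - Q) D)"
      by (rule sum_abs_le_sqrt_card)
    also have "\<dots> \<le> sqrt (real (card (K - Q))) * V"
      unfolding V_def v_def by (intro mult_left_mono norm_restr_mono) auto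
    also have "real (card (K - Q)) = real (card K) - real (card Q)"
      using QK card_mono[OF _ QK] by (simp add: card_Diff_subset of_nat_diff)
    finally show ?thesis
      using lam by (intro mult_left_mono) auto
  qed
  finally have "(\<Sum>j\<in>K - Q. D $ j * (z + w) $ j) \<le> 3 / 4 * lam * (sqrt (real (card K) - real (card Q)) * V)" .
  moreover have "restr I D \<bullet> (z + w) \<le> (\<Sum>j\<in>Q. D $ j * (z + w) $ j) + (\<Sum>j\<in>K - Q. D $ j * (z + w) $ j)"
    using restr_inner_split[OF I, of D "z + w"] sum_nonpos[of "I - K", OF off]
      sum.subset_diff[OF QK, of "\<lambda>j. D $ j * (z + w) $ j"] by simp
  ultimately show ?thesis
    using inQ by (simp add: N_def algebra_simps)
qed

text \<open>The bias from the truncated coordinates is paid for in the prediction norm, by Cauchy-Schwarz, so that \<open>r\<close> and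
not \<open>r1\<close> appears.\<close>

lemma energy: "(pred_norm n x D)\<^sup>2 \<le> N * V + sqrt \<rho> * r * pred_norm n x D"
proof -
  have "(pred_norm n x D)\<^sup>2 = restr UNIV D \<bullet> (z + w) + D \<bullet> (A *v restr (- K) \<beta>)"
    using gram_D by (simp add: pred_norm_power2 A[symmetric] inner_add_right restr_vec_on vec_on_def)
  also have "\<dots> \<le> N * V + pred_norm n x D * (sqrt \<rho> * r)"
    using noise_inner_le[OF subset_UNIV] gram_inner_le_pred_norm[of D n x "restr (- K) \<beta>", folded A]
      mult_left_mono[OF pred_norm_tail_target pred_norm_nonneg[of n x D]]
    by linarith
  finally show ?thesis
    by (simp add: mult_ac)
qed

text \<open>The tail \<open>r1\<close> enlarges the cone condition by the factor \<open>1 + t / 4\<close> only, and then the condition on \<open>\<pi>\<close> still leaves the fraction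
\<open>t / 4\<close> of the quadratic form of \<open>v\<close>. The case assumption forces \<open>card K > 0\<close>, without which that condition would
say nothing.\<close>

lemma energy_good:
  assumes big: "4 / t * r1 < sqrt (real (card K)) * V"
  shows "0 < V" and "0 < v \<bullet> (A *v v)" and "v \<bullet> (A *v v) * (t / 4) \<le> (N + \<rho> * r) * V"
    and "norm (restr (- (K \<union> J)) D) \<le> 3 / 2 * V + 3 / 2 * r"
proof -
  have "0 \<le> 4 / t * r1"
    using nonneg(2) t by simp
  then have "0 < sqrt (real (card K)) * V"
    using big by linarith
  then have V: "0 < V" and k: "0 < sqrt (real (card K))"
    using nonneg(4) by (auto simp: zero_less_mult_iff)
  show "0 < V"
    by (rule V)
  have v0: "v \<noteq> 0" and vI: "vec_on (K \<union> J) v"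
    using V by (auto simp: V_def v_def)
  obtain p where p: "pi_coef 2 A (card K + l) l = ereal p" "0 \<le> p"
    and W: "\<And>I v. card I = card K + l \<Longrightarrow> vec_on I v \<Longrightarrow> v \<noteq> 0 \<Longrightarrow> 0 < v \<bullet> (sub_matrix A I I *v dual_power 2 v)"
    and PW: "\<And>I J u v. card I = card K + l \<Longrightarrow> card J = l \<Longrightarrow> I \<inter> J = {} \<Longrightarrow> vec_on I v \<Longrightarrow> v \<noteq> 0 \<Longrightarrow> vec_on J u \<Longrightarrow>
       (dual_power 2 v \<bullet> (sub_matrix A I J *v u)) * lp_norm 2 v
         \<le> p * (v \<bullet> (sub_matrix A I I *v dual_power 2 v)) * lp_norm \<infinity> u"
    using pi_coef_real[of 2 "card K + l" l A, OF _ kl(1) l(1) kl(3) coef_condition(1)[OF _ _ _ cond]] l t k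
    by auto
  let ?W = "v \<bullet> (A *v v)"
  have W_eq: "v \<bullet> (sub_matrix A (K \<union> J) (K \<union> J) *v v) = ?W"
    using vI by (simp add: sub_matrix_mult inner_restr_vec_on restr_vec_on)
  show W0: "0 < ?W"
    using W[OF card_I vI v0] unfolding dual_power_2 W_eq .
  have tail: "v \<bullet> (A *v u) \<le> p * ?W / V * lp_norm \<infinity> u"
    if "card L = l" "(K \<union> J) \<inter> L = {}" "vec_on L u" for L u
  proof -
    have "v \<bullet> (sub_matrix A (K \<union> J) L *v u) * V \<le> p * ?W * lp_norm \<infinity> u"
      using PW[OF card_I that(1,2) vI v0 that(3)] unfolding dual_power_2 W_eq lp_norm_2 V_def .
    then show ?thesis
      using that(3) vI V
      by (simp add: sub_matrix_mult restr_vec_on inner_restr_vec_on pos_le_divide_eq)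
  qed
  let ?B = "\<Sum>j\<in>- K. \<bar>D $ j\<bar>"
  have small: "r1 \<le> t / 4 * (sqrt (real (card K)) * V)"
    using big t by (simp add: field_simps)
  have "?B \<le> cone_ratio t * (sqrt (real (card K)) * V + t / 4 * (sqrt (real (card K)) * V))"
    using cone small cone_ratio_bounds(1)[OF t] by (meson add_left_mono less_imp_le mult_left_mono order_trans)
  also have "\<dots> = cone_ratio t * (1 + t / 4) * (sqrt (real (card K)) * V)"
    by (simp add: algebra_simps)
  finally have B: "?B \<le> cone_ratio t * (1 + t / 4) * (sqrt (real (card K)) * V)" .
  have "v \<bullet> (A *v v) - p * ?W / V * (?B / real l) \<le> v \<bullet> (A *v D)"
    using tail_inner_lower_bound[OF head l(1) tail_room _ tail] p V W0 by (simp add: v_def[symmetric])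
  moreover have "p * ?W / V * (?B / real l) \<le> ?W * (1 - t / 4)"
  proof -
    have "p * ?W / V * (?B / real l) \<le>
        p * ?W / V * (cone_ratio t * (1 + t / 4) * (sqrt (real (card K)) * V) / real l)"
      using B p V W0 l by (intro mult_left_mono divide_right_mono) auto
    also have "\<dots> = ?W * (cone_ratio t * (1 + t / 4) * (p * sqrt (real (card K)) / real l))"
      using V by simp
    also have "\<dots> \<le> ?W * (cone_ratio t * (1 + t / 4) * (1 - t))"
      using coef_condition(2)[OF _ _ _ cond p(1)] t k l W0 cone_ratio_bounds(1)[OF t]
      by (intro mult_left_mono) auto
    also have "\<dots> \<le> ?W * (1 - t / 4)"
      using cone_ratio_bounds(4)[OF t] W0 by (intro mult_left_mono) auto
    finally show ?thesis .
  qed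
  moreover have "v \<bullet> (A *v D) \<le> N * V + \<rho> * r * V"
  proof -
    have "v \<bullet> (A *v restr (- K) \<beta>) \<le> pred_norm n x v * pred_norm n x (restr (- K) \<beta>)"
      unfolding A by (rule gram_inner_le_pred_norm)
    also have "\<dots> \<le> (sqrt \<rho> * V) * (sqrt \<rho> * r)"
      unfolding V_def using pred_norm_le[OF _ vI] card_I
      by (intro mult_mono pred_norm_tail_target) (auto simp: rho_bound(1))
    also have "\<dots> = \<rho> * r * V"
      using rho_bound(1) by (simp add: mult_ac)
    finally show ?thesis
      using noise_inner_le[of "K \<union> J"] by (simp add: gram_D inner_add_right v_def)
  qed
  ultimately show "?W * (t / 4) \<le> (N + \<rho> * r) * V"
    by (simp add: algebra_simps)
  have sl: "0 < sqrt (real l)"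
    using l by simp
  have "?B \<le> 3 * (sqrt (real (card K)) * V + r1)"
    using cone cone_ratio_bounds(2)[OF t] nonneg by (intro order.trans[OF cone] mult_right_mono) auto
  also have "\<dots> \<le> 3 * (sqrt (real l) * V + sqrt (real l) * r)"
    using r1_le k_le l nonneg by (intro mult_left_mono add_mono mult_right_mono) auto
  finally have "?B / (2 * sqrt (real l)) \<le> 3 * (sqrt (real l) * V + sqrt (real l) * r) / (2 * sqrt (real l))"
    using sl by (intro divide_right_mono) auto
  also have "\<dots> = 3 / 2 * V + 3 / 2 * r"
    using sl by (simp add: field_simps)
  finally show "norm (restr (- (K \<union> J)) D) \<le> 3 / 2 * V + 3 / 2 * r"
    using head_tail_norm_le[OF head l(1)] by linarith
qed

text \<open>Here the cone condition bounds the \<open>1\<close>-norm of \<open>D\<close> outside \<open>K\<close> by \<open>15 / t * sqrt l * r\<close>. Shelling for the prediction norm makes the part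
beyond \<open>K \<union> J\<close> at most \<open>15 / t * sqrt \<rho> * r\<close>, since a block of size \<open>l\<close> costs at most \<open>sqrt \<rho> * sqrt l\<close> times its sup-norm.
The triangle inequality and the energy inequality then bound \<open>sqrt m * V\<close>.\<close>

lemma energy_bad:
  assumes bad: "sqrt (real (card K)) * V \<le> 4 / t * r1"
  shows "m * V \<le> N + 32 / t * (\<rho> * r)" and "norm (restr (- (K \<union> J)) D) \<le> 15 / 2 * (r / t)"
    and "r = 0 \<Longrightarrow> D = 0"
proof -
  let ?B = "\<Sum>j\<in>- K. \<bar>D $ j\<bar>"
  have sl: "0 < sqrt (real l)"
    using l by simp
  have B1: "?B \<le> 15 / t * r1"
  proof -
    have "?B \<le> 3 * (4 / t * r1 + r1)"
    proof (rule order.trans[OF cone], rule mult_mono)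
      show "sqrt (real (card K)) * V + r1 \<le> 4 / t * r1 + r1"
        using bad by simp
    qed (use cone_ratio_bounds(2)[OF t] nonneg in auto)
    also have "\<dots> \<le> 3 * (4 / t * r1 + 1 / t * r1)"
      using t nonneg mult_right_mono[of 1 "1 / t" r1] by (intro mult_left_mono add_left_mono) auto
    finally show ?thesis
      by simp
  qed
  then have B: "?B \<le> 15 / t * (sqrt (real l) * r)"
    using r1_le t by (meson divide_nonneg_pos mult_left_mono order_trans zero_le_numeral)
  then have "?B / (2 * sqrt (real l)) \<le> 15 / t * (sqrt (real l) * r) / (2 * sqrt (real l))"
    using sl by (intro divide_right_mono) auto
  also have "\<dots> = 15 / 2 * (r / t)"
    using sl by (simp add: field_simps)
  finally show tail: "norm (restr (- (K \<union> J)) D) \<le> 15 / 2 * (r / t)"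
    using head_tail_norm_le[OF head l(1)] by linarith
  show "D = 0" if "r = 0"
  proof -
    have r10: "r1 = 0"
      using that r1_le nonneg(2) by simp
    have "?B \<le> 0"
      using B1 r10 by simp
    moreover have "(\<Sum>j\<in>K. \<bar>D $ j\<bar>) \<le> 0"
      using sum_abs_le_sqrt_card[of D K] bad r10 mult_left_mono[OF norm_restr_mono[of K "K \<union> J" D], of "sqrt (real (card K))"]
      by (simp add: V_def v_def)
    ultimately have "(\<Sum>j\<in>UNIV. \<bar>D $ j\<bar>) \<le> 0"
      using sum.union_disjoint[of K "- K" "\<lambda>j. \<bar>D $ j\<bar>"] by simp
    then have "\<bar>D $ j\<bar> \<le> 0" for j
      using member_le_sum[of j UNIV "\<lambda>j. \<bar>D $ j\<bar>"] by simp
    then show ?thesis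
      by (simp add: vec_eq_iff)
  qed
  have vI: "vec_on (K \<union> J) v"
    by (simp add: v_def)
  let ?X = "pred_norm n x D"
  have "pred_norm n x (restr (- (K \<union> J)) D) \<le> (sqrt \<rho> * sqrt (real l)) * (?B / real l)"
  proof (rule shelling[OF pred_norm_triangle _ head l(1) tail_room])
    fix L :: "'d set" and u :: "real^'d"
    assume L: "card L = l" "(K \<union> J) \<inter> L = {}" "vec_on L u"
    have "pred_norm n x u \<le> sqrt \<rho> * norm u"
      using L by (intro pred_norm_le[of L]) auto
    also have "\<dots> \<le> sqrt \<rho> * (sqrt (real l) * lp_norm \<infinity> u)"
      using norm_le_sqrt_card_sup[OF L(3)] L(1) rho_bound(1) by (intro mult_left_mono) auto
    finally show "pred_norm n x u \<le> sqrt \<rho> * sqrt (real l) * lp_norm \<infinity> u"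
      by (simp add: mult_ac)
  qed (use rho_bound(1) in simp)
  also have "\<dots> \<le> (sqrt \<rho> * sqrt (real l)) * ((15 / t * (sqrt (real l) * r)) / real l)"
    using B rho_bound(1) by (intro mult_left_mono divide_right_mono) auto
  also have "\<dots> = 15 / t * (sqrt \<rho> * r) * ((sqrt (real l) * sqrt (real l)) / real l)"
    by (simp only: divide_inverse mult_ac)
  also have "\<dots> = 15 / t * (sqrt \<rho> * r)"
    using l by simp
  finally have tailX: "pred_norm n x (restr (- (K \<union> J)) D) \<le> 15 / t * (sqrt \<rho> * r)" .
  have "sqrt m * V \<le> pred_norm n x v"
  proof (rule power2_le_imp_le)
    show "(sqrt m * V)\<^sup>2 \<le> (pred_norm n x v)\<^sup>2"
      using gram_block_lower_bound[of "K \<union> J" m n x v] mu_bound card_I vI unfolding A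
      by (simp add: power_mult_distrib pred_norm_power2 V_def)
  qed simp
  also have "v = D + - restr (- (K \<union> J)) D"
    by (auto simp: v_def vec_eq_iff)
  also have "pred_norm n x (D + - restr (- (K \<union> J)) D) \<le> ?X + pred_norm n x (restr (- (K \<union> J)) D)"
    using pred_norm_triangle[of n x D "- restr (- (K \<union> J)) D"] by simp
  also have "?X \<le> sqrt (N * V) + sqrt \<rho> * r"
    using energy nonneg rho_bound(1) by (intro le_of_quadratic) auto
  finally have "sqrt m * V \<le> sqrt (N * V) + (sqrt \<rho> * r + 15 / t * (sqrt \<rho> * r))"
    using tailX by simp
  also have "sqrt \<rho> * r + 15 / t * (sqrt \<rho> * r) \<le> 16 / t * (sqrt \<rho> * r)"
    using t nonneg rho_bound(1) mult_right_mono[of 1 "1 / t" "sqrt \<rho> * r"] by simp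
  finally have "sqrt m * (sqrt m * V) \<le> sqrt m * (sqrt (N * V) + 16 / t * (sqrt \<rho> * r))"
    using mu_bound(1) by (intro mult_left_mono) auto
  moreover have "sqrt m * (sqrt m * V) = m * V"
    using mu_bound(1) by (simp add: mult.assoc[symmetric])
  ultimately have "m * V \<le> sqrt N * sqrt (m * V) + 16 / t * (sqrt m * sqrt \<rho> * r)"
    by (simp add: real_sqrt_mult algebra_simps)
  also have "sqrt N * sqrt (m * V) \<le> (N + m * V) / 2"
    using arith_geo_mean_sqrt[of N "m * V"] nonneg mu_bound(1) by (simp add: real_sqrt_mult)
  also have "16 / t * (sqrt m * sqrt \<rho> * r) \<le> 16 / t * (sqrt \<rho> * sqrt \<rho> * r)"
    using mu_le_rho nonneg t rho_bound(1) by (intro mult_left_mono mult_right_mono) auto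
  also have "sqrt \<rho> * sqrt \<rho> = \<rho>"
    using rho_bound(1) by simp
  finally have "m * V \<le> (N + m * V) / 2 + 16 / t * (\<rho> * r)"
    by simp
  moreover have "X \<le> N + 2 * Y" if "X \<le> (N + X) / 2 + Y" for X Y
    using that by (simp add: field_simps)
  ultimately show "m * V \<le> N + 32 / t * (\<rho> * r)"
    by fastforce
qed

lemma error_split: "norm (b - \<beta>) \<le> V + norm (restr (- (K \<union> J)) D) + r"
proof -
  have "b - \<beta> = (v + restr (- (K \<union> J)) D) - restr (- K) \<beta>"
    by (auto simp: v_def D_def vec_eq_iff)
  then have "norm (b - \<beta>) \<le> norm (v + restr (- (K \<union> J)) D) + norm (restr (- K) \<beta>)"
    by (metis norm_triangle_ineq4)
  then show ?thesis
    using norm_triangle_ineq[of v "restr (- (K \<union> J)) D"] by (simp add: V_def r_def)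
qed

text \<open>In the first case \<open>V \<le> 4 (N + \<rho> r) / (t m)\<close>, and the tail adds \<open>3 / 2 * V\<close>, which gives \<open>10 N\<close>. In the second case the
contributions of \<open>\<rho> r\<close> are \<open>32\<close> from \<open>V\<close> and \<open>15 / 2\<close> from the tail, where \<open>m \<le> \<rho>\<close> turns \<open>r / t\<close> into
\<open>\<rho> r / (t m)\<close>; together they stay below \<open>40\<close>.\<close>

lemma error_bound:
  assumes m0: "0 < m"
  shows "norm (b - \<beta>) \<le> (10 * N + 40 * (\<rho> * r)) / (t * m) + 8 * r"
proof (cases "4 / t * r1 < sqrt (real (card K)) * V")
  case True
  note good = energy_good[OF True]
  have "m * V\<^sup>2 * (t / 4) \<le> v \<bullet> (A *v v) * (t / 4)"
    using gram_block_lower_bound[of "K \<union> J" m n x v] mu_bound card_I t unfolding A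
    by (intro mult_right_mono) (auto simp: V_def v_def)
  then have "V * (m * V * (t / 4)) \<le> V * (N + \<rho> * r)"
    using good(3) by (simp add: power2_eq_square mult_ac)
  then have "m * V * (t / 4) \<le> N + \<rho> * r"
    using good(1) by simp
  then have "V * (t * m) \<le> 4 * (N + \<rho> * r)"
    by (simp add: algebra_simps)
  then have "V \<le> 4 * (N + \<rho> * r) / (t * m)"
    using m0 t by (simp add: pos_le_divide_eq)
  then have "norm (b - \<beta>) \<le> 5 / 2 * (4 * (N + \<rho> * r) / (t * m)) + 5 / 2 * r"
    using error_split good(4) by linarith
  also have "5 / 2 * (4 * (N + \<rho> * r) / (t * m)) = (10 * N + 10 * (\<rho> * r)) / (t * m)"
    by (simp add: distrib_left)
  also have "\<dots> \<le> (10 * N + 40 * (\<rho> * r)) / (t * m)"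
    using m0 t rho_bound(1) nonneg by (intro divide_right_mono) auto
  finally show ?thesis
    using nonneg(1) by linarith
next
  case False
  then have bad: "sqrt (real (card K)) * V \<le> 4 / t * r1"
    by simp
  have \<rho>r: "0 \<le> \<rho> * r"
    using rho_bound(1) nonneg by simp
  have "V * m \<le> N + 32 / t * (\<rho> * r)"
    using energy_bad(1)[OF bad] by (simp add: mult.commute)
  also have "\<dots> \<le> (N + 32 * (\<rho> * r)) / t"
    using t nonneg(3) mult_right_mono[of t 1 N] by (simp add: field_simps)
  finally have V: "V \<le> (N + 32 * (\<rho> * r)) / (t * m)"
    using m0 t by (simp add: field_simps)
  have "r * m \<le> \<rho> * r"
    using mult_left_mono[OF mu_le_rho nonneg(1)] by (simp add: mult.commute)
  then have "r / t \<le> \<rho> * r / (t * m)"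
    using m0 t by (simp add: field_simps)
  then have "norm (b - \<beta>) \<le> (N + 32 * (\<rho> * r)) / (t * m) + 15 / 2 * (\<rho> * r / (t * m)) + r"
    using error_split energy_bad(2)[OF bad] V by linarith
  also have "(N + 32 * (\<rho> * r)) / (t * m) + 15 / 2 * (\<rho> * r / (t * m)) =
      (N + 79 / 2 * (\<rho> * r)) / (t * m)"
    by (simp add: add_divide_distrib)
  also have "\<dots> \<le> (10 * N + 40 * (\<rho> * r)) / (t * m)"
    using m0 t \<rho>r nonneg(3) by (intro divide_right_mono) auto
  finally show ?thesis
    using nonneg(1) by linarith
qed

text \<open>All diagonal entries vanish, and Cauchy-Schwarz removes the others.\<close>

lemma rho_zero_imp_gram_zero:
  assumes "\<rho> = 0"
  shows "A = 0"
proof -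
  have axis: "pred_norm n x (axis j 1) = 0" for j
  proof (rule antisym)
    have "vec_on {j} (axis j (1 :: real))"
      by (simp add: vec_on_def axis_def)
    then show "pred_norm n x (axis j 1) \<le> 0"
      using pred_norm_le[of "{j}" "axis j 1"] kl(1) assms by simp
  qed simp
  have "A $ i $ j = axis i 1 \<bullet> (A *v axis j 1)" for i j
    by (simp add: inner_axis' matrix_vector_mult_basis column_def)
  moreover have "axis i 1 \<bullet> (A *v axis j 1) \<le> 0" "(- axis i 1) \<bullet> (A *v axis j 1) \<le> 0" for i j :: 'd
    using gram_inner_le_pred_norm[of "axis i 1" n x "axis j 1"]
      gram_inner_le_pred_norm[of "- axis i 1" n x "axis j 1"] axis
    unfolding A by simp_all
  ultimately have "A $ i $ j = 0" for i j
    by (simp add: antisym)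
  then show ?thesis
    by (simp add: vec_eq_iff)
qed

text \<open>This serves the case \<open>m = 0\<close> with vanishing bracket, where the product \<open>\<infinity> * 0 = 0\<close> leaves no room in the
bound. A large error on \<open>K \<union> J\<close> is impossible, since its quadratic form would be positive but bounded by \<open>0\<close>.\<close>

lemma error_bound_degenerate:
  assumes "N = 0" and r0: "r = 0"
  shows "b = \<beta>"
proof -
  have "\<not> 4 / t * r1 < sqrt (real (card K)) * V"
  proof
    assume "4 / t * r1 < sqrt (real (card K)) * V"
    note good = energy_good[OF this]
    have "v \<bullet> (A *v v) * (t / 4) \<le> 0"
      using good(3) assms by simp
    then show False
      using good(2) t by (simp add: mult_le_0_iff)
  qed
  then have "D = 0"
    using energy_bad(3) r0 by simp
  then have "norm (b - \<beta>) \<le> 0"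
    using error_split r0 by (simp add: V_def v_def restr_zero)
  then show ?thesis
    by simp
qed

end

section \<open>Tail norms\<close>

lemma take_filter_sorted:
  assumes "sorted xs"
  shows "take (length (filter (\<lambda>x. x \<le> c) xs)) xs = filter (\<lambda>x. x \<le> c) xs"
  using assms
proof (induction xs)
  case (Cons a xs)
  show ?case
  proof (cases "a \<le> c")
    case False
    then have "filter (\<lambda>x. x \<le> c) xs = []"
      using Cons.prems by (fastforce simp: filter_empty_conv)
    then show ?thesis
      using False by simp
  qed (use Cons in simp)
qed simp

text \<open>The list starts with the absolute values above the threshold \<open>c\<close>, so dropping them leaves a permutation of the others.\<close>

lemma tail_norm_eq:
  fixes \<beta> :: "real^'d"
  shows "tail_norm 2 (card (supp_above c \<beta>)) \<beta> = norm (restr (- supp_above c \<beta>) \<beta>)"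
proof -
  define xs where "xs = sorted_list_of_multiset (image_mset (\<lambda>j. \<bar>\<beta> $ j\<bar>) (mset_set (UNIV :: 'd set)))"
  have mset: "mset xs = image_mset (\<lambda>j. \<bar>\<beta> $ j\<bar>) (mset_set UNIV)"
    by (simp add: xs_def)
  let ?ys = "filter (\<lambda>x. x \<le> c) xs"
  have my: "mset ?ys = image_mset (\<lambda>j. \<bar>\<beta> $ j\<bar>) (mset_set (- supp_above c \<beta>))"
  proof -
    have "{j \<in> UNIV. \<bar>\<beta> $ j\<bar> \<le> c} = - supp_above c \<beta>"
      by (auto simp: supp_above_def)
    then show ?thesis
      unfolding mset_filter mset filter_mset_image_mset by simp
  qed
  have "length ?ys = card (- supp_above c \<beta>)"
    unfolding size_mset[symmetric] my by simp
  moreover have "length xs = CARD('d)"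
    unfolding size_mset[symmetric] mset by simp
  ultimately have "length xs - card (supp_above c \<beta>) = length ?ys"
    using card_add_card_compl[of "supp_above c \<beta>"] by simp
  then have "drop (card (supp_above c \<beta>)) (abs_desc \<beta>) = rev ?ys"
    unfolding abs_desc_def xs_def[symmetric] drop_rev
    using take_filter_sorted[of xs c] by (simp add: xs_def)
  then have "(\<Sum>x\<leftarrow>drop (card (supp_above c \<beta>)) (abs_desc \<beta>). x powr 2) =
      sum_mset (image_mset (\<lambda>x. x powr 2) (mset ?ys))"
    by (simp add: rev_map[symmetric] sum_mset_sum_list[symmetric] del: mset_filter)
  also have "\<dots> = (\<Sum>j\<in>- supp_above c \<beta>. \<bar>\<beta> $ j\<bar> powr 2)"
    unfolding my by (simp add: sum_unfold_sum_mset image_mset.compositionality comp_def)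
  also have "\<dots> = (\<Sum>j\<in>UNIV. (restr (- supp_above c \<beta>) \<beta> $ j)\<^sup>2)"
    by (intro sum.mono_neutral_cong_left) auto
  finally show ?thesis
    by (simp add: tail_norm_def norm_vec_def L2_set_def powr_half_sqrt sum_nonneg)
qed

section \<open>Sub-Gaussian noise\<close>

text \<open>\<open>v\<close> is a variance proxy. The nonnegative integral makes integrability part of the bound.\<close>

definition sub_gaussian :: "'w measure \<Rightarrow> real \<Rightarrow> ('w \<Rightarrow> real) \<Rightarrow> bool" where
  "sub_gaussian M v Z \<longleftrightarrow> Z \<in> borel_measurable M \<and>
     (\<forall>\<theta>. (\<integral>\<^sup>+w. ennreal (exp (\<theta> * Z w)) \<partial>M) \<le> ennreal (exp (v * \<theta>\<^sup>2 / 2)))"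

lemma sub_gaussianD:
  assumes "sub_gaussian M v Z"
  shows "Z \<in> borel_measurable M"
    and "(\<integral>\<^sup>+w. ennreal (exp (\<theta> * Z w)) \<partial>M) \<le> ennreal (exp (v * \<theta>\<^sup>2 / 2))"
  using assms by (auto simp: sub_gaussian_def)

lemma sub_gaussian_mono:
  assumes "sub_gaussian M v Z" "v \<le> v'"
  shows "sub_gaussian M v' Z"
proof -
  have "exp (v * \<theta>\<^sup>2 / 2) \<le> exp (v' * \<theta>\<^sup>2 / 2)" for \<theta> :: real
    using assms(2) by (simp add: mult_right_mono)
  then show ?thesis
    using assms(1) unfolding sub_gaussian_def by (meson ennreal_leI order_trans)
qed

lemma sub_gaussian_uminus:
  assumes "sub_gaussian M v Z"
  shows "sub_gaussian M v (\<lambda>w. - Z w)"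
  unfolding sub_gaussian_def
proof (intro conjI allI)
  show "(\<lambda>w. - Z w) \<in> borel_measurable M"
    using sub_gaussianD(1)[OF assms] by simp
  show "(\<integral>\<^sup>+w. ennreal (exp (\<theta> * - Z w)) \<partial>M) \<le> ennreal (exp (v * \<theta>\<^sup>2 / 2))" for \<theta>
    using sub_gaussianD(2)[OF assms, of "- \<theta>"] by simp
qed

lemma (in prob_space) sub_gaussian_linear_combination:
  fixes X :: "'i \<Rightarrow> 'a \<Rightarrow> real"
  assumes I: "finite I" and indep: "indep_vars (\<lambda>_. borel) X I"
    and X: "\<And>i. i \<in> I \<Longrightarrow> sub_gaussian M v (\<lambda>w. X i w - \<mu> i)"
  shows "sub_gaussian M (v * (\<Sum>i\<in>I. (c i)\<^sup>2)) (\<lambda>w. \<Sum>i\<in>I. c i * (X i w - \<mu> i))"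
  unfolding sub_gaussian_def
proof (intro conjI allI)
  show "(\<lambda>w. \<Sum>i\<in>I. c i * (X i w - \<mu> i)) \<in> borel_measurable M"
    using sub_gaussianD(1)[OF X] by auto
  fix \<theta>
  have "(\<integral>\<^sup>+w. ennreal (exp (\<theta> * (\<Sum>i\<in>I. c i * (X i w - \<mu> i)))) \<partial>M) =
      (\<integral>\<^sup>+w. (\<Prod>i\<in>I. ennreal (exp (\<theta> * c i * (X i w - \<mu> i)))) \<partial>M)"
    using I by (simp add: prod_ennreal exp_sum[symmetric] sum_distrib_left mult.assoc)
  also have "\<dots> = (\<Prod>i\<in>I. \<integral>\<^sup>+w. ennreal (exp (\<theta> * c i * (X i w - \<mu> i))) \<partial>M)"
    by (intro indep_vars_nn_integral I indep_vars_compose2[OF indep]) auto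
  also have "\<dots> \<le> (\<Prod>i\<in>I. ennreal (exp (v * (\<theta> * c i)\<^sup>2 / 2)))"
    by (intro prod_mono_ennreal sub_gaussianD(2)[OF X])
  also have "\<dots> = ennreal (exp (v * (\<Sum>i\<in>I. (c i)\<^sup>2) * \<theta>\<^sup>2 / 2))"
    using I by (simp add: prod_ennreal exp_sum[symmetric] sum_distrib_left sum_distrib_right
        sum_divide_distrib power_mult_distrib mult_ac)
  finally show "(\<integral>\<^sup>+w. ennreal (exp (\<theta> * (\<Sum>i\<in>I. c i * (X i w - \<mu> i)))) \<partial>M)
      \<le> ennreal (exp (v * (\<Sum>i\<in>I. (c i)\<^sup>2) * \<theta>\<^sup>2 / 2))" .
qed

lemma (in prob_space) sub_gaussian_tail:
  assumes Z: "sub_gaussian M v Z" and v: "0 < v" and u: "0 < u"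
  shows "prob {w \<in> space M. u \<le> Z w} \<le> exp (- u\<^sup>2 / (2 * v))"
proof -
  have [measurable]: "Z \<in> borel_measurable M"
    using sub_gaussianD(1)[OF Z] .
  let ?s = "u / v"
  have "emeasure M {w \<in> space M. u \<le> Z w} \<le>
      ennreal (exp (- ?s * u)) * (\<integral>\<^sup>+w. ennreal (exp (?s * Z w)) * indicator (space M) w \<partial>M)"
    using u v by (intro Chernoff_ineq_nn_integral_ge) auto
  also have "(\<integral>\<^sup>+w. ennreal (exp (?s * Z w)) * indicator (space M) w \<partial>M) = (\<integral>\<^sup>+w. ennreal (exp (?s * Z w)) \<partial>M)"
    by (intro nn_integral_cong) simp
  also have "ennreal (exp (- ?s * u)) * \<dots> \<le> ennreal (exp (- ?s * u)) * ennreal (exp (v * ?s\<^sup>2 / 2))"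
    by (intro mult_left_mono sub_gaussianD(2)[OF Z]) simp
  also have "\<dots> = ennreal (exp (- ?s * u + v * ?s\<^sup>2 / 2))"
    unfolding exp_add by (rule ennreal_mult[symmetric]) auto
  also have "- ?s * u + v * ?s\<^sup>2 / 2 = - u\<^sup>2 / (2 * v)"
    using v by (simp add: field_simps power2_eq_square)
  finally show ?thesis
    by (simp add: emeasure_eq_measure)
qed

lemma (in prob_space) sub_gaussian_abs_tail:
  assumes Z: "sub_gaussian M v Z" and v: "0 < v" and u: "0 < u"
  shows "prob {w \<in> space M. u < \<bar>Z w\<bar>} \<le> 2 * exp (- u\<^sup>2 / (2 * v))"
proof -
  have [measurable]: "Z \<in> borel_measurable M"
    using sub_gaussianD(1)[OF Z] .
  have "prob {w \<in> space M. u < \<bar>Z w\<bar>} \<le> prob ({w \<in> space M. u \<le> Z w} \<union> {w \<in> space M. u \<le> - Z w})"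
    by (intro finite_measure_mono) auto
  also have "\<dots> \<le> prob {w \<in> space M. u \<le> Z w} + prob {w \<in> space M. u \<le> - Z w}"
    by (intro measure_Un_le) auto
  finally show ?thesis
    using sub_gaussian_tail[OF Z v u] sub_gaussian_tail[OF sub_gaussian_uminus[OF Z] v u] by linarith
qed

text \<open>The nonnegative function \<open>exp Z + exp (- Z) - 2\<close> has integral at most \<open>0\<close>, and it vanishes only where \<open>Z = 0\<close>.\<close>

lemma (in prob_space) sub_gaussian_zero:
  assumes Z: "sub_gaussian M 0 Z"
  shows "AE w in M. Z w = 0"
proof -
  have [measurable]: "Z \<in> borel_measurable M"
    using sub_gaussianD(1)[OF Z] .
  define f where "f w = exp (Z w) + exp (- Z w) - 2" for w
  have f: "f w = (exp (Z w / 2) - exp (- Z w / 2))\<^sup>2" for w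
    by (simp add: f_def power2_eq_square algebra_simps exp_add[symmetric])
  then have f0: "0 \<le> f w" for w
    by simp
  have "(\<integral>\<^sup>+w. ennreal (f w) \<partial>M) + 2 = (\<integral>\<^sup>+w. ennreal (f w) + 2 \<partial>M)"
    by (subst nn_integral_add) (auto simp: f_def emeasure_space_1)
  also have "\<dots> = (\<integral>\<^sup>+w. ennreal (exp (Z w)) + ennreal (exp (- Z w)) \<partial>M)"
  proof (intro nn_integral_cong)
    fix w
    have "ennreal (f w) + ennreal 2 = ennreal (f w + 2)"
      using f0 by (intro ennreal_plus[symmetric]) auto
    then show "ennreal (f w) + 2 = ennreal (exp (Z w)) + ennreal (exp (- Z w))"
      by (simp add: f_def ennreal_plus[symmetric] del: ennreal_plus)
  qed
  also have "\<dots> = (\<integral>\<^sup>+w. ennreal (exp (Z w)) \<partial>M) + (\<integral>\<^sup>+w. ennreal (exp (- Z w)) \<partial>M)"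
    by (intro nn_integral_add) auto
  also have "\<dots> \<le> 1 + 1"
    using sub_gaussianD(2)[OF Z, of 1] sub_gaussianD(2)[OF Z, of "-1"] by (intro add_mono) auto
  finally have "2 + (\<integral>\<^sup>+w. ennreal (f w) \<partial>M) \<le> 2 + 0"
    by (simp add: add.commute)
  then have "(\<integral>\<^sup>+w. ennreal (f w) \<partial>M) = 0"
    unfolding ennreal_add_left_cancel_le by simp
  then have "AE w in M. ennreal (f w) = 0"
    by (subst (asm) nn_integral_0_iff_AE) (auto simp: f_def)
  then show ?thesis
  proof eventually_elim
    fix w assume "ennreal (f w) = 0"
    then have "f w = 0"
      using f0[of w] by simp
    then show "Z w = 0"
      unfolding f by simp
  qed
qed

lemma exp_square_eq_gaussian_mixture:
  "(\<integral>\<^sup>+g. ennreal (std_normal_density g * exp (s * g)) \<partial>lborel) = ennreal (exp (s\<^sup>2 / 2))"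
proof -
  have "std_normal_density g * exp (s * g) = exp (s\<^sup>2 / 2) * normal_density s 1 g" for g
  proof -
    have "- g\<^sup>2 / 2 + s * g = s\<^sup>2 / 2 + - (g - s)\<^sup>2 / 2"
      by (simp add: power2_eq_square field_simps)
    then have "exp (- g\<^sup>2 / 2) * exp (s * g) = exp (s\<^sup>2 / 2) * exp (- (g - s)\<^sup>2 / 2)"
      unfolding mult_exp_exp by simp
    then show ?thesis
      by (simp add: normal_density_def)
  qed
  then have "(\<integral>\<^sup>+g. ennreal (std_normal_density g * exp (s * g)) \<partial>lborel) =
      (\<integral>\<^sup>+g. ennreal (exp (s\<^sup>2 / 2)) * ennreal (normal_density s 1 g) \<partial>lborel)"
    by (simp add: ennreal_mult)
  also have "\<dots> = ennreal (exp (s\<^sup>2 / 2)) * (\<integral>\<^sup>+g. ennreal (normal_density s 1 g) \<partial>lborel)"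
    by (rule nn_integral_cmult) simp
  also have "(\<integral>\<^sup>+g. ennreal (normal_density s 1 g) \<partial>lborel) = 1"
    by (subst nn_integral_eq_integral) auto
  finally show ?thesis
    by simp
qed

text \<open>The exponential of a square is a Gaussian mixture of exponentials of linear functions. Exchanging the integrals, the inner one is
at most \<open>exp (g\<^sup>2 / 4)\<close>, and integrating this against the standard normal density gives \<open>sqrt 2\<close>.\<close>

lemma (in prob_space) sub_gaussian_exp_square:
  assumes Z: "sub_gaussian M v Z" and v: "0 < v"
  shows "(\<integral>\<^sup>+w. ennreal (exp ((Z w)\<^sup>2 / (4 * v))) \<partial>M) \<le> ennreal (sqrt 2)"
proof -
  interpret pair_sigma_finite lborel M
    by unfold_locales
  have [measurable]: "Z \<in> borel_measurable M"
    using sub_gaussianD(1)[OF Z] .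
  define c where "c = 1 / sqrt (2 * v)"
  have c2: "c\<^sup>2 = 1 / (2 * v)"
    using v by (simp add: c_def power_divide)
  have "(\<integral>\<^sup>+w. ennreal (exp ((Z w)\<^sup>2 / (4 * v))) \<partial>M) =
      (\<integral>\<^sup>+w. (\<integral>\<^sup>+g. ennreal (std_normal_density g * exp (c * Z w * g)) \<partial>lborel) \<partial>M)"
    by (simp add: exp_square_eq_gaussian_mixture power_mult_distrib c2)
  also have "\<dots> = (\<integral>\<^sup>+g. (\<integral>\<^sup>+w. ennreal (std_normal_density g * exp (c * Z w * g)) \<partial>M) \<partial>lborel)"
    by (rule Fubini') measurable
  also have "\<dots> \<le> (\<integral>\<^sup>+g. ennreal (sqrt 2 * normal_density 0 (sqrt 2) g) \<partial>lborel)"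
  proof (rule nn_integral_mono)
    fix g :: real
    have "(\<integral>\<^sup>+w. ennreal (std_normal_density g * exp (c * Z w * g)) \<partial>M) =
        (\<integral>\<^sup>+w. ennreal (std_normal_density g) * ennreal (exp (c * g * Z w)) \<partial>M)"
      by (simp add: ennreal_mult mult_ac)
    also have "\<dots> = ennreal (std_normal_density g) * (\<integral>\<^sup>+w. ennreal (exp (c * g * Z w)) \<partial>M)"
      by (rule nn_integral_cmult) simp
    also have "\<dots> \<le> ennreal (std_normal_density g) * ennreal (exp (v * (c * g)\<^sup>2 / 2))"
      by (intro mult_left_mono sub_gaussianD(2)[OF Z]) simp
    also have "\<dots> = ennreal (std_normal_density g * exp (g\<^sup>2 / 4))"
      using v by (simp add: ennreal_mult power_mult_distrib c2)
    also have "std_normal_density g * exp (g\<^sup>2 / 4) = sqrt 2 * normal_density 0 (sqrt 2) g"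
      by (simp add: normal_density_def real_sqrt_mult mult_exp_exp field_simps)
    finally show "(\<integral>\<^sup>+w. ennreal (std_normal_density g * exp (c * Z w * g)) \<partial>M) \<le>
        ennreal (sqrt 2 * normal_density 0 (sqrt 2) g)" .
  qed
  also have "\<dots> = ennreal (sqrt 2) * (\<integral>\<^sup>+g. ennreal (normal_density 0 (sqrt 2) g) \<partial>lborel)"
    by (simp add: ennreal_mult nn_integral_cmult)
  also have "(\<integral>\<^sup>+g. ennreal (normal_density 0 (sqrt 2) g) \<partial>lborel) = 1"
    by (subst nn_integral_eq_integral) auto
  finally show ?thesis
    by simp
qed

text \<open>The \<open>Z j\<close> may be dependent. By convexity the exponential of an average is at most the average of the exponentials, which
reduces the bound to a single \<open>Z j\<close>.\<close>

lemma (in prob_space) sub_gaussian_sum_square_tail: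
  assumes Z: "\<And>j. j \<in> Q \<Longrightarrow> sub_gaussian M v (Z j)" and v: "0 < v" and Q: "finite Q" "Q \<noteq> {}"
  shows "prob {w \<in> space M. u \<le> (\<Sum>j\<in>Q. (Z j w)\<^sup>2)} \<le> sqrt 2 * exp (- u / (4 * v * real (card Q)))"
proof -
  have meas: "Z j \<in> borel_measurable M" if "j \<in> Q" for j
    using sub_gaussianD(1)[OF Z] that .
  let ?q = "real (card Q)"
  have q: "0 < ?q"
    using Q by (simp add: card_gt_0_iff)
  let ?s = "1 / (4 * v * ?q)"
  have "emeasure M {w \<in> space M. u \<le> (\<Sum>j\<in>Q. (Z j w)\<^sup>2)} \<le>
      ennreal (exp (- ?s * u)) * (\<integral>\<^sup>+w. ennreal (exp (?s * (\<Sum>j\<in>Q. (Z j w)\<^sup>2))) * indicator (space M) w \<partial>M)"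
    using q v meas by (intro Chernoff_ineq_nn_integral_ge) auto
  also have "(\<integral>\<^sup>+w. ennreal (exp (?s * (\<Sum>j\<in>Q. (Z j w)\<^sup>2))) * indicator (space M) w \<partial>M) \<le>
      (\<integral>\<^sup>+w. (\<Sum>j\<in>Q. ennreal (1 / ?q) * ennreal (exp ((Z j w)\<^sup>2 / (4 * v)))) \<partial>M)"
  proof (rule nn_integral_mono)
    fix w assume "w \<in> space M"
    have "exp (\<Sum>j\<in>Q. (1 / ?q) *\<^sub>R ((Z j w)\<^sup>2 / (4 * v))) \<le> (\<Sum>j\<in>Q. (1 / ?q) * exp ((Z j w)\<^sup>2 / (4 * v)))"
      using q by (intro convex_on_sum[OF Q exp_convex]) auto
    also have "(\<Sum>j\<in>Q. (1 / ?q) *\<^sub>R ((Z j w)\<^sup>2 / (4 * v))) = ?s * (\<Sum>j\<in>Q. (Z j w)\<^sup>2)"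
      by (simp add: sum_divide_distrib mult_ac)
    finally have "ennreal (exp (?s * (\<Sum>j\<in>Q. (Z j w)\<^sup>2))) \<le> ennreal (\<Sum>j\<in>Q. (1 / ?q) * exp ((Z j w)\<^sup>2 / (4 * v)))"
      by (rule ennreal_leI)
    also have "\<dots> = (\<Sum>j\<in>Q. ennreal ((1 / ?q) * exp ((Z j w)\<^sup>2 / (4 * v))))"
      by (simp add: sum_ennreal)
    also have "\<dots> = (\<Sum>j\<in>Q. ennreal (1 / ?q) * ennreal (exp ((Z j w)\<^sup>2 / (4 * v))))"
      by (intro sum.cong refl ennreal_mult) auto
    finally show "ennreal (exp (?s * (\<Sum>j\<in>Q. (Z j w)\<^sup>2))) * indicator (space M) w \<le>
        (\<Sum>j\<in>Q. ennreal (1 / ?q) * ennreal (exp ((Z j w)\<^sup>2 / (4 * v))))"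
      using \<open>w \<in> space M\<close> by simp
  qed
  also have "\<dots> = (\<Sum>j\<in>Q. \<integral>\<^sup>+w. ennreal (1 / ?q) * ennreal (exp ((Z j w)\<^sup>2 / (4 * v))) \<partial>M)"
    using meas by (intro nn_integral_sum) auto
  also have "\<dots> = (\<Sum>j\<in>Q. ennreal (1 / ?q) * (\<integral>\<^sup>+w. ennreal (exp ((Z j w)\<^sup>2 / (4 * v))) \<partial>M))"
    using meas by (intro sum.cong refl nn_integral_cmult) auto
  also have "\<dots> \<le> (\<Sum>j\<in>Q. ennreal (1 / ?q) * ennreal (sqrt 2))"
    by (intro sum_mono mult_left_mono sub_gaussian_exp_square Z v) auto
  also have "\<dots> = (\<Sum>j\<in>Q. ennreal (1 / ?q * sqrt 2))"
    by (intro sum.cong refl ennreal_mult[symmetric]) auto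
  also have "\<dots> = ennreal (\<Sum>j\<in>Q. 1 / ?q * sqrt 2)"
    by (intro sum_ennreal) simp
  also have "(\<Sum>j\<in>Q. 1 / ?q * sqrt 2) = sqrt 2"
    using q by simp
  finally have "emeasure M {w \<in> space M. u \<le> (\<Sum>j\<in>Q. (Z j w)\<^sup>2)} \<le> ennreal (exp (- ?s * u)) * ennreal (sqrt 2)"
    by (simp add: mult_left_mono)
  also have "\<dots> = ennreal (sqrt 2 * exp (- u / (4 * v * ?q)))"
    by (simp add: ennreal_mult[symmetric] mult.commute)
  finally show ?thesis
    by (simp add: emeasure_eq_measure)
qed

section \<open>Combining noise control and both stages\<close>

text \<open>The first part is a union bound over the coordinates and costs \<open>\<delta>\<close>. For the second, the tail bound at \<open>10 ln (1 / \<delta>)\<close> gives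
\<open>sqrt 2 * \<delta> powr (5 / 2)\<close>, which is strictly below \<open>\<delta>\<close> as \<open>\<delta> < 1 / 2\<close>; this is where the strict inequality for the probability comes
from. For \<open>v = 0\<close> the noise vanishes almost surely.\<close>

lemma (in prob_space) noise_event:
  fixes Z :: "'d::finite \<Rightarrow> 'a \<Rightarrow> real" and Q :: "'d set"
  assumes Z: "\<And>j. sub_gaussian M v (Z j)" and v: "0 \<le> v" and \<delta>: "0 < \<delta>" "\<delta> < 1 / 2"
  shows "\<exists>E\<in>events. 1 - 2 * \<delta> < prob E \<and>
    (\<forall>w\<in>E. (\<forall>j. \<bar>Z j w\<bar> \<le> sqrt (v * (2 * ln (2 * real CARD('d) / \<delta>)))) \<and>
            (\<Sum>j\<in>Q. (Z j w)\<^sup>2) \<le> v * (10 * ln (1 / \<delta>)) * real (card Q))"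
proof -
  let ?d = "real CARD('d)"
  define T where "T = sqrt (v * (2 * ln (2 * ?d / \<delta>)))"
  define c where "c = v * (10 * ln (1 / \<delta>)) * real (card Q)"
  define E where "E = {w \<in> space M. (\<forall>j. \<bar>Z j w\<bar> \<le> T) \<and> (\<Sum>j\<in>Q. (Z j w)\<^sup>2) \<le> c}"
  have [measurable]: "Z j \<in> borel_measurable M" for j
    using sub_gaussianD(1)[OF Z] .
  have E[measurable]: "E \<in> events"
    unfolding E_def by measurable
  have d: "1 \<le> ?d"
    by (simp add: Suc_leI)
  have ln1: "0 < ln (1 / \<delta>)"
    using \<delta> by simp
  have "\<delta> < 2 * ?d"
    using \<delta> d by linarith
  then have ln2: "0 < ln (2 * ?d / \<delta>)"
    using \<delta> by simp
  have "1 - 2 * \<delta> < prob E"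
  proof (cases "v = 0")
    case True
    have "AE w in M. Z j w = 0" for j
      using sub_gaussian_zero Z True by metis
    then have "AE w in M. \<forall>j. Z j w = 0"
      by (simp add: AE_all_countable)
    then have "AE w in M. w \<in> E"
      by (rule AE_mp) (auto simp: E_def T_def c_def True)
    then have "prob E = 1"
      using E by (simp add: prob_eq_1)
    then show ?thesis
      using \<delta> by simp
  next
    case False
    then have v: "0 < v"
      using v by simp
    define B where "B = {w \<in> space M. Q \<noteq> {} \<and> c \<le> (\<Sum>j\<in>Q. (Z j w)\<^sup>2)}"
    have [measurable]: "B \<in> events"
      unfolding B_def by measurable
    have T: "0 < T" "T\<^sup>2 = v * (2 * ln (2 * ?d / \<delta>))"
      using v ln2 by (auto simp: T_def)
    have PT: "prob {w \<in> space M. T < \<bar>Z j w\<bar>} \<le> \<delta> / ?d" for j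
    proof -
      have "prob {w \<in> space M. T < \<bar>Z j w\<bar>} \<le> 2 * exp (- T\<^sup>2 / (2 * v))"
        by (rule sub_gaussian_abs_tail[OF Z v T(1)])
      also have "- T\<^sup>2 / (2 * v) = - ln (2 * ?d / \<delta>)"
        using v by (simp add: T(2))
      also have "2 * exp (- ln (2 * ?d / \<delta>)) = \<delta> / ?d"
        using \<delta> d by (simp add: exp_minus)
      finally show ?thesis .
    qed
    have PB: "prob B < \<delta>"
    proof (cases "Q = {}")
      case True
      then show ?thesis
        using \<delta> by (simp add: B_def)
    next
      case False
      then have q: "0 < real (card Q)"
        by (simp add: card_gt_0_iff)
      have "prob B \<le> sqrt 2 * exp (- c / (4 * v * real (card Q)))"
        unfolding B_def using False sub_gaussian_sum_square_tail[OF Z v _ False, of c] by simp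
      also have "- c / (4 * v * real (card Q)) = - (5 / 2) * ln (1 / \<delta>)"
        using v q False by (simp add: c_def field_simps)
      also have "sqrt 2 * exp (- (5 / 2) * ln (1 / \<delta>)) \<le> sqrt 2 * (\<delta> * \<delta>)"
      proof -
        have "exp (- (5 / 2) * ln (1 / \<delta>)) \<le> exp (- ln (1 / \<delta>) + - ln (1 / \<delta>))"
          using ln1 by simp
        also have "\<dots> = \<delta> * \<delta>"
          using \<delta> unfolding exp_add by (simp add: ln_div)
        finally show ?thesis
          by simp
      qed
      also have "sqrt 2 * (\<delta> * \<delta>) < 2 * (\<delta> * (1 / 2))"
      proof -
        have "sqrt 2 * (\<delta> * \<delta>) \<le> 2 * (\<delta> * \<delta>)"
          using \<delta> sqrt2_less_2 by (intro mult_right_mono) auto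
        also have "\<dots> < 2 * (\<delta> * (1 / 2))"
          using \<delta> by (intro mult_strict_left_mono) auto
        finally show ?thesis .
      qed
      finally show ?thesis
        by simp
    qed
    have "prob (space M - E) \<le> prob ((\<Union>j\<in>UNIV. {w \<in> space M. T < \<bar>Z j w\<bar>}) \<union> B)"
    proof (rule finite_measure_mono)
      show "space M - E \<subseteq> (\<Union>j\<in>UNIV. {w \<in> space M. T < \<bar>Z j w\<bar>}) \<union> B"
      proof
        fix w assume w: "w \<in> space M - E"
        show "w \<in> (\<Union>j\<in>UNIV. {w \<in> space M. T < \<bar>Z j w\<bar>}) \<union> B"
        proof (cases "\<forall>j. \<bar>Z j w\<bar> \<le> T")
          case True
          then have "c < (\<Sum>j\<in>Q. (Z j w)\<^sup>2)"
            using w by (auto simp: E_def)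
          moreover from this have "Q \<noteq> {}"
            by (auto simp: c_def)
          ultimately show ?thesis
            using w by (simp add: B_def)
        next
          case False
          then show ?thesis
            using w by (auto simp: not_le)
        qed
      qed
    qed measurable
    also have "\<dots> \<le> prob (\<Union>j\<in>UNIV. {w \<in> space M. T < \<bar>Z j w\<bar>}) + prob B"
      by (intro measure_Un_le) measurable
    also have "prob (\<Union>j\<in>UNIV. {w \<in> space M. T < \<bar>Z j w\<bar>}) \<le> (\<Sum>j\<in>UNIV. prob {w \<in> space M. T < \<bar>Z j w\<bar>})"
      by (intro finite_measure_subadditive_finite) auto
    also have "\<dots> \<le> (\<Sum>j\<in>(UNIV::'d set). \<delta> / ?d)"
      by (intro sum_mono PT)
    also have "\<dots> = \<delta>"
      using d by simp
    finally have "prob (space M - E) < 2 * \<delta>"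
      using PB by simp
    then show ?thesis
      using prob_compl[OF E] by simp
  qed
  then show ?thesis
    using E by (intro bexI[of _ E]) (auto simp: E_def T_def c_def)
qed

text \<open>For \<open>A = 0\<close> both \<open>\<omega>\<close> and \<open>\<mu>\<close> vanish, and the condition would read \<open>\<infinity> \<le> t\<close>.\<close>

lemma stage1_condition_imp_gram_nonzero:
  fixes A :: "real^'d^'d"
  assumes \<alpha>: "0 < \<alpha>" and lam: "0 < lam" and s: "0 < s" and l: "s + l \<le> CARD('d)" and p: "1 \<le> p"
    and cond: "ratio 16 (ereal \<alpha> * omega_coef p A (s + l))
              * ereal (real s powr real_of_ereal (1 / p)) * ereal lam \<le> ereal t \<or>
          ratio 16 (ereal \<alpha> * mu_coef p A (s + l))
              * ereal (real (s + l) powr real_of_ereal (1 / p)) * ereal lam \<le> ereal t"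
  shows "A \<noteq> 0"
proof
  assume A0: "A = 0"
  then have sub: "sub_matrix A I I *v v = 0" for I v
    by (simp add: sub_matrix_mult restr_zero)
  have sl: "1 \<le> s + l" "s + l \<le> CARD('d)"
    using s l by auto
  obtain v :: "real^'d" and I where v: "card I = s + l" "vec_on I v" "v \<noteq> 0"
    using block_vectors_nonempty[OF sl] by auto
  note pos = lp_norm_pos[OF p v(3)] dual_scale_pos[OF p v(3)]
  show False
    using cond
  proof
    assume c: "ratio 16 (ereal \<alpha> * omega_coef p A (s + l))
              * ereal (real s powr real_of_ereal (1 / p)) * ereal lam \<le> ereal t"
    obtain m where m: "omega_coef p A (s + l) = ereal m" "0 \<le> m"
      "m * (dual_scale p v * lp_norm p v) \<le> max 0 (v \<bullet> (sub_matrix A I I *v dual_power p v))"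
      using omega_coef_real[OF p sl, of A] v by metis
    have "0 < m"
      using c[unfolded m(1)] s by (intro ratio_condition(1)[OF \<alpha> m(2) _ lam]) auto
    then have "0 < m * (dual_scale p v * lp_norm p v)"
      using pos by simp
    then show False
      using m(3) by (simp add: sub)
  next
    assume c: "ratio 16 (ereal \<alpha> * mu_coef p A (s + l))
              * ereal (real (s + l) powr real_of_ereal (1 / p)) * ereal lam \<le> ereal t"
    obtain m where m: "mu_coef p A (s + l) = ereal m" "0 \<le> m"
      "m * lp_norm p v \<le> lp_norm p (sub_matrix A I I *v v)"
      using mu_coef_real[OF p sl, of A] v by metis
    have "0 < m"
      using c[unfolded m(1)] s by (intro ratio_condition(1)[OF \<alpha> m(2) _ lam]) auto
    then have "0 < m * lp_norm p v"
      using pos by simp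
    then show False
      using m(3) by (simp add: sub lp_norm_zero[OF p])
  qed
qed

text \<open>With \<open>m = 0\<close> the right-hand side is infinite unless \<open>c = 0\<close>, when it is \<open>f\<close>.\<close>

lemma le_ratio_bound:
  fixes t m c e f :: real
  assumes "0 < t" "0 \<le> m" "0 \<le> c"
    and "0 < m \<Longrightarrow> e \<le> 8 / (t * m) * c + f" and "m = 0 \<Longrightarrow> c = 0 \<Longrightarrow> e \<le> f"
  shows "ereal e \<le> ratio 8 (ereal t * ereal m) * ereal c + ereal f"
proof (cases "m = 0")
  case True
  then have "ratio 8 (ereal t * ereal m) = \<infinity>"
    by (simp add: ratio_def zero_ereal_def[symmetric])
  then show ?thesis
    using assms True by (cases "c = 0") (auto simp: zero_ereal_def[symmetric])
next
  case False
  then have "ratio 8 (ereal t * ereal m) = ereal (8 / (t * m))"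
    using assms ratio_ereal[of "t * m" 8] by simp
  then show ?thesis
    using assms False by simp
qed

lemma sub_gaussian_noise_corr:
  fixes x :: "nat \<Rightarrow> real^'d"
  assumes "prob_space M" and indep: "prob_space.indep_vars M (\<lambda>_. borel) y {1..n}"
    and sg: "\<And>i. i \<in> {1..n} \<Longrightarrow> sub_gaussian M (\<sigma>\<^sup>2) (\<lambda>w. y i w - \<beta> \<bullet> x i)"
    and a: "a = sqrt (SUP j. gram n x $ j $ j)"
  shows "sub_gaussian M (\<sigma>\<^sup>2 * a\<^sup>2 / real n) (\<lambda>w. noise_corr n x (\<lambda>i. y i w) \<beta> $ j)"
proof -
  interpret prob_space M by fact
  have diag: "gram n x $ j $ j = (\<Sum>i=1..n. (x i $ j)\<^sup>2) / real n" for j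
    by (simp add: gram_def power2_eq_square)
  have le: "gram n x $ j $ j \<le> (SUP j. gram n x $ j $ j)"
    by (rule cSUP_upper) auto
  have "0 \<le> gram n x $ j $ j"
    unfolding diag by (simp add: sum_nonneg)
  then have a2: "gram n x $ j $ j \<le> a\<^sup>2"
    using le a by simp
  have comb: "sub_gaussian M (\<sigma>\<^sup>2 * (\<Sum>i=1..n. (x i $ j / real n)\<^sup>2))
      (\<lambda>w. \<Sum>i=1..n. x i $ j / real n * (y i w - \<beta> \<bullet> x i))"
    by (rule sub_gaussian_linear_combination[OF _ indep sg]) auto
  have eq: "(\<lambda>w. \<Sum>i=1..n. x i $ j / real n * (y i w - \<beta> \<bullet> x i)) = (\<lambda>w. noise_corr n x (\<lambda>i. y i w) \<beta> $ j)"
    by (simp add: noise_corr_def sum_divide_distrib)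
  have le: "\<sigma>\<^sup>2 * (\<Sum>i=1..n. (x i $ j / real n)\<^sup>2) \<le> \<sigma>\<^sup>2 * a\<^sup>2 / real n"
  proof -
    have "(\<Sum>i=1..n. (x i $ j / real n)\<^sup>2) = gram n x $ j $ j / real n"
      unfolding diag by (simp add: sum_divide_distrib power2_eq_square)
    also have "\<dots> \<le> a\<^sup>2 / real n"
      using a2 by (rule divide_right_mono) simp
    finally show ?thesis
      using mult_left_mono[of _ _ "\<sigma>\<^sup>2"] by fastforce
  qed
  show ?thesis
    using sub_gaussian_mono[OF comb le] unfolding eq .
qed

text \<open>The deterministic part for \<open>lam > 0\<close>. An entrywise error of at most \<open>\<alpha> / 2\<close> puts the selected set between \<open>Q\<close> and \<open>K\<close>: an entry
above \<open>3 / 2 * \<alpha>\<close> is selected, and a selected entry exceeds \<open>\<alpha> / 2 \<ge> lam\<close>.\<close>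

lemma selection_error_bound:
  fixes x :: "nat \<Rightarrow> real^'d" and \<beta> b b' :: "real^'d"
  assumes A: "A = gram n x" and s: "card {j. \<beta> $ j \<noteq> 0} = s"
    and lam: "0 < lam" "lam \<le> 0.5 * \<alpha>" "4 * (2 - t) * \<tau> \<le> t * lam"
    and k: "k = card (supp_above lam \<beta>)" and q: "q = card (supp_above (1.5 * \<alpha>) \<beta>)"
    and z: "\<And>j. \<bar>noise_corr n x Y \<beta> $ j\<bar> \<le> \<tau>"
    and nz_le: "norm (restr (supp_above (1.5 * \<alpha>) \<beta>) (noise_corr n x Y \<beta>)) \<le> nz" "10 * nz \<le> 8 * e"
    and b: "stage1 n x Y lam b" and b': "stage2 n x Y lam \<alpha> b b'"
    and l: "1 \<le> l" "s \<le> l" "s + 2 * l \<le> CARD('d)" and t: "0 < t" "t < 1" and p: "1 \<le> p"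
    and cond2: "ereal t \<le> 1 - pi_coef 2 A (k + l) l * ereal (sqrt (real k)) / ereal (real l)"
    and selection: "ratio 16 (ereal \<alpha> * omega_coef p A (s + l))
              * ereal (real s powr real_of_ereal (1 / p)) * ereal lam \<le> ereal t \<and>
            ereal t \<le> 1 - pi_coef p A (s + l) l
              * ereal (real s powr (1 - real_of_ereal (1 / p))) / ereal (real l)
          \<or>
          ratio 16 (ereal \<alpha> * mu_coef p A (s + l))
              * ereal (real (s + l) powr real_of_ereal (1 / p)) * ereal lam \<le> ereal t \<and>
            ereal t \<le> 1 - gamma_coef p A (s + l) l
              * ereal (real s powr (1 - real_of_ereal (1 / p))) / ereal (real l)"
  shows "ereal (norm (b' - \<beta>)) \<le>
           ratio 8 (ereal t * mu_coef 2 A (k + l)) *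
             (5 * rho_coef 2 A (k + l) * ereal (tail_norm 2 k \<beta>)
              + ereal (sqrt (real k - real q) * lam) + ereal e)
           + ereal (8 * tail_norm 2 k \<beta>)"
proof -
  define z where "z = noise_corr n x Y \<beta>"
  define Q where "Q = supp_above (1.5 * \<alpha>) \<beta>"
  define K where "K = supp_above lam \<beta>"
  have \<alpha>: "0 < \<alpha>"
    using lam by simp
  have st1: "stationary A z lam UNIV \<beta> b"
    using arg_min_stationary[of lam n x Y UNIV b \<beta>] b lam A by (simp add: stage1_def z_def)
  have st2: "stationary A z lam (- supp_above \<alpha> b) \<beta> b'"
    using arg_min_stationary[of lam n x Y "- supp_above \<alpha> b" b' \<beta>] b' lam A by (simp add: stage2_def z_def)
  have err: "\<bar>b $ j - \<beta> $ j\<bar> \<le> \<alpha> / 2" for j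
    by (rule stage1_sup_error[OF A st1 z[folded z_def] lam(1,3) \<alpha> s l(1,3) t p selection])
  have QF: "Q \<subseteq> supp_above \<alpha> b"
  proof
    fix j assume "j \<in> Q"
    then have "1.5 * \<alpha> < \<bar>\<beta> $ j\<bar>"
      by (simp add: Q_def supp_above_def)
    then have "\<alpha> < \<bar>b $ j\<bar>"
      using err[of j] by linarith
    then show "j \<in> supp_above \<alpha> b"
      by (simp add: supp_above_def)
  qed
  have FK: "supp_above \<alpha> b \<subseteq> K"
  proof
    fix j assume "j \<in> supp_above \<alpha> b"
    then have "\<alpha> < \<bar>b $ j\<bar>"
      by (simp add: supp_above_def)
    then have "lam < \<bar>\<beta> $ j\<bar>"
      using err[of j] lam(2) by linarith
    then show "j \<in> K"
      by (simp add: K_def supp_above_def)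
  qed
  have K0: "K \<subseteq> {j. \<beta> $ j \<noteq> 0}"
    using lam(1) by (auto simp: K_def supp_above_def)
  have kl: "1 \<le> k + l" "k + l \<le> CARD('d)"
  proof -
    have "k \<le> s"
      using card_mono[OF _ K0] s k by (simp add: K_def)
    then show "1 \<le> k + l" "k + l \<le> CARD('d)"
      using l by auto
  qed
  obtain \<rho> where rho: "rho_coef 2 A (k + l) = ereal \<rho>"
    using rho_coef_real[OF kl, of A] by metis
  have "(1 :: ereal) \<le> 2"
    by simp
  then obtain m where mu: "mu_coef 2 A (k + l) = ereal m"
    using mu_coef_real[OF _ kl, of 2 A] by metis
  interpret second_stage n x A z lam \<tau> t nz "- supp_above \<alpha> b" K Q \<beta> b' s l \<rho> m
  proof
    show "norm (restr Q z) \<le> nz"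
      using nz_le(1) by (simp add: Q_def z_def)
  qed (use A st2 z lam t QF FK K0 s l rho mu cond2 k in \<open>auto simp: z_def K_def\<close>)
  have r: "tail_norm 2 k \<beta> = r"
    using tail_norm_eq[of lam \<beta>] unfolding r_def k K_def[symmetric] .
  have kq: "sqrt (real k - real q) = sqrt (real (card K) - real (card Q))"
    by (simp add: k q K_def Q_def)
  let ?S = "sqrt (real k - real q) * lam"
  have "card Q \<le> card K"
    using QF FK by (intro card_mono) auto
  then have S: "0 \<le> ?S"
    using lam(1) unfolding kq by simp
  have e: "0 \<le> e"
    using nz_le(2) nonneg(5) by simp
  \<comment> \<open>The factor \<open>3 / 4\<close> in \<open>N\<close> and the margin between \<open>nz\<close> and \<open>e\<close> absorb the constant \<open>10\<close> of the error bound.\<close>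
  have N: "10 * N \<le> 8 * (?S + e)"
    using nz_le(2) S by (simp add: N_def kq algebra_simps)
  have \<rho>r: "0 \<le> \<rho> * r"
    using rho_bound(1) nonneg(1) by simp
  have "ereal (norm (b' - \<beta>)) \<le> ratio 8 (ereal t * ereal m) * ereal (5 * (\<rho> * r) + ?S + e) + ereal (8 * r)"
  proof (rule le_ratio_bound[OF t(1) mu_bound(1)])
    show "0 \<le> 5 * (\<rho> * r) + ?S + e"
      using \<rho>r S e by simp
    assume m0: "0 < m"
    have "(10 * N + 40 * (\<rho> * r)) / (t * m) \<le> (8 * (5 * (\<rho> * r) + ?S + e)) / (t * m)"
      using N t m0 by (intro divide_right_mono) auto
    then show "norm (b' - \<beta>) \<le> 8 / (t * m) * (5 * (\<rho> * r) + ?S + e) + 8 * r"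
      using error_bound[OF m0] by simp
  next
    assume "5 * (\<rho> * r) + ?S + e = 0"
    then have zero: "\<rho> * r = 0" "?S + e = 0"
      using \<rho>r S e by linarith+
    then have N0: "N = 0"
      using N nonneg(3) by simp
    have "r = 0"
    proof (rule ccontr)
      assume r0: "r \<noteq> 0"
      then have "A = 0"
        using zero(1) rho_zero_imp_gram_zero by simp
      have "{j. \<beta> $ j \<noteq> 0} \<noteq> {}"
        using r0 by (auto simp: r_def vec_eq_iff split: if_splits)
      then have s0: "0 < s"
        using s by (metis card_gt_0_iff finite)
      have sl: "s + l \<le> CARD('d)"
        using l by simp
      have "A \<noteq> 0"
        by (rule stage1_condition_imp_gram_nonzero[OF \<alpha> lam(1) s0 sl p
              disj_forward[OF selection conjunct1 conjunct1]])
      then show False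
        using \<open>A = 0\<close> by simp
    qed
    then show "norm (b' - \<beta>) \<le> 8 * r"
      using error_bound_degenerate[OF N0] by simp
  qed
  also have "ereal (5 * (\<rho> * r) + ?S + e) =
      5 * rho_coef 2 A (k + l) * ereal (tail_norm 2 k \<beta>) + ereal ?S + ereal e"
    unfolding rho r by simp
  finally show ?thesis
    unfolding mu r .
qed

text \<open>Without noise and penalty both stages have the same objective, and \<open>\<beta>\<close> minimises it.\<close>

lemma noiseless_unpenalized_estimates:
  fixes x :: "nat \<Rightarrow> real^'d" and \<beta> b b' :: "real^'d"
  assumes z: "noise_corr n x Y \<beta> = 0" and unique: "\<exists>!b. stage1 n x Y 0 b"
    and b': "stage2 n x Y 0 \<alpha> b b'"
  shows "b' = \<beta>"
proof -
  have "penalized_loss n x Y 0 P c = (\<Sum>i=1..n. (\<beta> \<bullet> x i - Y i)\<^sup>2) / real n + (pred_norm n x (c - \<beta>))\<^sup>2" for P c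
    using squared_loss_shift[of \<beta> "c - \<beta>" x Y n \<beta>] z
    by (simp add: penalized_loss_def pred_norm_power2)
  moreover have "pred_norm n x 0 = 0"
    by (simp add: pred_norm_def L2_set_def)
  ultimately have "stage1 n x Y 0 \<beta>" "stage1 n x Y 0 b'"
    using b' by (simp_all add: stage1_def stage2_def is_arg_min_def not_less)
  then show ?thesis
    using unique by blast
qed

theorem theorem8p1:
  fixes M :: "'w measure"
    and n s k q :: nat
    and x :: "nat \<Rightarrow> real^'d"
    and y :: "nat \<Rightarrow> 'w \<Rightarrow> real"
    and \<sigma> a lam \<alpha> \<delta> :: real
    and A :: "real^'d^'d"
    and \<beta> :: "real^'d"
  assumes "prob_space M"
    and "n \<ge> 1"
    and "prob_space.indep_vars M (\<lambda>_. borel) y {1..n}"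
    and "\<And>i. i \<in> {1..n} \<Longrightarrow> integrable M (y i)"
    and "\<sigma> \<ge> 0"
    and "\<And>i t. i \<in> {1..n} \<Longrightarrow>
           integrable M (\<lambda>w. exp (t * (y i w - prob_space.expectation M (y i)))) \<and>
           prob_space.expectation M (\<lambda>w. exp (t * (y i w - prob_space.expectation M (y i))))
             \<le> exp (\<sigma>\<^sup>2 * t\<^sup>2 / 2)"
    and "A = gram n x"
    and "a = sqrt (SUP j. A $ j $ j)"
    and "\<And>i. i \<in> {1..n} \<Longrightarrow> prob_space.expectation M (y i) = \<beta> \<bullet> x i"
    and "card {j. \<beta> $ j \<noteq> 0} = s"
    and "lam \<ge> 0"
    and "\<alpha> \<ge> 0"
    and "lam = 0 \<Longrightarrow> \<forall>w\<in>space M. \<exists>!b. stage1 n x (\<lambda>i. y i w) lam b"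
    and "k = card (supp_above lam \<beta>)"
    and "q = card (supp_above (1.5 * \<alpha>) \<beta>)"
    and "0 < \<delta>" and "\<delta> < 0.5"
  shows "\<exists>E \<in> sets M. measure M E > 1 - 2 * \<delta> \<and>
    (\<forall>w\<in>E. \<forall>b b'. stage1 n x (\<lambda>i. y i w) lam b \<longrightarrow> stage2 n x (\<lambda>i. y i w) lam \<alpha> b b' \<longrightarrow>
      (\<forall>(l::nat) (t::real) (p::ereal).
         1 \<le> l \<longrightarrow> s \<le> l \<longrightarrow> real l \<le> (real CARD('d) - real s) / 2 \<longrightarrow>
         0 < t \<longrightarrow> t < 1 \<longrightarrow> 1 \<le> p \<longrightarrow>
         ereal t \<le> 1 - pi_coef 2 A (k + l) l * ereal (sqrt (real k)) / ereal (real l) \<longrightarrow>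
         0.5 * \<alpha> \<ge> lam \<longrightarrow>
         lam \<ge> 4 * (2 - t) / t * \<sigma> * a * sqrt (2 * ln (2 * real CARD('d) / \<delta>) / real n) \<longrightarrow>
         (ratio 16 (ereal \<alpha> * omega_coef p A (s + l))
              * ereal (real s powr real_of_ereal (1 / p)) * ereal lam \<le> ereal t \<and>
            ereal t \<le> 1 - pi_coef p A (s + l) l
              * ereal (real s powr (1 - real_of_ereal (1 / p))) / ereal (real l)
          \<or>
          ratio 16 (ereal \<alpha> * mu_coef p A (s + l))
              * ereal (real (s + l) powr real_of_ereal (1 / p)) * ereal lam \<le> ereal t \<and>
            ereal t \<le> 1 - gamma_coef p A (s + l) l
              * ereal (real s powr (1 - real_of_ereal (1 / p))) / ereal (real l)) \<longrightarrow>
         ereal (norm (b' - \<beta>)) \<le>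
           ratio 8 (ereal t * mu_coef 2 A (k + l)) *
             (5 * rho_coef 2 A (k + l) * ereal (tail_norm 2 k \<beta>)
              + ereal (sqrt (real k - real q) * lam)
              + ereal (a * \<sigma> * (1 + sqrt (20 * ln (1 / \<delta>))) * sqrt (real q / real n)))
           + ereal (8 * tail_norm 2 k \<beta>)))"
proof -
  interpret prob_space M by fact
  let ?d = "real CARD('d)"
  define v where "v = \<sigma>\<^sup>2 * a\<^sup>2 / real n"
  define Q where "Q = supp_above (1.5 * \<alpha>) \<beta>"
  define z where "z w = noise_corr n x (\<lambda>i. y i w) \<beta>" for w
  have sg: "sub_gaussian M (\<sigma>\<^sup>2) (\<lambda>w. y i w - \<beta> \<bullet> x i)" if "i \<in> {1..n}" for i
    unfolding sub_gaussian_def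
  proof (intro conjI allI)
    show "(\<lambda>w. y i w - \<beta> \<bullet> x i) \<in> borel_measurable M"
      using borel_measurable_integrable[OF assms(4)[OF that]] by simp
    fix \<theta>
    show "(\<integral>\<^sup>+w. ennreal (exp (\<theta> * (y i w - \<beta> \<bullet> x i))) \<partial>M) \<le> ennreal (exp (\<sigma>\<^sup>2 * \<theta>\<^sup>2 / 2))"
      using assms(6)[OF that, of \<theta>] unfolding assms(9)[OF that]
      by (subst nn_integral_eq_integral) (auto intro: ennreal_leI)
  qed
  have a: "a = sqrt (SUP j. gram n x $ j $ j)"
    using assms(7,8) by simp
  have "sub_gaussian M v (\<lambda>w. z w $ j)" for j
    unfolding v_def z_def by (rule sub_gaussian_noise_corr[OF assms(1,3) sg a])
  moreover have "0 \<le> v"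
    by (simp add: v_def)
  ultimately obtain E where E: "E \<in> events" "1 - 2 * \<delta> < prob E"
    and zE: "\<And>w j. w \<in> E \<Longrightarrow> \<bar>z w $ j\<bar> \<le> sqrt (v * (2 * ln (2 * ?d / \<delta>)))"
    and zQ: "\<And>w. w \<in> E \<Longrightarrow> (\<Sum>j\<in>Q. (z w $ j)\<^sup>2) \<le> v * (10 * ln (1 / \<delta>)) * real (card Q)"
    using noise_event[of v "\<lambda>j w. z w $ j" \<delta> Q] assms(16,17) by auto
  have diag: "0 \<le> gram n x $ j $ j" for j
    unfolding gram_def by (simp add: sum_nonneg)
  have "0 \<le> (SUP j. gram n x $ j $ j)"
    using diag by (rule order_trans[OF _ cSUP_upper]) auto
  then have a0: "0 \<le> a"
    using a by simp
  define \<tau> where "\<tau> = \<sigma> * a * sqrt (2 * ln (2 * ?d / \<delta>) / real n)"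
  define nz where "nz = \<sigma> * a * sqrt (10 * ln (1 / \<delta>)) * sqrt (real q / real n)"
  define e where "e = a * \<sigma> * (1 + sqrt (20 * ln (1 / \<delta>))) * sqrt (real q / real n)"
  have \<tau>: "\<bar>z w $ j\<bar> \<le> \<tau>" if "w \<in> E" for w j
  proof -
    have "sqrt (v * (2 * ln (2 * ?d / \<delta>))) = \<tau>"
      using assms(5) a0 by (simp add: v_def \<tau>_def real_sqrt_mult real_sqrt_divide)
    then show ?thesis
      using zE[OF that] by metis
  qed
  have nz: "norm (restr Q (z w)) \<le> nz" if "w \<in> E" for w
  proof -
    have "norm (restr Q (z w)) = sqrt (\<Sum>j\<in>Q. (z w $ j)\<^sup>2)"
      unfolding norm_vec_def L2_set_def
      by (intro arg_cong[of _ _ sqrt] sum.mono_neutral_cong_right) auto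
    also have "\<dots> \<le> sqrt (v * (10 * ln (1 / \<delta>)) * real (card Q))"
      using zQ[OF that] by simp
    also have "\<dots> = nz"
      using assms(5,15) a0 by (simp add: v_def nz_def Q_def real_sqrt_mult real_sqrt_divide)
    finally show ?thesis .
  qed
  have nz_e: "10 * nz \<le> 8 * e"
  proof -
    have "0 \<le> ln (1 / \<delta>)"
      using assms(16,17) by simp
    \<comment> \<open>The squared form of \<open>10 * sqrt 10 \<le> 8 * sqrt 20\<close>.\<close>
    then have "sqrt (100 * (10 * ln (1 / \<delta>))) \<le> sqrt (64 * (20 * ln (1 / \<delta>)))"
      by (intro real_sqrt_le_mono) simp
    then have "10 * sqrt (10 * ln (1 / \<delta>)) \<le> 8 * (1 + sqrt (20 * ln (1 / \<delta>)))"
      unfolding real_sqrt_mult[of 100] real_sqrt_mult[of 64] by simp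
    then have "\<sigma> * a * sqrt (real q / real n) * (10 * sqrt (10 * ln (1 / \<delta>))) \<le>
        \<sigma> * a * sqrt (real q / real n) * (8 * (1 + sqrt (20 * ln (1 / \<delta>))))"
      using assms(5) a0 by (intro mult_left_mono) auto
    then show ?thesis
      unfolding nz_def e_def by (simp only: mult_ac)
  qed
  have e0: "0 \<le> e"
    using assms(5) a0 assms(16,17) by (simp add: e_def)
  show ?thesis
  proof (intro bexI[OF _ E(1)] conjI E(2) ballI allI impI)
    fix w b b' l p and t :: real
    assume w: "w \<in> E" and b: "stage1 n x (\<lambda>i. y i w) lam b" and b': "stage2 n x (\<lambda>i. y i w) lam \<alpha> b b'"
      and l: "1 \<le> l" "s \<le> l" "real l \<le> (real CARD('d) - real s) / 2"
      and t: "0 < t" "t < 1" and p: "1 \<le> p"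
      and cond2: "ereal t \<le> 1 - pi_coef 2 A (k + l) l * ereal (sqrt (real k)) / ereal (real l)"
      and lam: "lam \<le> 0.5 * \<alpha>"
        "4 * (2 - t) / t * \<sigma> * a * sqrt (2 * ln (2 * real CARD('d) / \<delta>) / real n) \<le> lam"
      and cond: "ratio 16 (ereal \<alpha> * omega_coef p A (s + l))
              * ereal (real s powr real_of_ereal (1 / p)) * ereal lam \<le> ereal t \<and>
            ereal t \<le> 1 - pi_coef p A (s + l) l
              * ereal (real s powr (1 - real_of_ereal (1 / p))) / ereal (real l)
          \<or>
          ratio 16 (ereal \<alpha> * mu_coef p A (s + l))
              * ereal (real (s + l) powr real_of_ereal (1 / p)) * ereal lam \<le> ereal t \<and>
            ereal t \<le> 1 - gamma_coef p A (s + l) l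
              * ereal (real s powr (1 - real_of_ereal (1 / p))) / ereal (real l)"
    have l2: "s + 2 * l \<le> CARD('d)"
      using l(3) by simp
    have lam\<tau>: "4 * (2 - t) * \<tau> \<le> t * lam"
      using lam(2) t by (simp add: \<tau>_def field_simps)
    show "ereal (norm (b' - \<beta>)) \<le>
           ratio 8 (ereal t * mu_coef 2 A (k + l)) *
             (5 * rho_coef 2 A (k + l) * ereal (tail_norm 2 k \<beta>)
              + ereal (sqrt (real k - real q) * lam)
              + ereal (a * \<sigma> * (1 + sqrt (20 * ln (1 / \<delta>))) * sqrt (real q / real n)))
           + ereal (8 * tail_norm 2 k \<beta>)"
    proof (cases "lam = 0")
      case False
      then have "0 < lam"
        using assms(11) by simp
      then show ?thesis
        unfolding e_def[symmetric]
        by (rule selection_error_bound[OF assms(7,10) _ lam(1) lam\<tau> assms(14,15) \<tau>[OF w, unfolded z_def]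
              nz[OF w, unfolded z_def Q_def] nz_e b b' l(1,2) l2 t p cond2 cond])
    next
      case True
      have "\<tau> \<le> 0"
        using lam\<tau> True t by (simp add: mult_le_0_iff)
      then have "\<bar>z w $ j\<bar> \<le> 0" for j
        using \<tau>[OF w, of j] by linarith
      then have z0: "noise_corr n x (\<lambda>i. y i w) \<beta> = 0"
        by (simp add: z_def vec_eq_iff)
      have "w \<in> space M"
        using w E(1) sets.sets_into_space by blast
      then have "b' = \<beta>"
        using noiseless_unpenalized_estimates[OF z0 _ b'[unfolded True]] assms(13)[OF True] True by simp
      moreover have "1 \<le> k + l" "k + l \<le> CARD('d)"
      proof -
        have "k \<le> s"
          unfolding assms(14) assms(10)[symmetric] by (intro card_mono) (auto simp: supp_above_def True)
        then show "1 \<le> k + l" "k + l \<le> CARD('d)"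
          using l l2 by auto
      qed
      note kl = this
      obtain \<rho> where \<rho>: "rho_coef 2 A (k + l) = ereal \<rho>" "0 \<le> \<rho>"
        using rho_coef_real[OF kl, of A] by metis
      have "(1 :: ereal) \<le> 2"
        by simp
      then obtain m where m: "mu_coef 2 A (k + l) = ereal m" "0 \<le> m"
        using mu_coef_real[OF _ kl, of 2 A] by metis
      have r: "0 \<le> tail_norm 2 k \<beta>"
        by (simp add: tail_norm_def)
      have "ereal 0 \<le> ratio 8 (ereal t * ereal m) * ereal (5 * \<rho> * tail_norm 2 k \<beta> + e) + ereal (8 * tail_norm 2 k \<beta>)"
        using r \<rho>(2) e0 t m(2) by (intro le_ratio_bound) auto
      ultimately show ?thesis
        unfolding e_def[symmetric] \<rho>(1) m(1) by (simp add: True)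
    qed
  qed
qed

end
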